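(* Consider the planar piecewise-smooth system $(\dot x,\dot y)=(X^+(x,y),Y^+(x,y))$ for $y>0$, $(\dot x,\dot y)=(X^-(x,y),Y^-(x,y))$ for $y<0$, where $X^\pm,Y^\pm$ are real analytic and the origin $O$ is a monodromic singular point of FF, FP or PP type. Let $\{V_k\}_{k=1}^{+\infty}$ be its Lyapunov constant series. Then $\{V_k\}_{k=1}^{+\infty}$ is algebraically equivalent to the normal form coefficient series of the system, namely to (i) $\{\gamma_k^++(-1)^{k-1}\gamma_k^-\}_{k=1}^{+\infty}$ if $O$ is of FF type; (ii) $\{\gamma_k^+\}_{k=1}^{+\infty}$ if $O$ is of FP type; (iii) $\{(1+(-1)^k)\sigma_k^+\}_{k=1}^{+\infty}$ if $O$ is of PP type. That is, the first nonzero quantities of the two series share the same subscript and differ by a positive constant multiple.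
   Context: Orbits are understood in Filippov's sense. The system with $(X^+,Y^+)$ (resp. $(X^-,Y^-)$) is called the upper (resp. lower) subsystem; both vector fields are regarded as defined in a full neighborhood of $O=(0,0)$. **Monodromic singular point.** $O$ is monodromic if no orbits approach it in a definite direction as $t\to\pm\infty$. Nearby orbits are assumed to rotate counterclockwise around $O$ (if they rotate clockwise, first apply the reflection $(x,y)\mapsto(-x,y)$). **Types.** A subsystem is of focus type if $O$ is a linear focus of it, i.e. an equilibrium whose Jacobian matrix has eigenvalues $\alpha\pm\beta i$ with $\beta\neq0$. A subsystem $(X,Y)$ is of parabolic type if $O$ is an invisible tangent point of multiplicity $2\ell-1$, $\ell\in\mathbb Z^+$: $Y(0,0)=\partial_xY(0,0)=\dots=\partial_x^{2\ell-2}Y(0,0)=0$, and $X(0,0)\,\partial_x^{2\ell-1}Y(0,0)<0$ for the upper subsystem, $>0$ for the lower subsystem. Write $\ell=\ell^\pm$ for the upper/lower subsystem. The monodromic point $O$ is of FF type if both subsystems are of focus type, of FP type if the upper one is of focus type and the lower one of parabolic type, and of PP type if both are of parabolic type. **Lyapunov constants.** For small $x>0$ the orbit starting at $(x,0)$ first meets the negative $x$-axis at $(\Pi^+(x),0)$ after travelling in $y>0$; for small $x<0$ the orbit starting at $(x,0)$ first meets the positive $x$-axis at $(\Pi^-(x),0)$ after travelling in $y<0$; set $\Pi^\pm(0)=0$. The Lyapunov constants $V_k$ are the coefficients in the expansion at $x=0$ of $$\Delta(x):=(\Pi^-)^{-1}(x)-\Pi^+(x)=\sum_{k\ge1}V_kx^k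 .$$ **Algebraic equivalence.** Two real series $\{U_k\}_{k\ge1}$, $\{W_k\}_{k\ge1}$ are algebraically equivalent if the first nonzero quantities of the two series have the same subscript and differ by a positive constant multiple (in particular, one series vanishes identically if and only if the other does). **Normal forms.** It is known that for every positive integer $N$ one can find a piecewise change of coordinates (old coordinates expressed through new ones) $$\begin{pmatrix} x \\ y \end{pmatrix}\to\begin{pmatrix} 1&q_2^\pm \\ 0&q_1^\pm \end{pmatrix}\begin{pmatrix} x \\ y \end{pmatrix}+\begin{pmatrix} \Phi^\pm(x,y) \\ \Psi^\pm(x,y) \end{pmatrix}$$ (sign $+$ for $y\ge0$, sign $-$ for $y\le0$), with $q_1^\pm>0$, $\Phi^\pm,\Psi^\pm$ analytic near $O$ and $O(|(x,y)|^2)$, $\Phi^+(x,0)=\Phi^-(x,0)$, $\Psi^\pm(x,0)=0$, and a time scaling $\mathrm dt\to K^\pm(x,y)\,\mathrm dt$ (sign $+$ for $y\ge0$, sign $-$ for $y\le0$) with $K^\pm(x,y)>0$, which carry the system to one of the following normal forms. FF type: for $\pm y>0$ respectively, $$\begin{pmatrix} \dot x \\ \dot y \end{pmatrix}=\begin{pmatrix} \gamma_1^\pm&-1 \\ 1&\gamma_1^\pm \end{pmatrix}\begin{pmatrix} x \\ y \end{pmatrix}+\sum_{i=1}^N\gamma_{i+1}^\pm y^i\begin{pmatrix} x \\ y \end{pmatrix}+\boldsymbol G_{N+2}^\pm(x,y).$$ FP type: for $y>0$, the same form as in the FF case with sign $+$; for $y<0$, $$\begin{pmatrix} \dot x \\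 \dot y \end{pmatrix}=\begin{pmatrix} 1 \\ x^{2\ell^--1} \end{pmatrix}+\boldsymbol R_N^-(x,y).$$ PP type: for $y>0$, $$\begin{pmatrix} \dot x \\ \dot y \end{pmatrix}=\begin{pmatrix} -1 \\ x^{2\ell^+-1}+\sum_{i=1}^N\sigma_{i+1}^+x^{2\ell^+-1+i} \end{pmatrix}+\boldsymbol R_N^+(x,y);$$ for $y<0$, the same form as for $y<0$ in the FP case. Here $\boldsymbol G_{N+2}^\pm$ are sums of homogeneous polynomial vector fields of degree $\ge N+2$, and $\boldsymbol R_N^\pm$ are sums of quasi-homogeneous polynomial vector fields of type $(1,2\ell^\pm)$ and degree $\ge N$ (a vector field is quasi-homogeneous of type $(1,2\ell)$ and degree $d$ if, with $x$ of weight $1$ and $y$ of weight $2\ell$, its first component has weighted degree $d+1$ and its second has weighted degree $d+2\ell$). The coefficients $\gamma_k^\pm$ ($k\ge1$) and $\sigma_k^+$ ($k\ge2$) are constructed recursively for increasing $N$, lower-order coefficients being unchanged when $N$ increases, which gives infinite sequences. In the PP case the term of index $k=1$ of $\{(1+(-1)^k)\sigma_k^+\}$ is $0$. The series in (i), (ii), (iii) are called the normal form coefficient series. *)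

theory Defs
  imports "HOL-Analysis.Analysis" "HOL-Library.Landau_Symbols" "Jordan_Normal_Form.Char_Poly"
begin

text \<open>A planar vector field is a total function, but all notions below only depend on its germ
  at the origin. A piecewise-smooth system is a pair \<open>Zp\<close>, \<open>Zm\<close> of fields: \<open>Zp\<close> acts for
  \<open>y > 0\<close> and \<open>Zm\<close> for \<open>y < 0\<close>.\<close>

type_synonym vfield = "real \<times> real \<Rightarrow> real \<times> real"

subsection \<open>Real analytic germs at the origin\<close>

definition expands_at_0 :: "(real \<times> real \<Rightarrow> real) \<Rightarrow> (nat \<Rightarrow> nat \<Rightarrow> real) \<Rightarrow> bool" where
  "expands_at_0 f a \<longleftrightarrow>
     (\<forall>\<^sub>F w in nhds 0. ((\<lambda>(i, j). a i j * fst w ^ i * snd w ^ j) has_sum f w) UNIV)"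

definition analytic_at_0 :: "(real \<times> real \<Rightarrow> real) \<Rightarrow> bool" where
  "analytic_at_0 f \<longleftrightarrow> (\<exists>a. expands_at_0 f a)"

definition analytic_field :: "vfield \<Rightarrow> bool" where
  "analytic_field Z \<longleftrightarrow> analytic_at_0 (\<lambda>w. fst (Z w)) \<and> analytic_at_0 (\<lambda>w. snd (Z w))"

subsection \<open>Filippov orbits\<close>

definition filippov_field :: "vfield \<Rightarrow> vfield \<Rightarrow> real \<times> real \<Rightarrow> (real \<times> real) set" where
  "filippov_field Zp Zm w =
     (if snd w > 0 then {Zp w} else if snd w < 0 then {Zm w} else convex hull {Zp w, Zm w})"

text \<open>Orbits are absolutely continuous curves satisfying the Filippov inclusion almost everywhere
  on the interval \<open>I\<close>; absolute continuity is expressed by a locally Lebesgue integrable velocity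
  \<open>v\<close>.\<close>

definition filippov_orbit ::
    "vfield \<Rightarrow> vfield \<Rightarrow> real set \<Rightarrow> (real \<Rightarrow> real \<times> real) \<Rightarrow> bool" where
  "filippov_orbit Zp Zm I z \<longleftrightarrow>
     (\<exists>v. (\<forall>s\<in>I. \<forall>t\<in>I. s \<le> t \<longrightarrow>
             v absolutely_integrable_on {s..t} \<and> integral {s..t} v = z t - z s) \<and>
          (\<exists>S. negligible S \<and> (\<forall>t\<in>I - S. v t \<in> filippov_field Zp Zm (z t))))"

subsection \<open>Monodromy and orientation\<close>

definition approaches_in_direction ::
    "(real \<Rightarrow> real \<times> real) \<Rightarrow> real filter \<Rightarrow> bool" where
  "approaches_in_direction z F \<longleftrightarrow>
     (\<forall>\<^sub>F t in F. z t \<noteq> 0) \<and> (z \<longlongrightarrow> 0) F \<and> (\<exists>d. ((\<lambda>t. z t /\<^sub>R norm (z t)) \<longlongrightarrow> d) F)"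

definition monodromic :: "vfield \<Rightarrow> vfield \<Rightarrow> bool" where
  "monodromic Zp Zm \<longleftrightarrow>
     (\<nexists>z t0. filippov_orbit Zp Zm {t0..} z \<and> approaches_in_direction z at_top) \<and>
     (\<nexists>z t0. filippov_orbit Zp Zm {..t0} z \<and> approaches_in_direction z at_bot)"

text \<open>Along an orbit the polar angle satisfies \<open>r\<^sup>2 \<theta>' = x y' - y x'\<close>; nearby orbits rotate
  counterclockwise when this is positive for every admissible Filippov velocity.\<close>

definition rotates_ccw :: "vfield \<Rightarrow> vfield \<Rightarrow> bool" where
  "rotates_ccw Zp Zm \<longleftrightarrow>
     (\<forall>\<^sub>F w in at 0. \<forall>v\<in>filippov_field Zp Zm w. fst w * snd v - snd w * fst v > 0)"

text \<open>The field in the reflected coordinates \<open>(-x, y)\<close>.\<close>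

definition reflect_field :: "vfield \<Rightarrow> vfield" where
  "reflect_field Z w = (- fst (Z (- fst w, snd w)), snd (Z (- fst w, snd w)))"

definition ccw_version :: "vfield \<Rightarrow> vfield \<Rightarrow> vfield \<Rightarrow> vfield \<Rightarrow> bool" where
  "ccw_version Zp Zm Wp Wm \<longleftrightarrow>
     rotates_ccw Wp Wm \<and>
     (Wp = Zp \<and> Wm = Zm \<or> Wp = reflect_field Zp \<and> Wm = reflect_field Zm)"

subsection \<open>Types of subsystems\<close>

definition focus_type :: "vfield \<Rightarrow> bool" where
  "focus_type Z \<longleftrightarrow> Z 0 = 0 \<and>
     (\<exists>a b c d \<alpha> \<beta>. (Z has_derivative (\<lambda>(h, k). (a * h + b * k, c * h + d * k))) (at 0) \<and> \<beta> \<noteq> 0 \<and>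
        {e. eigenvalue (mat_of_rows_list 2 [[complex_of_real a, complex_of_real b],
                                            [complex_of_real c, complex_of_real d]]) e}
          = {Complex \<alpha> \<beta>, Complex \<alpha> (- \<beta>)})"

definition dx_Y :: "vfield \<Rightarrow> nat \<Rightarrow> real" where
  "dx_Y Z k = (deriv ^^ k) (\<lambda>x. snd (Z (x, 0))) 0"

text \<open>The parameter \<open>s\<close> is \<open>1\<close> for the upper and \<open>-1\<close> for the lower subsystem.\<close>

definition parabolic_type :: "real \<Rightarrow> vfield \<Rightarrow> nat \<Rightarrow> bool" where
  "parabolic_type s Z l \<longleftrightarrow>
     l \<ge> 1 \<and> (\<forall>k \<le> 2 * l - 2. dx_Y Z k = 0) \<and> s * (fst (Z 0) * dx_Y Z (2 * l - 1)) < 0"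

definition FF_type :: "vfield \<Rightarrow> vfield \<Rightarrow> bool" where
  "FF_type Zp Zm \<longleftrightarrow> focus_type Zp \<and> focus_type Zm"

definition FP_type :: "vfield \<Rightarrow> vfield \<Rightarrow> nat \<Rightarrow> bool" where
  "FP_type Zp Zm lm \<longleftrightarrow> focus_type Zp \<and> parabolic_type (-1) Zm lm"

definition PP_type :: "vfield \<Rightarrow> vfield \<Rightarrow> nat \<Rightarrow> nat \<Rightarrow> bool" where
  "PP_type Zp Zm lp lm \<longleftrightarrow> parabolic_type 1 Zp lp \<and> parabolic_type (-1) Zm lm"

subsection \<open>Half-return maps and Lyapunov constants\<close>

text \<open>The orbit from \<open>(x, 0)\<close> to \<open>(x', 0)\<close> travels in \<open>s y > 0\<close> in between.\<close>

definition travels_to :: "vfield \<Rightarrow> vfield \<Rightarrow> real \<Rightarrow> real \<Rightarrow> real \<Rightarrow> bool" where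
  "travels_to Zp Zm s x x' \<longleftrightarrow>
     (\<exists>T>0. \<exists>z. filippov_orbit Zp Zm {0..T} z \<and> z 0 = (x, 0) \<and> z T = (x', 0) \<and>
              (\<forall>t\<in>{0<..<T}. s * snd (z t) > 0))"

definition half_return_maps ::
    "vfield \<Rightarrow> vfield \<Rightarrow> real \<Rightarrow> (real \<Rightarrow> real) \<Rightarrow> (real \<Rightarrow> real) \<Rightarrow> bool" where
  "half_return_maps Zp Zm \<delta> \<Pi>p \<Pi>m \<longleftrightarrow>
     \<Pi>p 0 = 0 \<and> \<Pi>m 0 = 0 \<and>
     (\<forall>x\<in>{0<..\<delta>}. \<Pi>p x < 0 \<and> travels_to Zp Zm 1 x (\<Pi>p x)) \<and>
     (\<forall>x\<in>{-\<delta>..<0}. \<Pi>m x > 0 \<and> travels_to Zp Zm (-1) x (\<Pi>m x))"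

text \<open>\<open>V k\<close> is the Lyapunov constant of index \<open>k \<ge> 1\<close>; the value \<open>V 0\<close> is irrelevant.\<close>

definition lyapunov_constants :: "vfield \<Rightarrow> vfield \<Rightarrow> (nat \<Rightarrow> real) \<Rightarrow> bool" where
  "lyapunov_constants Zp Zm V \<longleftrightarrow>
     (\<exists>\<delta>>0. \<exists>\<Pi>p \<Pi>m. half_return_maps Zp Zm \<delta> \<Pi>p \<Pi>m \<and> inj_on \<Pi>m {-\<delta>..0} \<and>
        (\<forall>\<^sub>F x in at_right 0. x \<in> \<Pi>m ` {-\<delta>..0} \<and>
           (\<lambda>k. V (Suc k) * x ^ Suc k) sums (the_inv_into {-\<delta>..0} \<Pi>m x - \<Pi>p x)))"

subsection \<open>Normal forms\<close>

text \<open>Sums of homogeneous fields of degree at least \<open>d\<close>.\<close>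

definition homogeneous_from :: "nat \<Rightarrow> vfield \<Rightarrow> bool" where
  "homogeneous_from d G \<longleftrightarrow>
     (\<exists>a b. expands_at_0 (\<lambda>w. fst (G w)) a \<and> expands_at_0 (\<lambda>w. snd (G w)) b \<and>
        (\<forall>i j. i + j < d \<longrightarrow> a i j = 0 \<and> b i j = 0))"

text \<open>Sums of quasi-homogeneous fields of type \<open>(1, 2 l)\<close> and degree at least \<open>d\<close>.\<close>

definition quasi_homogeneous_from :: "nat \<Rightarrow> nat \<Rightarrow> vfield \<Rightarrow> bool" where
  "quasi_homogeneous_from l d R \<longleftrightarrow>
     (\<exists>a b. expands_at_0 (\<lambda>w. fst (R w)) a \<and> expands_at_0 (\<lambda>w. snd (R w)) b \<and>
        (\<forall>i j. i + 2 * l * j < d + 1 \<longrightarrow> a i j = 0) \<and>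
        (\<forall>i j. i + 2 * l * j < d + 2 * l \<longrightarrow> b i j = 0))"

definition focus_normal_form :: "nat \<Rightarrow> (nat \<Rightarrow> real) \<Rightarrow> vfield \<Rightarrow> bool" where
  "focus_normal_form N \<gamma> F \<longleftrightarrow>
     (\<exists>G. homogeneous_from (N + 2) G \<and>
        (\<forall>x y. F (x, y) = (\<gamma> 1 * x - y, x + \<gamma> 1 * y)
                 + (\<Sum>i=1..N. (\<gamma> (i + 1) * y ^ i) *\<^sub>R (x, y)) + G (x, y)))"

definition lower_parabolic_normal_form :: "nat \<Rightarrow> nat \<Rightarrow> vfield \<Rightarrow> bool" where
  "lower_parabolic_normal_form N l F \<longleftrightarrow>
     (\<exists>R. quasi_homogeneous_from l N R \<and>
        (\<forall>x y. F (x, y) = (1, x ^ (2 * l - 1)) + R (x, y)))"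

definition upper_parabolic_normal_form :: "nat \<Rightarrow> nat \<Rightarrow> (nat \<Rightarrow> real) \<Rightarrow> vfield \<Rightarrow> bool" where
  "upper_parabolic_normal_form N l \<sigma> F \<longleftrightarrow>
     (\<exists>R. quasi_homogeneous_from l N R \<and>
        (\<forall>x y. F (x, y) = (-1, x ^ (2 * l - 1) + (\<Sum>i=1..N. \<sigma> (i + 1) * x ^ (2 * l - 1 + i)))
                 + R (x, y)))"

definition coord_map ::
    "real \<Rightarrow> real \<Rightarrow> (real \<times> real \<Rightarrow> real) \<Rightarrow> (real \<times> real \<Rightarrow> real) \<Rightarrow> vfield" where
  "coord_map q1 q2 \<Phi> \<Psi> w = (fst w + q2 * snd w + \<Phi> w, q1 * snd w + \<Psi> w)"

definition admissible_change ::
    "real \<Rightarrow> (real \<times> real \<Rightarrow> real) \<Rightarrow> (real \<times> real \<Rightarrow> real) \<Rightarrow> bool" where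
  "admissible_change q1 \<Phi> \<Psi> \<longleftrightarrow>
     q1 > 0 \<and> analytic_at_0 \<Phi> \<and> analytic_at_0 \<Psi> \<and>
     \<Phi> \<in> O[nhds 0](\<lambda>w. norm w ^ 2) \<and> \<Psi> \<in> O[nhds 0](\<lambda>w. norm w ^ 2) \<and>
     (\<forall>\<^sub>F x in nhds 0. \<Psi> (x, 0) = 0)"

text \<open>Near \<open>O\<close> and for \<open>s y > 0\<close>, the substitution \<open>(old) = T (new)\<close> together with the time
  scaling \<open>dt \<rightarrow> K dt\<close> carries \<open>Z\<close> to \<open>F\<close>: if \<open>w\<close> is the new variable then
  \<open>DT(w) w' = K(w) Z(T(w))\<close> with \<open>w' = F(w)\<close>.\<close>

definition carries_to ::
    "real \<Rightarrow> vfield \<Rightarrow> (real \<times> real \<Rightarrow> real) \<Rightarrow> vfield \<Rightarrow> vfield \<Rightarrow> bool" where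
  "carries_to s T K Z F \<longleftrightarrow>
     (\<forall>\<^sub>F w in nhds 0.
        (s * snd w \<ge> 0 \<longrightarrow> K w > 0) \<and>
        (s * snd w > 0 \<longrightarrow> (\<exists>D. (T has_derivative D) (at w) \<and> D (F w) = K w *\<^sub>R Z (T w))))"

definition transforms_to :: "vfield \<Rightarrow> vfield \<Rightarrow> vfield \<Rightarrow> vfield \<Rightarrow> bool" where
  "transforms_to Zp Zm Fp Fm \<longleftrightarrow>
     (\<exists>q1p q2p \<Phi>p \<Psi>p Kp q1m q2m \<Phi>m \<Psi>m Km.
        admissible_change q1p \<Phi>p \<Psi>p \<and> admissible_change q1m \<Phi>m \<Psi>m \<and>
        (\<forall>\<^sub>F x in nhds 0. \<Phi>p (x, 0) = \<Phi>m (x, 0)) \<and>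
        carries_to 1 (coord_map q1p q2p \<Phi>p \<Psi>p) Kp Zp Fp \<and>
        carries_to (-1) (coord_map q1m q2m \<Phi>m \<Psi>m) Km Zm Fm)"

text \<open>The coefficient sequences are shared by the normal forms of all orders \<open>N\<close>, whereas the
  transformation may depend on \<open>N\<close>. Only \<open>\<gamma> k\<close> with \<open>k \<ge> 1\<close> and \<open>\<sigma> k\<close> with \<open>k \<ge> 2\<close> occur.\<close>

definition FF_normal_form_coeffs ::
    "vfield \<Rightarrow> vfield \<Rightarrow> (nat \<Rightarrow> real) \<Rightarrow> (nat \<Rightarrow> real) \<Rightarrow> bool" where
  "FF_normal_form_coeffs Zp Zm \<gamma>p \<gamma>m \<longleftrightarrow>
     (\<forall>N\<ge>1. \<exists>Fp Fm. focus_normal_form N \<gamma>p Fp \<and> focus_normal_form N \<gamma>m Fm \<and>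
        transforms_to Zp Zm Fp Fm)"

definition FP_normal_form_coeffs :: "vfield \<Rightarrow> vfield \<Rightarrow> nat \<Rightarrow> (nat \<Rightarrow> real) \<Rightarrow> bool" where
  "FP_normal_form_coeffs Zp Zm lm \<gamma>p \<longleftrightarrow>
     (\<forall>N\<ge>1. \<exists>Fp Fm. focus_normal_form N \<gamma>p Fp \<and> lower_parabolic_normal_form N lm Fm \<and>
        transforms_to Zp Zm Fp Fm)"

definition PP_normal_form_coeffs :: "vfield \<Rightarrow> vfield \<Rightarrow> nat \<Rightarrow> nat \<Rightarrow> (nat \<Rightarrow> real) \<Rightarrow> bool" where
  "PP_normal_form_coeffs Zp Zm lp lm \<sigma>p \<longleftrightarrow>
     (\<forall>N\<ge>1. \<exists>Fp Fm. upper_parabolic_normal_form N lp \<sigma>p Fp \<and>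
        lower_parabolic_normal_form N lm Fm \<and> transforms_to Zp Zm Fp Fm)"

subsection \<open>Algebraic equivalence of series indexed from 1\<close>

definition first_nonzero_at :: "(nat \<Rightarrow> real) \<Rightarrow> nat \<Rightarrow> bool" where
  "first_nonzero_at U k \<longleftrightarrow> k \<ge> 1 \<and> U k \<noteq> 0 \<and> (\<forall>j. 1 \<le> j \<and> j < k \<longrightarrow> U j = 0)"

definition algebraically_equivalent :: "(nat \<Rightarrow> real) \<Rightarrow> (nat \<Rightarrow> real) \<Rightarrow> bool" where
  "algebraically_equivalent U W \<longleftrightarrow>
     (\<forall>k\<ge>1. U k = 0) \<and> (\<forall>k\<ge>1. W k = 0) \<or>
     (\<exists>k. first_nonzero_at U k \<and> first_nonzero_at W k \<and> (\<exists>c>0. U k = c * W k))"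

end

theory Submission
  imports Defs
begin

text \<open>
  Only the order and the sign of the first nonzero Lyapunov constant matter, so it suffices to bound
  the difference map from both sides by multiples of \<open>x ^ k\<close>; no expansion of the half-return maps
  is needed. Since the upper and lower coordinate changes agree on the \<open>x\<close>-axis, such bounds carry
  over from normal form coordinates. The given Filippov orbits are pulled back to these coordinates,
  where their velocity is a positive multiple of the normal form field; time is then eliminated.

  For a focus, the orbit is a graph \<open>r(\<theta>)\<close> over \<open>[0, \<pi>]\<close> with
  \<open>r' = \<Sum>j \<gamma> j r ^ j sin \<theta> ^ (j - 1)\<close> up to higher order. Reversing time and reflecting the lower
  half plane multiplies the \<open>j\<close>-th lower coefficient by \<open>(-1) ^ j\<close>, and the difference of the
  two graphs satisfies a linear
  differential equation driven by the first nonzero difference of coefficients times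
  \<open>r ^ k sin \<theta> ^ (k - 1)\<close>, which is positive on \<open>(0, \<pi>)\<close>. For a parabolic point, \<open>y + h(x)\<close> with
  \<open>h' (x) = x ^ (2 l - 1) + \<dots>\<close> is almost conserved, so the exit abscissa \<open>-u\<close> solves
  \<open>h(-u) = h(x)\<close> up to higher order, and only the odd part of \<open>h\<close> moves \<open>u\<close> away from \<open>x\<close>.
\<close>

section \<open>Double power series\<close>

text \<open>A normal form of order \<open>N\<close> is valid only near O, in a chart that may change
  with \<open>N\<close>, and nothing says in advance that a given orbit stays there. The a priori
  bounds hold only while it does, so confinement is a first-exit argument: an orbit that has stayed
  in the closure of a small region, scaled with its starting abscissa \<xi>, is forced strictly
  inside. All constants must therefore be uniform in \<xi>.

  Index \<open>k\<close> is settled with \<open>N = k\<close>. The truncation then moves the exit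
  abscissa only by O(\<xi> ^ (k + 2)): for a focus this is the error of the graph; for a parabolic
  point it is the error \<xi> ^ (k + 2l + 1) of the potential divided by the slope of the potential,
  which is of order \<xi> ^ (2l - 1).

  With two foci the half maps must be compared with each other, since each may leave the identity at
  a lower order than their gap. A lower parabolic side has an even potential, so it is the identity
  to every order needed and drops out. On the axis the charts distort differences by factors between
  1/2 and 3/2, which preserves order and sign of the gap.\<close>

lemma expands_at_0_radius:
  assumes "expands_at_0 f a"
  obtains r where "0 < r" "r \<le> 1"
    "\<And>x y. \<bar>x\<bar> \<le> r \<Longrightarrow> \<bar>y\<bar> \<le> r \<Longrightarrow> ((\<lambda>(i, j). a i j * x ^ i * y ^ j) has_sum f (x, y)) UNIV"
    "(\<lambda>(i, j). \<bar>a i j\<bar> * r ^ (i + j)) summable_on UNIV"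
proof -
  obtain e where e: "e > 0" and
    he: "\<And>w. norm w < e \<Longrightarrow> ((\<lambda>(i, j). a i j * fst w ^ i * snd w ^ j) has_sum f w) UNIV"
    using assms unfolding expands_at_0_def eventually_nhds_metric dist_norm by auto
  define r where "r = min 1 (e / 3)"
  have r: "0 < r" "r \<le> 1" "2 * r < e" using e by (auto simp: r_def)
  have *: "((\<lambda>(i, j). a i j * x ^ i * y ^ j) has_sum f (x, y)) UNIV" if "\<bar>x\<bar> \<le> r" "\<bar>y\<bar> \<le> r" for x y
  proof -
    have "norm (x, y) \<le> \<bar>x\<bar> + \<bar>y\<bar>" by (simp add: norm_Pair sqrt_sum_squares_le_sum_abs)
    then show ?thesis using he[of "(x, y)"] that r by simp
  qed
  have "(\<lambda>(i, j). a i j * r ^ i * r ^ j) summable_on UNIV"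
    using *[of r r] r by (auto simp: summable_on_def)
  \<comment> \<open>For real families summability is absolute, so the corner \<open>(r, r)\<close>
    supplies one majorant for the whole square.\<close>
  then have "(\<lambda>p. norm (case p of (i, j) \<Rightarrow> a i j * r ^ i * r ^ j)) summable_on UNIV"
    by (rule summable_on_iff_abs_summable_on_real[THEN iffD1])
  also have "(\<lambda>p. norm (case p of (i, j) \<Rightarrow> a i j * r ^ i * r ^ j)) =
      (\<lambda>(i, j). \<bar>a i j\<bar> * r ^ (i + j))"
    using r by (auto simp: fun_eq_iff abs_mult power_add)
  finally show ?thesis using that r * by blast
qed

lemma has_sum_real_diff:
  fixes f g :: "'a \<Rightarrow> real"
  assumes "(f has_sum s) A" "(g has_sum t) A"
  shows "((\<lambda>p. f p - g p) has_sum (s - t)) A"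
  using has_sum_add[OF assms(1), of "\<lambda>p. - g p" "- t"] assms(2) by (simp add: has_sum_uminus)

lemma has_sum_dominated_le:
  fixes f g :: "'a \<Rightarrow> real"
  assumes "(f has_sum s) A" "g summable_on A" "\<And>p. p \<in> A \<Longrightarrow> \<bar>f p\<bar> \<le> g p"
  shows "\<bar>s\<bar> \<le> infsum g A"
proof -
  have "s \<le> infsum g A"
    using has_sum_mono[OF assms(1) has_sum_infsum[OF assms(2)]] assms(3) by (meson abs_le_D1)
  moreover have "((\<lambda>p. - f p) has_sum - s) A" using assms(1) by (simp add: has_sum_uminus)
  from has_sum_mono[OF this has_sum_infsum[OF assms(2)]] have "- s \<le> infsum g A"
    using assms(3) by (meson abs_le_D2)
  ultimately show ?thesis by linarith
qed

text \<open>If x has size \<open>r * s\<close> and y size \<open>r * s ^ m\<close>, a monomial of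
  weighted degree \<open>i + m * j\<close> has size at most
  \<open>r ^ (i + j) * s ^ (i + m * j)\<close>; only weighted degrees from \<open>d\<close> on
  occur, so \<open>s ^ d\<close> factors out of an absolutely convergent sum. Homogeneous remainders
  use \<open>m = 1\<close>, quasi-homogeneous ones \<open>m = 2 * l\<close>.\<close>

lemma expands_at_0_quasi_homogeneous_bound:
  assumes "expands_at_0 f a" and "\<And>i j. i + m * j < d \<Longrightarrow> a i j = 0" and "m \<ge> 1"
  obtains C r where "0 \<le> C" "0 < r" "r \<le> 1"
    "\<And>s x y. 0 \<le> s \<Longrightarrow> s \<le> 1 \<Longrightarrow> \<bar>x\<bar> \<le> r * s \<Longrightarrow> \<bar>y\<bar> \<le> r * s ^ m \<Longrightarrow> \<bar>f (x, y)\<bar> \<le> C * s ^ d"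
proof -
  obtain r where r: "0 < r" "r \<le> 1" and
    hs: "\<And>x y. \<bar>x\<bar> \<le> r \<Longrightarrow> \<bar>y\<bar> \<le> r \<Longrightarrow> ((\<lambda>(i, j). a i j * x ^ i * y ^ j) has_sum f (x, y)) UNIV"
    and su: "(\<lambda>(i, j). \<bar>a i j\<bar> * r ^ (i + j)) summable_on UNIV"
    by (rule expands_at_0_radius[OF assms(1)]) (blast intro: that)
  define g where "g = (\<lambda>(i, j). \<bar>a i j\<bar> * r ^ (i + j))"
  have g0: "0 \<le> infsum g UNIV" unfolding g_def using r by (intro infsum_nonneg) auto
  have "\<bar>f (x, y)\<bar> \<le> infsum g UNIV * s ^ d"
    if s: "0 \<le> s" "s \<le> 1" and x: "\<bar>x\<bar> \<le> r * s" and y: "\<bar>y\<bar> \<le> r * s ^ m" for s x y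
  proof -
    have "r * s \<le> r" "r * s ^ m \<le> r"
      using s r by (auto intro: mult_left_le power_le_one)
    then have xy: "\<bar>x\<bar> \<le> r" "\<bar>y\<bar> \<le> r" using x y by linarith+
    have "\<bar>case p of (i, j) \<Rightarrow> a i j * x ^ i * y ^ j\<bar> \<le> g p * s ^ d" for p
    proof (cases p)
      case (Pair i j)
      show ?thesis
      proof (cases "i + m * j < d")
        case True
        then show ?thesis using assms(2) Pair by (simp add: g_def)
      next
        case False
        have "\<bar>x\<bar> ^ i * \<bar>y\<bar> ^ j \<le> (r * s) ^ i * (r * s ^ m) ^ j"
          using x y by (intro mult_mono power_mono) (use s r in auto)
        also have "\<dots> = r ^ (i + j) * s ^ (i + m * j)"
          by (simp add: power_mult_distrib power_add power_mult)
        also have "\<dots> \<le> r ^ (i + j) * s ^ d"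
          using False s r by (intro mult_left_mono power_decreasing) auto
        finally have "\<bar>a i j\<bar> * (\<bar>x\<bar> ^ i * \<bar>y\<bar> ^ j) \<le> \<bar>a i j\<bar> * (r ^ (i + j) * s ^ d)"
          by (intro mult_left_mono) auto
        then show ?thesis using Pair by (simp add: g_def abs_mult power_abs mult.assoc)
      qed
    qed
    moreover have "(\<lambda>p. g p * s ^ d) summable_on UNIV"
      using su unfolding g_def by (rule summable_on_cmult_left)
    ultimately have "\<bar>f (x, y)\<bar> \<le> infsum (\<lambda>p. g p * s ^ d) UNIV"
      by (intro has_sum_dominated_le[OF hs[OF xy]]) auto
    then show ?thesis using su unfolding g_def by (simp add: infsum_cmult_left)
  qed
  then show ?thesis using that[of "infsum g UNIV" r] g0 r by blast
qed

lemma abs_monomial_diff_le: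
  fixes x y x' y' s h :: real
  assumes "\<bar>x\<bar> \<le> s" "\<bar>y\<bar> \<le> s" "\<bar>x'\<bar> \<le> s" "\<bar>y'\<bar> \<le> s" "\<bar>x - x'\<bar> \<le> h" "\<bar>y - y'\<bar> \<le> h"
  shows "\<bar>x ^ i * y ^ j - x' ^ i * y' ^ j\<bar> \<le> real (i + j) * s ^ (i + j - 1) * h"
proof -
  have s: "0 \<le> s" "0 \<le> h" using assms by linarith+
  have pd: "\<bar>u ^ n - v ^ n\<bar> \<le> real n * s ^ (n - 1) * h"
    if "\<bar>u\<bar> \<le> s" "\<bar>v\<bar> \<le> s" "\<bar>u - v\<bar> \<le> h" for u v :: real and n
  proof (cases n)
    case (Suc m)
    have "\<bar>u ^ n - v ^ n\<bar> = \<bar>u - v\<bar> * \<bar>\<Sum>p<Suc m. u ^ p * v ^ (m - p)\<bar>"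
      unfolding Suc diff_power_eq_sum by (simp add: abs_mult)
    also have "\<bar>\<Sum>p<Suc m. u ^ p * v ^ (m - p)\<bar> \<le> (\<Sum>p<Suc m. s ^ m)"
    proof (rule order_trans[OF sum_abs sum_mono])
      fix p assume "p \<in> {..<Suc m}"
      then have "s ^ m = s ^ p * s ^ (m - p)" by (simp flip: power_add)
      then show "\<bar>u ^ p * v ^ (m - p)\<bar> \<le> s ^ m"
        using that s by (auto simp: abs_mult power_abs intro!: mult_mono power_mono)
    qed
    finally have "\<bar>u ^ n - v ^ n\<bar> \<le> \<bar>u - v\<bar> * (real (Suc m) * s ^ m)"
      by (simp add: mult_left_mono)
    also have "\<dots> \<le> h * (real (Suc m) * s ^ m)" using that s by (intro mult_right_mono) auto
    finally show ?thesis using Suc by (simp add: mult_ac)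
  qed simp
  have "x ^ i * y ^ j - x' ^ i * y' ^ j = (x ^ i - x' ^ i) * y ^ j + x' ^ i * (y ^ j - y' ^ j)"
    by (simp add: algebra_simps)
  then have "\<bar>x ^ i * y ^ j - x' ^ i * y' ^ j\<bar> \<le>
      \<bar>x ^ i - x' ^ i\<bar> * \<bar>y\<bar> ^ j + \<bar>x'\<bar> ^ i * \<bar>y ^ j - y' ^ j\<bar>"
    by (metis abs_mult abs_triangle_ineq power_abs)
  also have "\<dots> \<le> (real i * s ^ (i - 1) * h) * s ^ j + s ^ i * (real j * s ^ (j - 1) * h)"
  proof (rule add_mono)
    have "\<bar>y\<bar> ^ j \<le> s ^ j" "\<bar>x'\<bar> ^ i \<le> s ^ i" using assms by (auto intro: power_mono)
    then show "\<bar>x ^ i - x' ^ i\<bar> * \<bar>y\<bar> ^ j \<le> (real i * s ^ (i - 1) * h) * s ^ j"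
      "\<bar>x'\<bar> ^ i * \<bar>y ^ j - y' ^ j\<bar> \<le> s ^ i * (real j * s ^ (j - 1) * h)"
      using pd[of x x' i] pd[of y y' j] assms s by (meson mult_mono abs_ge_zero zero_le_power
        order_trans)+
  qed
  also have "\<dots> = real (i + j) * s ^ (i + j - 1) * h"
    by (cases i; cases j) (auto simp: power_add algebra_simps)
  finally show ?thesis .
qed

text \<open>Every monomial has degree at least 2, so its increment keeps a factor \<open>s\<close>.
  The Lipschitz constant thus tends to 0 with the radius, which is what makes the nonlinear part of
  a coordinate change a small perturbation.\<close>

lemma expands_at_0_Lipschitz:
  assumes "expands_at_0 f a" and low: "\<And>i j. i + j < 2 \<Longrightarrow> a i j = 0"
  obtains C r where "0 \<le> C" "0 < r"
    "\<And>s w w'. s \<le> r \<Longrightarrow> norm w \<le> s \<Longrightarrow> norm w' \<le> s \<Longrightarrow> \<bar>f w - f w'\<bar> \<le> C * s * norm (w - w')"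
proof -
  obtain r where r: "0 < r" "r \<le> 1" and
    hs: "\<And>x y. \<bar>x\<bar> \<le> r \<Longrightarrow> \<bar>y\<bar> \<le> r \<Longrightarrow> ((\<lambda>(i, j). a i j * x ^ i * y ^ j) has_sum f (x, y)) UNIV"
    and su: "(\<lambda>(i, j). \<bar>a i j\<bar> * r ^ (i + j)) summable_on UNIV"
    by (rule expands_at_0_radius[OF assms(1)]) (blast intro: that)
  define g where "g = (\<lambda>(i, j). \<bar>a i j\<bar> * r ^ (i + j))"
  have g0: "0 \<le> infsum g UNIV" unfolding g_def using r by (intro infsum_nonneg) auto
  have "\<bar>f w - f w'\<bar> \<le> infsum g UNIV * 4 / r\<^sup>2 * s * norm (w - w')"
    if s: "s \<le> r / 2" and w: "norm w \<le> s" "norm w' \<le> s" for s w w'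
  proof -
    obtain x y x' y' where ww: "w = (x, y)" "w' = (x', y')" by (cases w; cases w')
    have "0 \<le> s" using w(1) by (meson norm_ge_zero order_trans)
    define h where "h = norm (w - w')"
    have c: "\<bar>x\<bar> \<le> s" "\<bar>y\<bar> \<le> s" "\<bar>x'\<bar> \<le> s" "\<bar>y'\<bar> \<le> s" "\<bar>x - x'\<bar> \<le> h" "\<bar>y - y'\<bar> \<le> h"
      using w norm_fst_le[of x y] norm_snd_le[of y x] norm_fst_le[of x' y'] norm_snd_le[of y' x']
        norm_fst_le[of "x - x'" "y - y'"] norm_snd_le[of "y - y'" "x - x'"]
      by (auto simp: ww h_def)
    have h0: "0 \<le> h" by (simp add: h_def)
    define q where "q = 4 / r\<^sup>2 * s * h"
    have bd: "\<bar>case p of (i, j) \<Rightarrow> a i j * x ^ i * y ^ j - a i j * x' ^ i * y' ^ j\<bar> \<le> g p * q" for p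
    proof (cases p)
      case (Pair i j)
      show ?thesis
      proof (cases "i + j < 2")
        case True
        then show ?thesis using low Pair by (simp add: g_def)
      next
        case False
        then obtain n where n: "i + j = n + 2" by (metis add.commute le_Suc_ex not_less)
        have "\<bar>x ^ i * y ^ j - x' ^ i * y' ^ j\<bar> \<le> real (n + 2) * s ^ (n + 1) * h"
          using abs_monomial_diff_le[OF c, of i j] n by simp
        \<comment> \<open>The degree factor produced by differencing is paid for by working at half
          the radius, where \<open>s ^ n\<close> is at most \<open>(r / 2) ^ n\<close>.\<close>
        also have "real (n + 2) \<le> 4 * 2 ^ n"
          by (induction n) auto
        then have "real (n + 2) * s ^ (n + 1) * h \<le> (4 * 2 ^ n) * (s * (r / 2) ^ n) * h"
          using s \<open>0 \<le> s\<close> h0 by (intro mult_mono) (auto intro!: mult_left_mono power_mono)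
        also have "\<dots> = r ^ (i + j) * q"
          using r unfolding n q_def by (simp add: field_simps power2_eq_square)
        finally have "\<bar>a i j\<bar> * \<bar>x ^ i * y ^ j - x' ^ i * y' ^ j\<bar> \<le> \<bar>a i j\<bar> * (r ^ (i + j) * q)"
          by (intro mult_left_mono) auto
        then show ?thesis using Pair
          by (simp add: g_def mult.assoc flip: abs_mult right_diff_distrib)
      qed
    qed
    have "((\<lambda>p. (case p of (i, j) \<Rightarrow> a i j * x ^ i * y ^ j)
        - (case p of (i, j) \<Rightarrow> a i j * x' ^ i * y' ^ j)) has_sum (f w - f w')) UNIV"
      unfolding ww by (intro has_sum_real_diff hs) (use c s r in auto)
    then have "((\<lambda>(i, j). a i j * x ^ i * y ^ j - a i j * x' ^ i * y' ^ j) has_sum (f w - f w')) UNIV"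
      by (simp add: case_prod_unfold)
    moreover have "(\<lambda>p. g p * q) summable_on UNIV"
      using su unfolding g_def by (rule summable_on_cmult_left)
    ultimately have "\<bar>f w - f w'\<bar> \<le> infsum (\<lambda>p. g p * q) UNIV"
      using bd by (intro has_sum_dominated_le) auto
    also have "\<dots> = infsum g UNIV * q" using su unfolding g_def by (simp add: infsum_cmult_left)
    finally show ?thesis by (simp add: q_def h_def mult_ac)
  qed
  then show ?thesis using that[of "infsum g UNIV * 4 / r\<^sup>2" "r / 2"] g0 r by auto
qed

lemma expands_at_0_minus_affine:
  assumes "expands_at_0 f a"
  shows "expands_at_0 (\<lambda>w. f w - (a 0 0 + a 1 0 * fst w + a 0 1 * snd w))
      (\<lambda>i j. if i + j < 2 then 0 else a i j)"
proof -
  have "((\<lambda>(i, j). (if i + j < 2 then 0 else a i j) * fst w ^ i * snd w ^ j) has_sum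
      f w - (a 0 0 + a 1 0 * fst w + a 0 1 * snd w)) UNIV"
    if "((\<lambda>(i, j). a i j * fst w ^ i * snd w ^ j) has_sum f w) UNIV" for w
  proof -
    have "((\<lambda>(i, j). (if i + j < 2 then a i j else 0) * fst w ^ i * snd w ^ j) has_sum
        (a 0 0 + a 1 0 * fst w + a 0 1 * snd w)) UNIV"
      by (rule has_sum_finite_neutralI[where B = "{(0,0),(1,0),(0,1)}"])
         (auto simp: less_2_cases_iff split: if_splits)
    from has_sum_real_diff[OF that this] show ?thesis
      by (rule has_sum_cong[THEN iffD1, rotated]) auto
  qed
  then show ?thesis using assms unfolding expands_at_0_def by (auto elim: eventually_mono)
qed

text \<open>After removal of the affine part the Lipschitz estimate applies, and the affine part is
  continuous anyway.\<close>

lemma analytic_at_0_continuous: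
  assumes "analytic_at_0 f"
  obtains r where "0 < r" "continuous_on (ball 0 r) f"
proof -
  obtain a where a: "expands_at_0 f a" using assms by (auto simp: analytic_at_0_def)
  let ?g = "\<lambda>w. f w - (a 0 0 + a 1 0 * fst w + a 0 1 * snd w)"
  obtain C r where C: "0 \<le> C" and r: "0 < r" and
    L: "\<And>s w w'. s \<le> r \<Longrightarrow> norm w \<le> s \<Longrightarrow> norm w' \<le> s \<Longrightarrow> \<bar>?g w - ?g w'\<bar> \<le> C * s * norm (w - w')"
    by (rule expands_at_0_Lipschitz[OF expands_at_0_minus_affine[OF a]]) auto
  have "(C * r)-lipschitz_on (ball 0 r) ?g"
  proof (rule lipschitz_onI)
    fix w w' :: "real \<times> real" assume "w \<in> ball 0 r" "w' \<in> ball 0 r"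
    then show "dist (?g w) (?g w') \<le> C * r * dist w w'"
      using L[of r w w'] by (simp only: dist_norm mem_ball_0 real_norm_def)
  qed (use C r in auto)
  then have "continuous_on (ball 0 r) ?g" by (rule lipschitz_on_continuous_on)
  then have "continuous_on (ball 0 r) (\<lambda>w. ?g w + (a 0 0 + a 1 0 * fst w + a 0 1 * snd w))"
    by (rule continuous_on_add) (intro continuous_intros)
  then have "continuous_on (ball 0 r) f" by (simp only: diff_add_cancel)
  then show ?thesis using that r by blast
qed

lemma analytic_field_continuous:
  assumes "analytic_field Z"
  obtains r where "0 < r" "continuous_on (ball 0 r) Z"
proof -
  obtain r1 r2 where "0 < r1" "continuous_on (ball 0 r1) (\<lambda>w. fst (Z w))"
    "0 < r2" "continuous_on (ball 0 r2) (\<lambda>w. snd (Z w))"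
    using assms unfolding analytic_field_def by (metis analytic_at_0_continuous)
  then have "continuous_on (ball 0 (min r1 r2)) (\<lambda>w. (fst (Z w), snd (Z w)))" "0 < min r1 r2"
    by (auto intro!: continuous_on_Pair elim: continuous_on_subset simp del: prod.collapse)
  then show ?thesis using that by (simp, blast)
qed

text \<open>The growth condition is turned into vanishing of the coefficients of degree below 2: the
  affine part is the difference of two functions of quadratic size, and testing it along both axes
  kills its three coefficients.\<close>

lemma analytic_at_0_quadratic_Lipschitz:
  assumes "analytic_at_0 f" "f \<in> O[nhds 0](\<lambda>w. norm w ^ 2)"
  obtains C r where "0 \<le> C" "0 < r"
    "\<And>s w w'. s \<le> r \<Longrightarrow> norm w \<le> s \<Longrightarrow> norm w' \<le> s \<Longrightarrow> \<bar>f w - f w'\<bar> \<le> C * s * norm (w - w')"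
proof -
  obtain a where a: "expands_at_0 f a" using assms by (auto simp: analytic_at_0_def)
  define l where "l = (\<lambda>w. a 0 0 + a 1 0 * fst w + a 0 1 * snd w)"
  let ?b = "\<lambda>i j. if i + j < 2 then 0 else a i j"
  have b: "expands_at_0 (\<lambda>w. f w - l w) ?b"
    using expands_at_0_minus_affine[OF a] by (simp add: l_def)
  obtain C r where C: "0 \<le> C" and r: "0 < r" and
    L: "\<And>s w w'. s \<le> r \<Longrightarrow> norm w \<le> s \<Longrightarrow> norm w' \<le> s \<Longrightarrow>
      \<bar>(f w - l w) - (f w' - l w')\<bar> \<le> C * s * norm (w - w')"
    by (rule expands_at_0_Lipschitz[OF b]) auto
  obtain c where c: "c > 0" "\<forall>\<^sub>F w in nhds 0. norm (f w) \<le> c * norm (norm w ^ 2)"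
    using assms(2) by (elim landau_o.bigE) auto
  then obtain e where e: "e > 0" "\<And>w. norm w < e \<Longrightarrow> \<bar>f w\<bar> \<le> c * norm w ^ 2"
    unfolding eventually_nhds_metric by (auto simp: dist_norm)
  obtain K r' where K: "0 \<le> K" "0 < r'" "r' \<le> 1" and
    KB: "\<And>s x y. 0 \<le> s \<Longrightarrow> s \<le> 1 \<Longrightarrow> \<bar>x\<bar> \<le> r' * s \<Longrightarrow> \<bar>y\<bar> \<le> r' * s ^ 1 \<Longrightarrow>
      \<bar>f (x, y) - l (x, y)\<bar> \<le> K * s ^ 2"
    by (rule expands_at_0_quasi_homogeneous_bound[OF b, of 1 2]) auto
  \<comment> \<open>Points \<open>r' * t * (u, v)\<close> have norm at most \<open>2 * t\<close>,
    which gives \<open>4 * c\<close> from the growth condition, while the terms of degree at least 2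
    contribute \<open>K\<close>.\<close>
  have lim: "\<forall>\<^sub>F t in at_right (0::real). \<bar>l (r' * t * u, r' * t * v)\<bar> \<le> (4 * c + K) * t ^ 2"
    if "\<bar>u\<bar> \<le> 1" "\<bar>v\<bar> \<le> 1" for u v
  proof -
    have "\<bar>l (r' * t * u, r' * t * v)\<bar> \<le> (4 * c + K) * t ^ 2" if t: "0 < t" "t < min 1 (e / 3)" for t
    proof -
      have uv: "\<bar>r' * t * u\<bar> \<le> r' * t" "\<bar>r' * t * v\<bar> \<le> r' * t"
        using \<open>\<bar>u\<bar> \<le> 1\<close> \<open>\<bar>v\<bar> \<le> 1\<close> K t by (auto simp: abs_mult mult_le_cancel_left1)
      have rt: "r' * t \<le> t" using K t by simp
      have nn: "norm (r' * t * u, r' * t * v) \<le> 2 * t"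
        using sqrt_sum_squares_le_sum_abs[of "r' * t * u" "r' * t * v"] uv rt
        by (simp add: norm_Pair)
      then have "\<bar>f (r' * t * u, r' * t * v)\<bar> \<le> c * norm (r' * t * u, r' * t * v) ^ 2"
        using t by (intro e(2)) auto
      also have "\<dots> \<le> c * (2 * t) ^ 2" using c nn by (intro mult_left_mono power_mono) auto
      finally have "\<bar>f (r' * t * u, r' * t * v)\<bar> \<le> 4 * c * t ^ 2" by (simp add: power2_eq_square)
      moreover have "\<bar>f (r' * t * u, r' * t * v) - l (r' * t * u, r' * t * v)\<bar> \<le> K * t ^ 2"
        using t uv by (intro KB) auto
      ultimately show ?thesis by (simp add: algebra_simps abs_le_iff)
    qed
    then show ?thesis unfolding eventually_at_right_field
      using e by (intro exI[of _ "min 1 (e / 3)"]) auto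
  qed
  \<comment> \<open>The limit at 0 gives \<open>A = 0\<close>; after division by \<open>t\<close> a
    second limit gives \<open>B = 0\<close>.\<close>
  have z: "A = 0 \<and> B = 0" if ev: "\<forall>\<^sub>F t in at_right (0::real). \<bar>A + B * t\<bar> \<le> D * t ^ 2" for A B D :: real
  proof -
    have "((\<lambda>t. \<bar>A + B * t\<bar>) \<longlongrightarrow> \<bar>A + B * 0\<bar>) (at_right 0)"
      "((\<lambda>t. D * t ^ 2) \<longlongrightarrow> D * 0 ^ 2) (at_right 0)" by (intro tendsto_intros)+
    from tendsto_le[OF _ this(2,1) ev] have A: "A = 0" by simp
    have ev2: "\<forall>\<^sub>F t in at_right (0::real). \<bar>B\<bar> \<le> D * t"
      using ev eventually_at_right_less[of 0]
    proof eventually_elim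
      case (elim t)
      then have "\<bar>B\<bar> * t \<le> (D * t) * t" by (simp add: A abs_mult power2_eq_square)
      then show ?case using elim by (simp only: mult_le_cancel_right)
    qed
    have "((\<lambda>t. D * t) \<longlongrightarrow> D * 0) (at_right 0)" by (intro tendsto_intros)
    from tendsto_le[OF _ this tendsto_const ev2] have "B = 0" by simp
    with A show ?thesis by simp
  qed
  have "a 0 0 = 0 \<and> a 1 0 * r' = 0"
    using lim[of 1 0] by (intro z[where D = "4 * c + K"]) (simp add: l_def mult_ac)
  moreover have "a 0 0 = 0 \<and> a 0 1 * r' = 0"
    using lim[of 0 1] by (intro z[where D = "4 * c + K"]) (simp add: l_def mult_ac)
  ultimately have "l w = 0" for w using K by (simp add: l_def)
  then show ?thesis using that[OF C r] L by simp
qed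

section \<open>Charts preserving the axis\<close>

text \<open>The interface to a coordinate change \<open>T\<close>, free of its coefficients. The
  lower norm bound replaces a smooth inverse: it gives injectivity, a continuous inverse and
  injective derivatives. The sign clause keeps the half planes apart. The last clause makes
  differences of axis points change by factors between 1/2 and 3/2 only.\<close>

definition axis_chart :: "real \<Rightarrow> (real \<times> real \<Rightarrow> real \<times> real) \<Rightarrow> (real \<Rightarrow> real) \<Rightarrow> bool" where
  "axis_chart \<epsilon> T \<phi> \<longleftrightarrow> 0 < \<epsilon> \<and> \<phi> 0 = 0 \<and> continuous_on (ball 0 \<epsilon>) T \<and>
     (\<exists>c>0. \<forall>w\<in>ball 0 \<epsilon>. \<forall>w'\<in>ball 0 \<epsilon>. c * norm (w - w') \<le> norm (T w - T w')) \<and>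
     (\<forall>w\<in>ball 0 \<epsilon>. sgn (snd (T w)) = sgn (snd w)) \<and>
     (\<forall>x. \<bar>x\<bar> < \<epsilon> \<longrightarrow> T (x, 0) = (\<phi> x, 0)) \<and>
     (\<forall>x x'. \<bar>x\<bar> < \<epsilon> \<longrightarrow> \<bar>x'\<bar> < \<epsilon> \<longrightarrow> \<bar>(\<phi> x - \<phi> x') - (x - x')\<bar> \<le> \<bar>x - x'\<bar> / 2)"

lemma axis_chart_mono:
  assumes "axis_chart \<epsilon> T \<phi>" "0 < \<epsilon>'" "\<epsilon>' \<le> \<epsilon>"
  shows "axis_chart \<epsilon>' T \<phi>"
proof -
  have "ball 0 \<epsilon>' \<subseteq> (ball 0 \<epsilon> :: (real \<times> real) set)" using assms by auto
  then show ?thesis using assms unfolding axis_chart_def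
    by (auto intro: continuous_on_subset dest: subsetD) (meson subsetD)
qed

text \<open>The linear part is an invertible triangular matrix, and on a small ball the nonlinear
  part has a Lipschitz constant \<mu> too small to spoil any of the required properties.\<close>

lemma axis_chart_coord_map:
  assumes "admissible_change q1 \<Phi> \<Psi>"
  obtains \<epsilon> where "axis_chart \<epsilon> (coord_map q1 q2 \<Phi> \<Psi>) (\<lambda>x. x + \<Phi> (x, 0))"
proof -
  have q1: "0 < q1" and an: "analytic_at_0 \<Phi>" "analytic_at_0 \<Psi>"
    and O: "\<Phi> \<in> O[nhds 0](\<lambda>w. norm w ^ 2)" "\<Psi> \<in> O[nhds 0](\<lambda>w. norm w ^ 2)"
    and ev: "\<forall>\<^sub>F x in nhds 0. \<Psi> (x, 0) = 0"
    using assms by (auto simp: admissible_change_def)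
  obtain C1 r1 where C1: "0 \<le> C1" "0 < r1" and
    L1: "\<And>s w w'. s \<le> r1 \<Longrightarrow> norm w \<le> s \<Longrightarrow> norm w' \<le> s \<Longrightarrow> \<bar>\<Phi> w - \<Phi> w'\<bar> \<le> C1 * s * norm (w - w')"
    by (rule analytic_at_0_quadratic_Lipschitz[OF an(1) O(1)]) blast
  obtain C2 r2 where C2: "0 \<le> C2" "0 < r2" and
    L2: "\<And>s w w'. s \<le> r2 \<Longrightarrow> norm w \<le> s \<Longrightarrow> norm w' \<le> s \<Longrightarrow> \<bar>\<Psi> w - \<Psi> w'\<bar> \<le> C2 * s * norm (w - w')"
    by (rule analytic_at_0_quadratic_Lipschitz[OF an(2) O(2)]) blast
  obtain r3 where r3: "0 < r3" "\<And>x. \<bar>x\<bar> < r3 \<Longrightarrow> \<Psi> (x, 0) = 0"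
    using ev unfolding eventually_nhds_metric by (auto simp: dist_real_def)
  \<comment> \<open>\<open>B\<close> bounds the inverse of the linear part: solving first for y and
    then for x gives |x| + |y| at most \<open>B\<close> times the norm of the image.\<close>
  define B where "B = 1 + (1 + \<bar>q2\<bar>) / q1"
  have B: "1 \<le> B" using q1 by (simp add: B_def)
  \<comment> \<open>The three entries serve, in this order, closeness of the axis map to the
    identity, preservation of the sign of y, and the lower norm bound.\<close>
  define \<mu> where "\<mu> = min (1 / 2) (min (q1 / 2) (1 / (4 * B)))"
  have \<mu>: "0 < \<mu>" "\<mu> \<le> 1 / 2" "\<mu> \<le> q1 / 2" "\<mu> \<le> 1 / (4 * B)" using q1 B by (auto simp: \<mu>_def)
  define \<epsilon> where "\<epsilon> = Min {r1, r2, r3, \<mu> / (C1 + 1), \<mu> / (C2 + 1)}"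
  have \<epsilon>: "0 < \<epsilon>" "\<epsilon> \<le> r1" "\<epsilon> \<le> r2" "\<epsilon> \<le> r3" "\<epsilon> \<le> \<mu> / (C1 + 1)" "\<epsilon> \<le> \<mu> / (C2 + 1)"
    using C1 C2 r3 \<mu> by (auto simp: \<epsilon>_def)
  have "C1 * \<epsilon> \<le> (C1 + 1) * (\<mu> / (C1 + 1))" "C2 * \<epsilon> \<le> (C2 + 1) * (\<mu> / (C2 + 1))"
    using \<epsilon> C1 C2 by (intro mult_mono; simp)+
  then have Ce: "C1 * \<epsilon> \<le> \<mu>" "C2 * \<epsilon> \<le> \<mu>" using C1 C2 by auto
  have P1: "\<bar>\<Phi> w - \<Phi> w'\<bar> \<le> \<mu> * norm (w - w')" if "w \<in> ball 0 \<epsilon>" "w' \<in> ball 0 \<epsilon>" for w w'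
    using L1[of \<epsilon> w w'] that \<epsilon> mult_right_mono[OF Ce(1) norm_ge_zero[of "w - w'"]] by simp
  have P2: "\<bar>\<Psi> w - \<Psi> w'\<bar> \<le> \<mu> * norm (w - w')" if "w \<in> ball 0 \<epsilon>" "w' \<in> ball 0 \<epsilon>" for w w'
    using L2[of \<epsilon> w w'] that \<epsilon> mult_right_mono[OF Ce(2) norm_ge_zero[of "w - w'"]] by simp
  let ?T = "coord_map q1 q2 \<Phi> \<Psi>"
  \<comment> \<open>The filter \<open>nhds 0\<close>, unlike \<open>at 0\<close>, contains the
    origin itself, so the growth condition can be evaluated there.\<close>
  have "\<Phi> (0, 0) = 0"
  proof -
    obtain c where "\<forall>\<^sub>F w in nhds 0. norm (\<Phi> w) \<le> c * norm (norm w ^ 2)"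
      using O(1) by (elim landau_o.bigE) auto
    from eventually_nhds_x_imp_x[OF this] show ?thesis by (simp add: zero_prod_def)
  qed
  moreover have "continuous_on (ball 0 \<epsilon>) ?T"
  proof -
    have "\<mu>-lipschitz_on (ball 0 \<epsilon>) \<Phi>" "\<mu>-lipschitz_on (ball 0 \<epsilon>) \<Psi>"
      using P1 P2 \<mu> by (auto intro!: lipschitz_onI simp only: dist_norm real_norm_def)
    then show ?thesis unfolding coord_map_def
      by (intro continuous_intros lipschitz_on_continuous_on)
  qed
  moreover have "1 / (2 * B) * norm (w - w') \<le> norm (?T w - ?T w')"
    if "w \<in> ball 0 \<epsilon>" "w' \<in> ball 0 \<epsilon>" for w w'
  proof -
    obtain x y x' y' where ww: "w = (x, y)" "w' = (x', y')" by (cases w; cases w')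
    define n where "n = norm (w - w')"
    define N where "N = norm (?T w - ?T w')"
    define f where "f = \<Phi> w - \<Phi> w'"
    define g where "g = \<Psi> w - \<Psi> w'"
    have fg: "\<bar>f\<bar> \<le> \<mu> * n" "\<bar>g\<bar> \<le> \<mu> * n" using P1[OF that] P2[OF that] by (auto simp: f_def g_def n_def)
    have Td: "?T w - ?T w' = ((x - x') + q2 * (y - y') + f, q1 * (y - y') + g)"
      by (simp add: coord_map_def ww f_def g_def algebra_simps)
    have N: "\<bar>(x - x') + q2 * (y - y') + f\<bar> \<le> N" "\<bar>q1 * (y - y') + g\<bar> \<le> N"
      using norm_fst_le[of "(x - x') + q2 * (y - y') + f" "q1 * (y - y') + g"]
        norm_snd_le[of "q1 * (y - y') + g" "(x - x') + q2 * (y - y') + f"]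
      by (auto simp: N_def Td)
    have "q1 * \<bar>y - y'\<bar> \<le> N + \<mu> * n"
      using N(2) fg(2) q1 abs_mult_pos[of q1 "y - y'"] by (simp add: mult.commute)
    then have y: "\<bar>y - y'\<bar> \<le> (N + \<mu> * n) / q1" using q1 by (simp add: field_simps)
    have "\<bar>q2 * (y - y')\<bar> \<le> \<bar>q2\<bar> * ((N + \<mu> * n) / q1)" using mult_left_mono[OF y, of "\<bar>q2\<bar>"] by (simp add: abs_mult)
    then have x: "\<bar>x - x'\<bar> \<le> N + \<mu> * n + \<bar>q2\<bar> * ((N + \<mu> * n) / q1)" using N(1) fg(1) by linarith
    have "n \<le> \<bar>x - x'\<bar> + \<bar>y - y'\<bar>"
      by (simp add: n_def ww norm_Pair sqrt_sum_squares_le_sum_abs)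
    also have "\<dots> \<le> B * (N + \<mu> * n)" using x y by (simp add: B_def field_simps add_divide_distrib)
    also have "B * (\<mu> * n) \<le> n / 4"
      using mult_right_mono[OF \<mu>(4), of "B * n"] B by (simp add: n_def mult_ac)
    then have "B * (N + \<mu> * n) \<le> B * N + n / 4" by (simp add: algebra_simps)
    finally have "n \<le> B * N + n / 4" by simp
    moreover have "0 \<le> n" by (simp add: n_def)
    ultimately have "n / 2 \<le> B * N" by linarith
    then show ?thesis using B by (simp add: n_def N_def field_simps)
  qed
  moreover have "sgn (snd (?T w)) = sgn (snd w)" if "w \<in> ball 0 \<epsilon>" for w
  proof -
    obtain x y where w: "w = (x, y)" by (cases w)
    have "\<bar>x\<bar> \<le> norm w" using norm_fst_le[of x y] w by simp
    then have x: "\<bar>x\<bar> < \<epsilon>" using that by simp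
    \<comment> \<open>Comparison with the axis point of the same abscissa, where \<Psi> vanishes,
      gives a bound by |y| instead of the norm; the linear term \<open>q1 * y\<close> then
      dominates.\<close>
    then have "\<bar>\<Psi> (x, y) - \<Psi> (x, 0)\<bar> \<le> \<mu> * norm ((x, y) - (x, 0))"
      using that w by (intro P2) auto
    then have "\<bar>\<Psi> (x, y)\<bar> \<le> \<mu> * \<bar>y\<bar>" using r3(2)[of x] x \<epsilon> by simp
    also have "\<dots> \<le> q1 / 2 * \<bar>y\<bar>" using \<mu> by (intro mult_right_mono) auto
    finally have *: "\<bar>\<Psi> (x, y)\<bar> \<le> q1 / 2 * \<bar>y\<bar>" .
    have s: "snd (?T w) = q1 * y + \<Psi> (x, y)" by (simp add: coord_map_def w)
    show ?thesis
    proof (cases y "0 :: real" rule: linorder_cases)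
      case less
      then have "q1 * y < 0" using q1 by (simp add: mult_pos_neg)
      then show ?thesis using * less s w by (simp add: abs_le_iff)
    next
      case greater
      then have "q1 * y > 0" using q1 by simp
      then show ?thesis using * greater s w by (simp add: abs_le_iff)
    qed (use * s w in auto)
  qed
  moreover have "?T (x, 0) = (x + \<Phi> (x, 0), 0)" if "\<bar>x\<bar> < \<epsilon>" for x
    using r3(2)[of x] that \<epsilon> by (simp add: coord_map_def)
  moreover have "\<bar>((x + \<Phi> (x, 0)) - (x' + \<Phi> (x', 0))) - (x - x')\<bar> \<le> \<bar>x - x'\<bar> / 2"
    if "\<bar>x\<bar> < \<epsilon>" "\<bar>x'\<bar> < \<epsilon>" for x x'
  proof -
    have "\<bar>\<Phi> (x, 0) - \<Phi> (x', 0)\<bar> \<le> \<mu> * \<bar>x - x'\<bar>" using P1[of "(x, 0)" "(x', 0)"] that by simp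
    also have "\<dots> \<le> 1 / 2 * \<bar>x - x'\<bar>" using \<mu> by (intro mult_right_mono) auto
    finally show ?thesis by (simp add: algebra_simps)
  qed
  ultimately have "axis_chart \<epsilon> ?T (\<lambda>x. x + \<Phi> (x, 0))"
    unfolding axis_chart_def using \<epsilon>(1) B
    by (intro conjI exI[of _ "1 / (2 * B)"] ballI allI impI) simp_all
  then show ?thesis using that by blast
qed

lemma axis_chart_lower_bound:
  assumes "axis_chart \<epsilon> T \<phi>"
  obtains c where "c > 0"
    "\<And>w w'. w \<in> ball 0 \<epsilon> \<Longrightarrow> w' \<in> ball 0 \<epsilon> \<Longrightarrow> c * norm (w - w') \<le> norm (T w - T w')"
  using assms unfolding axis_chart_def by blast

lemma axis_chart_sgn: "axis_chart \<epsilon> T \<phi> \<Longrightarrow> w \<in> ball 0 \<epsilon> \<Longrightarrow> sgn (snd (T w)) = sgn (snd w)"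
  unfolding axis_chart_def by blast

lemma axis_chart_inj_on: "axis_chart \<epsilon> T \<phi> \<Longrightarrow> inj_on T (ball 0 \<epsilon>)"
  unfolding axis_chart_def inj_on_def by (metis diff_self mult_le_0_iff norm_eq_zero norm_ge_zero
    norm_le_zero_iff not_le right_minus_eq)

text \<open>Invariance of domain is used because differentiability of the chart is not part of
  \<open>axis_chart\<close>.\<close>

lemma axis_chart_open_image:
  assumes "axis_chart \<epsilon> T \<phi>" "open U" "U \<subseteq> ball 0 \<epsilon>"
  shows "open (T ` U)"
  using assms axis_chart_inj_on[OF assms(1)] unfolding axis_chart_def
  by (intro invariance_of_domain) (auto intro: continuous_on_subset inj_on_subset)

lemma axis_chart_inverse_continuous:
  assumes "axis_chart \<epsilon> T \<phi>"
  shows "continuous_on (T ` ball 0 \<epsilon>) (inv_into (ball 0 \<epsilon>) T)"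
proof -
  obtain c where c: "c > 0"
    "\<And>w w'. w \<in> ball 0 \<epsilon> \<Longrightarrow> w' \<in> ball 0 \<epsilon> \<Longrightarrow> c * norm (w - w') \<le> norm (T w - T w')"
    by (rule axis_chart_lower_bound[OF assms(1)]) blast
  have "(1 / c)-lipschitz_on (T ` ball 0 \<epsilon>) (inv_into (ball 0 \<epsilon>) T)"
  proof (rule lipschitz_onI)
    fix p q assume "p \<in> T ` ball 0 \<epsilon>" "q \<in> T ` ball 0 \<epsilon>"
    then obtain w w' where w: "w \<in> ball 0 \<epsilon>" "w' \<in> ball 0 \<epsilon>" "p = T w" "q = T w'" by blast
    show "dist (inv_into (ball 0 \<epsilon>) T p) (inv_into (ball 0 \<epsilon>) T q) \<le> 1 / c * dist p q"
      using c(1) c(2)[OF w(1,2)] unfolding w(3,4)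
        inv_into_f_f[OF axis_chart_inj_on[OF assms] w(1)] inv_into_f_f[OF axis_chart_inj_on[OF assms] w(2)]
      by (simp only: dist_norm) (simp add: field_simps)
  qed (use c in auto)
  then show ?thesis by (rule lipschitz_on_continuous_on)
qed

text \<open>The lower norm bound survives division by the increment and passage to the limit along
  the direction \<open>v\<close>.\<close>

lemma axis_chart_deriv_inj:
  assumes "axis_chart \<epsilon> T \<phi>" "w \<in> ball 0 \<epsilon>" "(T has_derivative D) (at w)" "D v = 0"
  shows "v = 0"
proof -
  obtain c where c: "c > 0"
    "\<And>w w'. w \<in> ball 0 \<epsilon> \<Longrightarrow> w' \<in> ball 0 \<epsilon> \<Longrightarrow> c * norm (w - w') \<le> norm (T w - T w')"
    by (rule axis_chart_lower_bound[OF assms(1)]) blast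
  have D': "(T has_derivative D) (at (w + 0 *\<^sub>R v))" using assms(3) by simp
  have "((\<lambda>t. w + t *\<^sub>R v) has_derivative (\<lambda>t. t *\<^sub>R v)) (at 0)"
    by (auto intro!: derivative_eq_intros)
  from has_derivative_compose[OF this D']
  have "((\<lambda>t. T (w + t *\<^sub>R v)) has_derivative (\<lambda>t. D (t *\<^sub>R v))) (at 0)" .
  moreover have "D (t *\<^sub>R v) = t *\<^sub>R D v" for t
    using assms(3) by (simp add: has_derivative_bounded_linear linear_scale bounded_linear.linear)
  ultimately have "((\<lambda>t. T (w + t *\<^sub>R v)) has_vector_derivative 0) (at 0)"
    using assms(4) by (simp add: has_vector_derivative_def)
  then have "((\<lambda>t. norm (T (w + t *\<^sub>R v) - T w) / \<bar>t\<bar>) \<longlongrightarrow> 0) (at 0)"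
    by (simp add: has_vector_derivative_def has_derivative_at)
  moreover have "\<forall>\<^sub>F t in at 0. c * norm v \<le> norm (T (w + t *\<^sub>R v) - T w) / \<bar>t\<bar>"
  proof -
    have "((\<lambda>t. w + t *\<^sub>R v) \<longlongrightarrow> w + 0 *\<^sub>R v) (at (0::real))" by (intro tendsto_intros)
    then have "\<forall>\<^sub>F t in at (0::real). w + t *\<^sub>R v \<in> ball 0 \<epsilon>"
      using assms(2) by (intro topological_tendstoD) auto
    then show ?thesis using eventually_neq_at_within[of 0]
    proof eventually_elim
      case (elim t)
      then have "c * norm (t *\<^sub>R v) \<le> norm (T (w + t *\<^sub>R v) - T w)"
        using c(2)[of "w + t *\<^sub>R v" w] assms(2) by simp
      then show ?case using elim(2) by (simp add: field_simps)
    qed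
  qed
  ultimately have "c * norm v \<le> 0"
    by (rule tendsto_lowerbound) simp
  then show ?thesis using c by (simp add: mult_le_0_iff)
qed

text \<open>The derivative is injective, hence has a linear left inverse; together with continuity
  of the inverse chart this left inverse is its derivative, and the chain rule recovers the velocity
  \<open>u\<close> from \<open>D u\<close>.\<close>

lemma axis_chart_curve_derivative:
  assumes ch: "axis_chart \<epsilon> T \<phi>" and w: "w \<in> ball 0 \<epsilon>" and D: "(T has_derivative D) (at w)"
    and z: "(z has_vector_derivative D u) (at t)" "z t = T w"
  shows "((\<lambda>t. inv_into (ball 0 \<epsilon>) T (z t)) has_vector_derivative u) (at t)"
proof -
  let ?g = "inv_into (ball 0 \<epsilon>) T"
  have lin: "linear D" using D has_derivative_bounded_linear bounded_linear.linear by blast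
  have "inj D" using axis_chart_deriv_inj[OF ch w D] by (simp add: linear_injective_0[OF lin])
  then obtain D' where D': "linear D'" "D' \<circ> D = id" using linear_injective_left_inverse[OF lin] by blast
  have op: "open (T ` ball 0 \<epsilon>)" using axis_chart_open_image[OF ch] by simp
  have gw: "?g (T w) = w" using w axis_chart_inj_on[OF ch] by simp
  have "(?g has_derivative D') (at (T w))"
  proof (rule has_derivative_inverse_basic[OF _ _ D'(2) _ op])
    show "(T has_derivative D) (at (?g (T w)))" using D gw by simp
    show "bounded_linear D'" using D'(1) by (simp add: linear_conv_bounded_linear)
    show "continuous (at (T w)) ?g"
      using axis_chart_inverse_continuous[OF ch] op w by (simp add: continuous_on_eq_continuous_at)
    show "\<And>p. p \<in> T ` ball 0 \<epsilon> \<Longrightarrow> T (?g p) = p" by (rule f_inv_into_f)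
  qed (use w in auto)
  then have g': "(?g has_derivative D') (at (z t))" using z by simp
  have "((\<lambda>t. ?g (z t)) has_derivative (\<lambda>h. D' (h *\<^sub>R D u))) (at t)"
    using has_derivative_compose[OF z(1)[unfolded has_vector_derivative_def] g'] .
  moreover have "D' (h *\<^sub>R D u) = h *\<^sub>R u" for h
    using D'(2) by (simp add: linear_scale[OF D'(1)]) (metis comp_apply id_apply)
  ultimately show ?thesis by (simp add: has_vector_derivative_def)
qed

section \<open>Pulling orbits back through a chart\<close>

text \<open>The time scaling is only constrained pointwise, so the velocity is a positive multiple
  of the field.\<close>

definition half_orbit :: "vfield \<Rightarrow> real \<Rightarrow> (real \<Rightarrow> real \<times> real) \<Rightarrow> real \<Rightarrow> bool" where
  "half_orbit F \<tau> w \<xi> \<longleftrightarrow> 0 < \<tau> \<and> continuous_on {0..\<tau>} w \<and> w 0 = (\<xi>, 0) \<and>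
     (\<forall>t\<in>{0<..<\<tau>}. snd (w t) > 0 \<and> (\<exists>c>0. (w has_vector_derivative c *\<^sub>R F (w t)) (at t)))"

text \<open>The differential equation is demanded only inside \<open>ball 0 \<rho>\<close>, where
  the field is known to be continuous. Whether the curve stays there is left open at this stage and
  is decided by trapping.\<close>

definition passage :: "real \<Rightarrow> vfield \<Rightarrow> real \<Rightarrow> real \<Rightarrow> bool" where
  "passage \<rho> Z x x' \<longleftrightarrow> (\<exists>\<tau>>0. \<exists>z. continuous_on {0..\<tau>} z \<and> z 0 = (x, 0) \<and> z \<tau> = (x', 0) \<and>
     (\<forall>t\<in>{0<..<\<tau>}. snd (z t) > 0 \<and>
        (z t \<in> ball 0 \<rho> \<longrightarrow> (z has_vector_derivative Z (z t)) (at t))))"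

text \<open>A continuity argument: by \<open>trap\<close>, a pulled-back curve that has stayed in
  the closure of \<open>U\<close> up to some time lies in the open set \<open>U\<close> at that
  time, so there can be no first time at which it leaves \<open>U\<close>. Hence the whole passage
  takes place in the chart.\<close>

lemma passage_in_chart:
  assumes ch: "axis_chart \<epsilon> T \<phi>"
    and car: "\<And>w. w \<in> ball 0 \<epsilon> \<Longrightarrow> snd w > 0 \<Longrightarrow>
      \<exists>D k. k > 0 \<and> (T has_derivative D) (at w) \<and> D (F w) = k *\<^sub>R Z (T w)"
    and img: "T ` ball 0 \<epsilon> \<subseteq> ball 0 \<rho>"
    and pas: "passage \<rho> Z (\<phi> \<xi>) x'"
    and U: "open U" "closure U \<subseteq> ball 0 \<epsilon>" "(\<xi>, 0) \<in> U"
    and trap: "\<And>\<sigma> w. half_orbit F \<sigma> w \<xi> \<Longrightarrow> w ` {0..\<sigma>} \<subseteq> closure U \<Longrightarrow> w \<sigma> \<in> U"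
  shows "\<exists>\<tau> w. half_orbit F \<tau> w \<xi> \<and> w ` {0..\<tau>} \<subseteq> U \<and> T (w \<tau>) = (x', 0)"
proof -
  obtain \<tau> z where \<tau>: "\<tau> > 0" and cz: "continuous_on {0..\<tau>} z" and z0: "z 0 = (\<phi> \<xi>, 0)"
    and z1: "z \<tau> = (x', 0)"
    and zp: "\<And>t. t \<in> {0<..<\<tau>} \<Longrightarrow> snd (z t) > 0"
    and zd: "\<And>t. t \<in> {0<..<\<tau>} \<Longrightarrow> z t \<in> ball 0 \<rho> \<Longrightarrow> (z has_vector_derivative Z (z t)) (at t)"
    using pas unfolding passage_def by blast
  let ?g = "inv_into (ball 0 \<epsilon>) T"
  have UcU: "U \<subseteq> closure U" by (rule closure_subset)
  have inj: "inj_on T (ball 0 \<epsilon>)" by (rule axis_chart_inj_on[OF ch])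
  have \<xi>: "(\<xi>, 0 :: real) \<in> ball 0 \<epsilon>"
    by (rule subsetD[OF U(2) subsetD[OF UcU U(3)]])
  then have T0: "T (\<xi>, 0) = z 0" using ch z0 by (simp add: axis_chart_def)
  have contT: "continuous_on (ball 0 \<epsilon>) T" using ch by (simp add: axis_chart_def)
  \<comment> \<open>As long as the curve stays in the image of the closure of \<open>U\<close>, it
    can be pulled back; its velocity is \<open>F\<close> divided by the time scaling
    \<open>k\<close>.\<close>
  have step: "half_orbit F \<sigma> (\<lambda>t. ?g (z t)) \<xi> \<and> (\<lambda>t. ?g (z t)) ` {0..\<sigma>} \<subseteq> closure U"
    if \<sigma>: "0 < \<sigma>" "\<sigma> \<le> \<tau>" and zin: "z ` {0..\<sigma>} \<subseteq> T ` closure U" for \<sigma>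
  proof
    have gin: "?g (z t) \<in> closure U" "T (?g (z t)) = z t" if tt: "t \<in> {0..\<sigma>}" for t
    proof -
      obtain w where w: "w \<in> closure U" "z t = T w"
        using subsetD[OF zin imageI[OF tt]] by (rule imageE)
      then have "?g (z t) = w" using inv_into_f_f[OF inj subsetD[OF U(2)]] by simp
      then show "?g (z t) \<in> closure U" "T (?g (z t)) = z t" using w by simp_all
    qed
    then show "(\<lambda>t. ?g (z t)) ` {0..\<sigma>} \<subseteq> closure U" by (intro image_subsetI) blast
    have zb: "z ` {0..\<sigma>} \<subseteq> T ` ball 0 \<epsilon>"
      using zin image_mono[OF U(2)] by (rule order_trans)
    have "continuous_on {0..\<sigma>} (\<lambda>t. ?g (z t))"
      by (rule continuous_on_compose2[OF axis_chart_inverse_continuous[OF ch]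
            continuous_on_subset[OF cz] zb]) (use \<sigma> in simp)
    moreover have "?g (z 0) = (\<xi>, 0)" using T0 \<xi> inj by (metis inv_into_f_f)
    moreover have "snd (?g (z t)) > 0 \<and> (\<exists>c>0. ((\<lambda>t. ?g (z t)) has_vector_derivative c *\<^sub>R F (?g (z t))) (at t))"
      if t: "t \<in> {0<..<\<sigma>}" for t
    proof -
      have t': "t \<in> {0..\<sigma>}" "t \<in> {0<..<\<tau>}" using t \<sigma> by auto
      have w: "?g (z t) \<in> ball 0 \<epsilon>" "T (?g (z t)) = z t"
        using subsetD[OF U(2) gin(1)[OF t'(1)]] gin(2)[OF t'(1)] .
      have zt: "0 < snd (z t)" "z t \<in> ball 0 \<rho>"
        using zp[OF t'(2)] subsetD[OF img imageI[OF w(1)]] w(2) by simp_all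
      have sg: "snd (?g (z t)) > 0"
        using axis_chart_sgn[OF ch w(1)] w(2) zt(1) by (metis sgn_greater)
      then obtain D k where Dk: "k > 0" "(T has_derivative D) (at (?g (z t)))"
        "D (F (?g (z t))) = k *\<^sub>R Z (z t)" using car[OF w(1)] w(2) by auto
      have "D ((1 / k) *\<^sub>R F (?g (z t))) = Z (z t)"
        using Dk by (simp add: linear_scale has_derivative_bounded_linear bounded_linear.linear)
      then have "(z has_vector_derivative D ((1 / k) *\<^sub>R F (?g (z t)))) (at t)"
        using zd[OF t'(2)] zt by simp
      from axis_chart_curve_derivative[OF ch w(1) Dk(2) this] w(2)
      show ?thesis using sg Dk(1) by (intro conjI exI[of _ "1 / k"]) auto
    qed
    ultimately show "half_orbit F \<sigma> (\<lambda>t. ?g (z t)) \<xi>" using \<sigma> by (simp add: half_orbit_def)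
  qed
  have all: "z ` {0..\<tau>} \<subseteq> T ` U"
  proof (rule ccontr)
    assume "\<not> z ` {0..\<tau>} \<subseteq> T ` U"
    have opW: "open (T ` U)" using axis_chart_open_image[OF ch U(1) order_trans[OF UcU U(2)]] .
    \<comment> \<open>\<open>A\<close> is the compact set of times outside the image of
      \<open>U\<close>. Its minimum \<open>t1\<close> is the first exit time; there the curve is
      still in the image of the compact closure, so \<open>trap\<close> applies and gives the
      contradiction.\<close>
    define A where "A = {0..\<tau>} \<inter> z -` (- (T ` U))"
    have "closed A" unfolding A_def
      using cz opW by (intro continuous_closed_preimage) (simp_all add: closed_Compl)
    moreover have "bounded A" unfolding A_def by (rule bounded_subset[of "{0..\<tau>}"]) simp_all
    ultimately have "compact A" by (simp add: compact_eq_bounded_closed)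
    moreover have "A \<noteq> {}"
      using \<open>\<not> z ` {0..\<tau>} \<subseteq> T ` U\<close> unfolding A_def image_subset_iff by blast
    ultimately have "\<exists>t1\<in>A. \<forall>t\<in>A. t1 \<le> t" by (rule compact_attains_inf)
    then obtain t1 where t1: "t1 \<in> A" "\<And>t. t \<in> A \<Longrightarrow> t1 \<le> t" by blast
    have "z 0 \<in> T ` U" using imageI[OF U(3), of T] T0 by simp
    then have pos: "0 < t1" "t1 \<le> \<tau>" "z t1 \<notin> T ` U"
      using t1(1) unfolding A_def by (auto simp only: less_le Int_iff atLeastAtMost_iff vimage_eq Compl_iff)
    have before: "z t \<in> T ` closure U" if "t \<in> {0..<t1}" for t
      proof -
      have "t \<notin> A" using t1(2)[of t] that by auto
      then have "z t \<in> T ` U" using that pos unfolding A_def by simp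
      then show ?thesis using image_mono[OF UcU] by (rule rev_subsetD)
    qed
    have "bounded (closure U)" by (rule bounded_subset[OF _ U(2)]) simp
    then have "compact (T ` closure U)"
      by (intro compact_continuous_image continuous_on_subset[OF contT U(2)])
        (simp add: compact_eq_bounded_closed)
    then have "closed ({0..t1} \<inter> z -` (T ` closure U))"
      using pos by (intro continuous_closed_preimage continuous_on_subset[OF cz])
        (simp_all add: compact_imp_closed)
    moreover have "{0..<t1} \<subseteq> {0..t1} \<inter> z -` (T ` closure U)"
      using before by (intro subsetI) (simp only: Int_iff vimage_eq, simp)
    ultimately have "closure {0..<t1} \<subseteq> {0..t1} \<inter> z -` (T ` closure U)" by (rule closure_minimal[rotated])
    then have "z ` {0..t1} \<subseteq> T ` closure U"
      using pos by (simp add: closure_atLeastLessThan image_subset_iff_subset_vimage)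
    note sub = this
    have "?g (z t1) \<in> U" using step[OF pos(1,2) sub] trap[of t1 "\<lambda>t. ?g (z t)"] by blast
    moreover have "z t1 \<in> T ` ball 0 \<epsilon>"
      using pos by (intro subsetD[OF image_mono[OF U(2)] subsetD[OF sub imageI]]) simp
    ultimately have "z t1 \<in> T ` U" by (metis f_inv_into_f imageI)
    then show False using pos(3) by contradiction
  qed
  then have "z ` {0..\<tau>} \<subseteq> T ` closure U" using image_mono[OF UcU] by (rule order_trans)
  note st = step[OF \<tau> order_refl this]
  moreover have "?g (z t) \<in> U" "T (?g (z t)) = z t" if tt: "t \<in> {0..\<tau>}" for t
  proof -
    obtain w where w: "w \<in> U" "z t = T w" using subsetD[OF all imageI[OF tt]] by (rule imageE)
    then have "?g (z t) = w" using inv_into_f_f[OF inj subsetD[OF U(2) subsetD[OF UcU]]] by simp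
    then show "?g (z t) \<in> U" "T (?g (z t)) = z t" using w by simp_all
  qed
  ultimately have "half_orbit F \<tau> (\<lambda>t. ?g (z t)) \<xi>" "(\<lambda>t. ?g (z t)) ` {0..\<tau>} \<subseteq> U"
    "T (?g (z \<tau>)) = z \<tau>" using \<tau> by (blast, blast, simp)
  then show ?thesis using z1 by (intro exI[of _ \<tau>] exI[of _ "\<lambda>t. ?g (z t)"]) simp
qed

section \<open>Filippov orbits and reflection of the lower half plane\<close>

text \<open>Where the inclusion leaves a single velocity, the weak velocity agrees almost everywhere
  with the field along the curve. Inside the ball that function is continuous, so the fundamental
  theorem makes the curve differentiable at every time and not only at almost every one.\<close>

lemma filippov_orbit_classical:
  assumes orb: "filippov_orbit Zp Zm {0..\<tau>} z" and \<tau>: "0 < \<tau>"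
    and fld: "\<And>t. t \<in> {0<..<\<tau>} \<Longrightarrow> filippov_field Zp Zm (z t) = {Z (z t)}"
    and contZ: "continuous_on (ball 0 \<rho>) Z"
  shows "continuous_on {0..\<tau>} z"
    and "\<And>t. t \<in> {0<..<\<tau>} \<Longrightarrow> z t \<in> ball 0 \<rho> \<Longrightarrow> (z has_vector_derivative Z (z t)) (at t)"
proof -
  obtain v S where v: "\<And>s t. s \<in> {0..\<tau>} \<Longrightarrow> t \<in> {0..\<tau>} \<Longrightarrow> s \<le> t \<Longrightarrow>
      v absolutely_integrable_on {s..t} \<and> integral {s..t} v = z t - z s"
    and S: "negligible S" "\<And>t. t \<in> {0..\<tau>} - S \<Longrightarrow> v t \<in> filippov_field Zp Zm (z t)"
    using orb unfolding filippov_orbit_def by blast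
  have "v integrable_on {0..\<tau>}"
    using v[of 0 \<tau>] \<tau> by (auto intro: set_lebesgue_integral_eq_integral(1))
  then have "continuous_on {0..\<tau>} (\<lambda>t. z 0 + integral {0..t} v)"
    by (intro continuous_intros indefinite_integral_continuous_1)
  then show cz: "continuous_on {0..\<tau>} z"
    by (rule continuous_on_eq) (use v[of 0] \<tau> in auto)
  fix t assume t: "t \<in> {0<..<\<tau>}" and zt: "z t \<in> ball 0 \<rho>"
  have "continuous_on {0<..<\<tau>} z" using cz by (rule continuous_on_subset) auto
  then have "open ({0<..<\<tau>} \<inter> z -` ball 0 \<rho>)" by (intro continuous_open_preimage) auto
  then obtain e where e: "e > 0" "cball t e \<subseteq> {0<..<\<tau>} \<inter> z -` ball 0 \<rho>"
    using t zt open_contains_cball_eq[of "{0<..<\<tau>} \<inter> z -` ball 0 \<rho>"] by blast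
  define a b where "a = t - e" and "b = t + e"
  have ab: "{a..b} \<subseteq> {0<..<\<tau>} \<inter> z -` ball 0 \<rho>" "a < t" "t < b"
    using e by (auto simp: a_def b_def cball_eq_atLeastAtMost)
  have cZz: "continuous_on {a..b} (\<lambda>u. Z (z u))"
    by (rule continuous_on_compose2[OF contZ continuous_on_subset[OF cz]]) (use ab(1) in force)+
  have zeq: "z a + integral {a..u} (\<lambda>u. Z (z u)) = z u" if u: "u \<in> {a..b}" for u
  proof -
    have in0: "{a..u} \<subseteq> {0<..<\<tau>}" using ab u by (meson Int_subset_iff atLeastatMost_subset_iff
      atLeastAtMost_iff order_refl order_trans)
    have "integral {a..u} (\<lambda>u. Z (z u)) = integral {a..u} v"
    proof (rule integral_spike[OF S(1)])
      fix s assume s: "s \<in> {a..u} - S"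
      then have "s \<in> {0<..<\<tau>}" using in0 by blast
      then show "v s = Z (z s)" using S(2)[of s] fld[of s] s by auto
    qed
    moreover have "a \<in> {0..\<tau>}" "u \<in> {0..\<tau>}" "a \<le> u" using ab(1) u by (auto simp: subset_iff)
    ultimately show ?thesis using v[of a u] by simp
  qed
  have "((\<lambda>u. z a + integral {a..u} (\<lambda>u. Z (z u))) has_vector_derivative 0 + Z (z t)) (at t within {a..b})"
    using ab by (intro has_vector_derivative_add has_vector_derivative_const
      integral_has_vector_derivative[OF cZz]) auto
  then have "(z has_vector_derivative Z (z t)) (at t within {a..b})"
    by (intro has_vector_derivative_transform[where g = z and
          f = "\<lambda>u. z a + integral {a..u} (\<lambda>u. Z (z u))"]) (use ab zeq in simp_all)
  then show "(z has_vector_derivative Z (z t)) (at t)"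
    using ab by (simp add: at_within_Icc_at)
qed

text \<open>Reflecting in the \<open>x\<close>-axis and reversing time turns backward lower orbits into forward
  upper ones.\<close>

definition flip_field :: "vfield \<Rightarrow> vfield" where
  "flip_field Z w = (- fst (Z (fst w, - snd w)), snd (Z (fst w, - snd w)))"

lemma travels_to_upper_passage:
  assumes "travels_to Zp Zm 1 x x'" "continuous_on (ball 0 \<rho>) Zp"
  shows "passage \<rho> Zp x x'"
proof -
  obtain \<tau> z where z: "\<tau> > 0" "filippov_orbit Zp Zm {0..\<tau>} z" "z 0 = (x, 0)" "z \<tau> = (x', 0)"
    "\<And>t. t \<in> {0<..<\<tau>} \<Longrightarrow> snd (z t) > 0"
    using assms(1) unfolding travels_to_def by auto
  have fld: "\<And>t. t \<in> {0<..<\<tau>} \<Longrightarrow> filippov_field Zp Zm (z t) = {Zp (z t)}"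
    using z(5) by (fastforce simp: filippov_field_def)
  have cl: "continuous_on {0..\<tau>} z"
    "\<And>t. t \<in> {0<..<\<tau>} \<Longrightarrow> z t \<in> ball 0 \<rho> \<Longrightarrow> (z has_vector_derivative Zp (z t)) (at t)"
    using filippov_orbit_classical[OF z(2,1) _ assms(2)] fld by blast+
  show ?thesis unfolding passage_def using z cl by blast
qed

text \<open>Time reversal exchanges the endpoints, so the flipped passage starts at the positive
  abscissa like an upper one. It computes the inverse of the lower half-return map, which is the map
  that enters the displacement function.\<close>

lemma travels_to_lower_passage:
  assumes "travels_to Zp Zm (-1) x x'" "continuous_on (ball 0 \<rho>) Zm"
  shows "passage \<rho> (flip_field Zm) x' x"
proof -
  obtain \<tau> z where z: "\<tau> > 0" "filippov_orbit Zp Zm {0..\<tau>} z" "z 0 = (x, 0)" "z \<tau> = (x', 0)"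
    "\<And>t. t \<in> {0<..<\<tau>} \<Longrightarrow> snd (z t) < 0"
    using assms(1) unfolding travels_to_def by auto
  have fld: "\<And>t. t \<in> {0<..<\<tau>} \<Longrightarrow> filippov_field Zp Zm (z t) = {Zm (z t)}"
    using z(5) by (fastforce simp: filippov_field_def)
  have cl: "continuous_on {0..\<tau>} z"
    "\<And>t. t \<in> {0<..<\<tau>} \<Longrightarrow> z t \<in> ball 0 \<rho> \<Longrightarrow> (z has_vector_derivative Zm (z t)) (at t)"
    using filippov_orbit_classical[OF z(2,1) _ assms(2)] fld by blast+
  define R where "R = (\<lambda>p :: real \<times> real. (fst p, - snd p))"
  have blR: "bounded_linear R" unfolding R_def
    by (intro bounded_linear_Pair bounded_linear_fst bounded_linear_minus bounded_linear_snd)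
  define y where "y = (\<lambda>t. R (z (\<tau> - t)))"
  have "continuous_on {0..\<tau>} (\<lambda>t. z (\<tau> - t))"
    by (rule continuous_on_compose2[OF cl(1)]) (auto intro!: continuous_intros)
  then have "continuous_on {0..\<tau>} y" unfolding y_def R_def by (intro continuous_intros)
  moreover have "snd (y t) > 0 \<and>
      (y t \<in> ball 0 \<rho> \<longrightarrow> (y has_vector_derivative flip_field Zm (y t)) (at t))"
    if t: "t \<in> {0<..<\<tau>}" for t
  proof (intro conjI impI)
    have t': "\<tau> - t \<in> {0<..<\<tau>}" using t by auto
    then show "snd (y t) > 0" using z(5)[of "\<tau> - t"] by (simp add: y_def R_def)
    assume "y t \<in> ball 0 \<rho>"
    then have "z (\<tau> - t) \<in> ball 0 \<rho>" by (simp add: y_def R_def norm_prod_def)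
    from cl(2)[OF t' this]
    have "(z has_vector_derivative Zm (z (\<tau> - t))) (at (\<tau> - t))" .
    moreover have "((\<lambda>t. \<tau> - t) has_vector_derivative - 1) (at t)"
      by (auto intro!: derivative_eq_intros)
    ultimately have "((z \<circ> (\<lambda>t. \<tau> - t)) has_vector_derivative (- 1) *\<^sub>R Zm (z (\<tau> - t))) (at t)"
      by (intro vector_diff_chain_at) auto
    from bounded_linear.has_vector_derivative[OF blR this]
    have "(y has_vector_derivative R ((- 1) *\<^sub>R Zm (z (\<tau> - t)))) (at t)" by (simp add: y_def o_def)
    moreover have "R ((- 1) *\<^sub>R Zm (z (\<tau> - t))) = flip_field Zm (y t)"
      by (simp add: flip_field_def y_def R_def)
    ultimately show "(y has_vector_derivative flip_field Zm (y t)) (at t)" by simp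
  qed
  moreover have "y 0 = (x', 0)" "y \<tau> = (x, 0)" using z by (auto simp: y_def R_def)
  ultimately show ?thesis unfolding passage_def using z(1) by blast
qed

lemma filterlim_flip: "filterlim (\<lambda>w. (fst w, - snd w)) (nhds 0) (nhds (0 :: real \<times> real))"
proof -
  have id: "((\<lambda>w :: real \<times> real. w) \<longlongrightarrow> 0) (nhds 0)" by (rule filterlim_ident)
  have "((\<lambda>w. (fst w, - snd w)) \<longlongrightarrow> (fst (0 :: real \<times> real), - snd (0 :: real \<times> real))) (nhds 0)"
    by (rule tendsto_Pair[OF tendsto_fst[OF id] tendsto_minus[OF tendsto_snd[OF id]]])
  then show ?thesis by (simp add: zero_prod_def)
qed

lemma expands_at_0_flip:
  assumes "expands_at_0 f a"
  shows "expands_at_0 (\<lambda>w. c * f (fst w, - snd w)) (\<lambda>i j. c * (-1) ^ j * a i j)"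
proof -
  have "\<forall>\<^sub>F w in nhds 0. ((\<lambda>(i, j). a i j * fst w ^ i * (- snd w) ^ j) has_sum f (fst w, - snd w)) UNIV"
    using filterlim_iff[THEN iffD1, OF filterlim_flip] assms
    unfolding expands_at_0_def by force
  then show ?thesis unfolding expands_at_0_def
  proof eventually_elim
    case (elim w)
    have e: "(\<lambda>(i, j). c * (-1) ^ j * a i j * fst w ^ i * snd w ^ j) =
        (\<lambda>p. c * (case p of (i, j) \<Rightarrow> a i j * fst w ^ i * (- snd w) ^ j))"
      using power_minus[of "snd w"] by (auto simp: fun_eq_iff)
    show ?case unfolding e by (rule has_sum_cmult_right[OF elim])
  qed
qed

lemma admissible_change_flip:
  assumes "admissible_change q1 \<Phi> \<Psi>"
  shows "admissible_change q1 (\<lambda>w. \<Phi> (fst w, - snd w)) (\<lambda>w. - \<Psi> (fst w, - snd w))"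
proof -
  have an: "analytic_at_0 (\<lambda>w. c * f (fst w, - snd w))" if "analytic_at_0 f" for c f
    using that expands_at_0_flip[of f _ c] by (auto simp: analytic_at_0_def)
  have O: "(\<lambda>w. f (fst w, - snd w)) \<in> O[nhds 0](\<lambda>w. norm w ^ 2)"
    if "f \<in> O[nhds 0](\<lambda>w :: real \<times> real. norm w ^ 2)" for f :: "real \<times> real \<Rightarrow> real"
    using landau_o.big.compose[OF that filterlim_flip] by (simp add: norm_prod_def)
  show ?thesis
    using assms an[of \<Phi> 1] an[of \<Psi> "-1"] O[of \<Phi>] O[of \<Psi>] by (simp add: admissible_change_def)
qed

text \<open>Old and new coordinates are reflected together, so the chart becomes its conjugate
  \<open>R (T (R w))\<close>. It is again a coordinate map, with \<open>q2\<close> and \<Psi>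
  changing sign, and it is unchanged on the axis. The minus sign of time reversal appears on both
  sides of the linear relation.\<close>

lemma carries_to_flip:
  assumes "carries_to (-1) (coord_map q1 q2 \<Phi> \<Psi>) K Z F"
  shows "carries_to 1 (coord_map q1 (- q2) (\<lambda>w. \<Phi> (fst w, - snd w)) (\<lambda>w. - \<Psi> (fst w, - snd w)))
    (\<lambda>w. K (fst w, - snd w)) (flip_field Z) (flip_field F)"
proof -
  define R where "R = (\<lambda>p :: real \<times> real. (fst p, - snd p))"
  have blR: "bounded_linear R" unfolding R_def
    by (intro bounded_linear_Pair bounded_linear_fst bounded_linear_minus bounded_linear_snd)
  have RR: "R (R p) = p" for p by (simp add: R_def)
  let ?T = "coord_map q1 q2 \<Phi> \<Psi>"
  have T: "coord_map q1 (- q2) (\<lambda>w. \<Phi> (fst w, - snd w)) (\<lambda>w. - \<Psi> (fst w, - snd w)) = (\<lambda>w. R (?T (R w)))"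
    by (simp add: coord_map_def R_def fun_eq_iff)
  have fl: "flip_field Z = (\<lambda>w. - R (Z (R w)))" for Z
    by (simp add: flip_field_def R_def fun_eq_iff)
  have fR: "filterlim R (nhds 0) (nhds 0)" using filterlim_flip by (simp add: R_def)
  have "\<forall>\<^sub>F w in nhds 0. (- 1 * snd (R w) \<ge> 0 \<longrightarrow> K (R w) > 0) \<and>
        (- 1 * snd (R w) > 0 \<longrightarrow>
          (\<exists>D. (?T has_derivative D) (at (R w)) \<and> D (F (R w)) = K (R w) *\<^sub>R Z (?T (R w))))"
    using assms fR unfolding carries_to_def filterlim_iff by blast
  then show ?thesis unfolding carries_to_def T fl
  proof eventually_elim
    case (elim w)
    have s: "snd (R w) = - snd w" by (simp add: R_def)
    have "\<exists>D. ((\<lambda>w. R (?T (R w))) has_derivative D) (at w) \<and>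
        D (- R (F (R w))) = K (fst w, - snd w) *\<^sub>R (- R (Z (R (R (?T (R w))))))"
      if w: "snd w > 0"
    proof -
      obtain D where D: "(?T has_derivative D) (at (R w))" "D (F (R w)) = K (R w) *\<^sub>R Z (?T (R w))"
        using elim w s by auto
      have "(R has_derivative R) (at w)" using blR by (rule bounded_linear_imp_has_derivative)
      from has_derivative_compose[OF this D(1)]
      have "((\<lambda>w. ?T (R w)) has_derivative (\<lambda>h. D (R h))) (at w)" .
      from bounded_linear.has_derivative[OF blR this]
      have 1: "((\<lambda>w. R (?T (R w))) has_derivative (\<lambda>h. R (D (R h)))) (at w)" .
      have linR: "linear R" using blR by (rule bounded_linear.linear)
      have linD: "linear D" using D(1) has_derivative_bounded_linear bounded_linear.linear by blast
      have "R (D (R (- R (F (R w))))) = - R (K (R w) *\<^sub>R Z (?T (R w)))"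
        by (simp add: linear_neg[OF linR] linear_neg[OF linD] RR D(2))
      also have "\<dots> = K (R w) *\<^sub>R (- R (Z (R (R (?T (R w))))))"
        by (simp add: linear_scale[OF linR] RR)
      finally show ?thesis using 1 by (auto simp: R_def)
    qed
    then show ?case using elim s by (auto simp: R_def)
  qed
qed

lemma homogeneous_from_flip:
  assumes "homogeneous_from d G"
  shows "homogeneous_from d (flip_field G)"
proof -
  obtain a b where ab: "expands_at_0 (\<lambda>w. fst (G w)) a" "expands_at_0 (\<lambda>w. snd (G w)) b"
    "\<And>i j. i + j < d \<Longrightarrow> a i j = 0 \<and> b i j = 0"
    using assms by (auto simp: homogeneous_from_def)
  show ?thesis unfolding homogeneous_from_def flip_field_def
    using expands_at_0_flip[OF ab(1), of "-1"] expands_at_0_flip[OF ab(2), of 1] ab(3)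
    by (intro exI conjI) (auto)
qed

lemma quasi_homogeneous_from_flip:
  assumes "quasi_homogeneous_from l d R"
  shows "quasi_homogeneous_from l d (flip_field R)"
proof -
  obtain a b where ab: "expands_at_0 (\<lambda>w. fst (R w)) a" "expands_at_0 (\<lambda>w. snd (R w)) b"
    "\<And>i j. i + 2 * l * j < d + 1 \<Longrightarrow> a i j = 0" "\<And>i j. i + 2 * l * j < d + 2 * l \<Longrightarrow> b i j = 0"
    using assms by (auto simp: quasi_homogeneous_from_def)
  show ?thesis unfolding quasi_homogeneous_from_def flip_field_def
    using expands_at_0_flip[OF ab(1), of "-1"] expands_at_0_flip[OF ab(2), of 1] ab(3,4)
    by (intro exI conjI) (auto)
qed

text \<open>Reflection turns \<open>y ^ (k - 1)\<close> into \<open>(-1) ^ (k - 1)\<close> times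
  itself and time reversal adds one more sign. On the rotation part the two signs cancel.\<close>

lemma focus_normal_form_flip:
  assumes "focus_normal_form N \<gamma> F"
  shows "focus_normal_form N (\<lambda>k. (-1) ^ k * \<gamma> k) (flip_field F)"
proof -
  obtain G where G: "homogeneous_from (N + 2) G" and
    F: "\<And>x y. F (x, y) = (\<gamma> 1 * x - y, x + \<gamma> 1 * y)
                 + (\<Sum>i=1..N. (\<gamma> (i + 1) * y ^ i) *\<^sub>R (x, y)) + G (x, y)"
    using assms by (auto simp: focus_normal_form_def)
  have "flip_field F (x, y) = ((-1) ^ 1 * \<gamma> 1 * x - y, x + (-1) ^ 1 * \<gamma> 1 * y)
      + (\<Sum>i=1..N. ((-1) ^ (i + 1) * \<gamma> (i + 1) * y ^ i) *\<^sub>R (x, y)) + flip_field G (x, y)" for x y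
    unfolding flip_field_def fst_conv snd_conv F
    by (rule prod_eqI) (simp_all add: fst_sum snd_sum power_minus[of y] mult_ac flip: sum_negf)
  then show ?thesis using homogeneous_from_flip[OF G] unfolding focus_normal_form_def by blast
qed

text \<open>All correction coefficients vanish, so the potential of the flipped lower system is even
  and its half map deviates from the identity only through the remainder.\<close>

lemma lower_parabolic_normal_form_flip:
  assumes "lower_parabolic_normal_form N l F"
  shows "upper_parabolic_normal_form N l (\<lambda>_. 0) (flip_field F)"
proof -
  obtain R where R: "quasi_homogeneous_from l N R" and
    F: "\<And>x y. F (x, y) = (1, x ^ (2 * l - 1)) + R (x, y)"
    using assms by (auto simp: lower_parabolic_normal_form_def)
  have "flip_field F (x, y) =
      (-1, x ^ (2 * l - 1) + (\<Sum>i=1..N. 0 * x ^ (2 * l - 1 + i))) + flip_field R (x, y)" for x y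
    unfolding flip_field_def fst_conv snd_conv F by simp
  then show ?thesis using quasi_homogeneous_from_flip[OF R]
    unfolding upper_parabolic_normal_form_def by blast
qed

section \<open>Polar form of the focus normal form\<close>

text \<open>The two expressions are r r' and r^2 \<theta>'. The correction terms are multiples of
  the position vector, so they enter only the first one; the remainder, of degree at least
  \<open>N + 2\<close>, gains one order by multiplication with the position.\<close>

lemma focus_normal_form_polar:
  assumes "focus_normal_form N \<gamma> F"
  obtains C r0 where "0 \<le> C" "0 < r0" "r0 \<le> 1"
    "\<And>a b p q r. F (a, b) = (p, q) \<Longrightarrow> norm (a, b) = r \<Longrightarrow> r \<le> r0 \<Longrightarrow>
       \<bar>a * p + b * q - r\<^sup>2 * (\<Sum>j=1..N+1. \<gamma> j * b ^ (j - 1))\<bar> \<le> C * r ^ (N + 3) \<and>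
       \<bar>a * q - b * p - r\<^sup>2\<bar> \<le> C * r ^ (N + 3)"
proof -
  obtain G where G: "homogeneous_from (N + 2) G" and
    F: "\<And>x y. F (x, y) = (\<gamma> 1 * x - y, x + \<gamma> 1 * y)
                 + (\<Sum>i=1..N. (\<gamma> (i + 1) * y ^ i) *\<^sub>R (x, y)) + G (x, y)"
    using assms by (auto simp: focus_normal_form_def)
  obtain A B where AB: "expands_at_0 (\<lambda>w. fst (G w)) A" "expands_at_0 (\<lambda>w. snd (G w)) B"
    "\<And>i j. i + j < N + 2 \<Longrightarrow> A i j = 0 \<and> B i j = 0"
    using G by (auto simp: homogeneous_from_def)
  obtain C1 r1 where C1: "0 \<le> C1" "0 < r1" "r1 \<le> 1" "\<And>s x y. 0 \<le> s \<Longrightarrow> s \<le> 1 \<Longrightarrow> \<bar>x\<bar> \<le> r1 * s \<Longrightarrow>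
      \<bar>y\<bar> \<le> r1 * s ^ 1 \<Longrightarrow> \<bar>fst (G (x, y))\<bar> \<le> C1 * s ^ (N + 2)"
    by (rule expands_at_0_quasi_homogeneous_bound[OF AB(1), of 1 "N + 2"]) (use AB(3) in auto)
  obtain C2 r2 where C2: "0 \<le> C2" "0 < r2" "r2 \<le> 1" "\<And>s x y. 0 \<le> s \<Longrightarrow> s \<le> 1 \<Longrightarrow> \<bar>x\<bar> \<le> r2 * s \<Longrightarrow>
      \<bar>y\<bar> \<le> r2 * s ^ 1 \<Longrightarrow> \<bar>snd (G (x, y))\<bar> \<le> C2 * s ^ (N + 2)"
    by (rule expands_at_0_quasi_homogeneous_bound[OF AB(2), of 1 "N + 2"]) (use AB(3) in auto)
  define D where "D = max (C1 / r1 ^ (N + 2)) (C2 / r2 ^ (N + 2))"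
  have "0 \<le> C1 / r1 ^ (N + 2)" using C1 by simp
  then have D: "0 \<le> D" unfolding D_def by (rule max.coboundedI1)
  define r0 where "r0 = min r1 r2"
  show ?thesis
  proof (rule that[of "2 * D" r0])
    show "0 \<le> 2 * D" "0 < r0" "r0 \<le> 1" using D C1 C2 by (auto simp: r0_def)
    fix a b p q r
    assume pq: "F (a, b) = (p, q)" and r: "norm (a, b) = r" "r \<le> r0"
    have ab: "\<bar>a\<bar> \<le> r" "\<bar>b\<bar> \<le> r" "0 \<le> r"
      using norm_fst_le[of a b] norm_snd_le[of b a] norm_ge_zero[of "(a, b)"] r by auto
    have r2eq: "r\<^sup>2 = a\<^sup>2 + b\<^sup>2" using r by (auto simp: norm_Pair)
    define g1 where "g1 = fst (G (a, b))"
    define g2 where "g2 = snd (G (a, b))"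
    have "\<bar>g1\<bar> \<le> C1 * (r / r1) ^ (N + 2)" unfolding g1_def
      using C1 ab r by (intro C1(4)) (auto simp: r0_def)
    also have "\<dots> = C1 / r1 ^ (N + 2) * r ^ (N + 2)" by (simp only: power_divide) simp
    also have "\<dots> \<le> D * r ^ (N + 2)" using ab by (intro mult_right_mono) (auto simp: D_def)
    finally have g1: "\<bar>g1\<bar> \<le> D * r ^ (N + 2)" .
    have "\<bar>g2\<bar> \<le> C2 * (r / r2) ^ (N + 2)" unfolding g2_def
      using C2 ab r by (intro C2(4)) (auto simp: r0_def)
    also have "\<dots> = C2 / r2 ^ (N + 2) * r ^ (N + 2)" by (simp only: power_divide) simp
    also have "\<dots> \<le> D * r ^ (N + 2)" using ab by (intro mult_right_mono) (auto simp: D_def)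
    finally have g2: "\<bar>g2\<bar> \<le> D * r ^ (N + 2)" .
    define S where "S = (\<Sum>j=1..N+1. \<gamma> j * b ^ (j - 1))"
    have S: "S = \<gamma> 1 + (\<Sum>i=1..N. \<gamma> (i + 1) * b ^ i)"
      unfolding S_def by (subst sum.atLeast_Suc_atMost)
        (simp_all add: sum.shift_bounds_cl_Suc_ivl del: sum.cl_ivl_Suc)
    have p: "p = S * a - b + g1"
      using arg_cong[OF pq, of fst] unfolding F S g1_def
      by (simp add: fst_sum sum_distrib_left sum_distrib_right algebra_simps)
    have q: "q = a + S * b + g2"
      using arg_cong[OF pq, of snd] unfolding F S g2_def
      by (simp add: snd_sum sum_distrib_left sum_distrib_right algebra_simps)
    have t: "\<bar>u * g\<bar> \<le> r * (D * r ^ (N + 2))" if "\<bar>u\<bar> \<le> r" "\<bar>g\<bar> \<le> D * r ^ (N + 2)" for u g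
      using that ab by (simp only: abs_mult) (intro mult_mono, auto)
    have e: "2 * D * r ^ (N + 3) = 2 * (r * (D * r ^ (N + 2)))" by (simp add: power_add numeral_3_eq_3)
    have "a * p + b * q - r\<^sup>2 * S = a * g1 + b * g2" "a * q - b * p - r\<^sup>2 = a * g2 - b * g1"
      unfolding p q r2eq by (simp_all add: algebra_simps power2_eq_square)
    then show "\<bar>a * p + b * q - r\<^sup>2 * (\<Sum>j=1..N+1. \<gamma> j * b ^ (j - 1))\<bar> \<le> 2 * D * r ^ (N + 3) \<and>
       \<bar>a * q - b * p - r\<^sup>2\<bar> \<le> 2 * D * r ^ (N + 3)"
      using t[OF ab(1) g1] t[OF ab(2) g2] t[OF ab(1) g2] t[OF ab(2) g1]
      unfolding e S_def[symmetric] by linarith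
  qed
qed

text \<open>In the upper half plane the polar angle is the arccosine of x / r, so no continuous lift
  of the angle along the orbit has to be chosen.\<close>

lemma polar_derivatives:
  assumes w: "(w has_vector_derivative (p, q)) (at t)" and wt: "w t = (a, b)" and b: "0 < b"
  defines "r \<equiv> norm (a, b)"
  shows "((\<lambda>s. norm (w s)) has_real_derivative (a * p + b * q) / r) (at t)"
    and "((\<lambda>s. arccos (fst (w s) / norm (w s))) has_real_derivative (a * q - b * p) / r\<^sup>2) (at t)"
proof -
  have f: "((\<lambda>s. fst (w s)) has_real_derivative p) (at t)"
    using bounded_linear.has_vector_derivative[OF bounded_linear_fst w]
    by (simp add: has_real_derivative_iff_has_vector_derivative)
  have g: "((\<lambda>s. snd (w s)) has_real_derivative q) (at t)"
    using bounded_linear.has_vector_derivative[OF bounded_linear_snd w]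
    by (simp add: has_real_derivative_iff_has_vector_derivative)
  have nw: "norm v = sqrt ((fst v)\<^sup>2 + (snd v)\<^sup>2)" for v :: "real \<times> real"
    by (simp add: norm_prod_def)
  have r2: "r\<^sup>2 = a\<^sup>2 + b\<^sup>2" and r: "0 < r" using b by (auto simp: r_def norm_Pair sum_power2_gt_zero_iff)
  have "((\<lambda>s. (fst (w s))\<^sup>2 + (snd (w s))\<^sup>2) has_real_derivative 2 * a * p + 2 * b * q) (at t)"
    using f g by (auto intro!: derivative_eq_intros simp: wt)
  moreover have "DERIV sqrt ((fst (w t))\<^sup>2 + (snd (w t))\<^sup>2) :> inverse (sqrt ((fst (w t))\<^sup>2 + (snd (w t))\<^sup>2)) / 2"
    using b by (intro DERIV_real_sqrt) (simp add: wt sum_power2_gt_zero_iff)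
  moreover have sq: "sqrt ((fst (w t))\<^sup>2 + (snd (w t))\<^sup>2) = r" by (simp add: wt r_def norm_Pair)
  moreover have v: "inverse r / 2 * (2 * a * p + 2 * b * q) = (a * p + b * q) / r"
    using r by (simp add: field_simps)
  ultimately have "((\<lambda>s. sqrt ((fst (w s))\<^sup>2 + (snd (w s))\<^sup>2)) has_real_derivative
      inverse (sqrt ((fst (w t))\<^sup>2 + (snd (w t))\<^sup>2)) / 2 * (2 * a * p + 2 * b * q)) (at t)"
    by (intro DERIV_chain2[where g = "\<lambda>s. (fst (w s))\<^sup>2 + (snd (w s))\<^sup>2"])
  then show nd: "((\<lambda>s. norm (w s)) has_real_derivative (a * p + b * q) / r) (at t)"
    unfolding nw sq v .
  have nz: "norm (w t) \<noteq> 0" using r by (simp add: wt r_def)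
  have q: "((\<lambda>s. fst (w s) / norm (w s)) has_real_derivative
      (p * r - a * ((a * p + b * q) / r)) / (r * r)) (at t)"
    using DERIV_divide[OF f nd nz] by (simp add: wt r_def)
  have lt: "\<bar>a / r\<bar> < 1"
  proof -
    have "\<bar>a\<bar>\<^sup>2 < r\<^sup>2" using b r2 by simp
    then have "\<bar>a\<bar> < r" using r by (meson less_imp_le power2_less_imp_less)
    then show ?thesis using r by (simp add: abs_divide)
  qed
  have "(a / r)\<^sup>2 + (b / r)\<^sup>2 = r\<^sup>2 / r\<^sup>2" by (simp only: power_divide r2 add_divide_distrib)
  then have "1 - (a / r)\<^sup>2 = (b / r)\<^sup>2" using r by simp
  then have s: "sqrt (1 - (a / r)\<^sup>2) = b / r" using r b by (simp add: real_sqrt_unique)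
  have "DERIV arccos (a / r) :> inverse (- sqrt (1 - (a / r)\<^sup>2))"
    using lt by (intro DERIV_arccos) linarith+
  then have "DERIV arccos (fst (w t) / norm (w t)) :> inverse (- (b / r))"
    unfolding s by (simp add: wt r_def)
  from DERIV_chain2[OF this q]
  have "((\<lambda>s. arccos (fst (w s) / norm (w s))) has_real_derivative
      inverse (- (b / r)) * ((p * r - a * ((a * p + b * q) / r)) / (r * r))) (at t)" .
  moreover have "inverse (- (b / r)) * ((p * r - a * ((a * p + b * q) / r)) / (r * r)) =
      (a * q - b * p) / r\<^sup>2"
  proof -
    have "(p * r - a * ((a * p + b * q) / r)) = (p * r\<^sup>2 - a * (a * p + b * q)) / r"
      using r by (simp add: field_simps power2_eq_square)
    also have "p * r\<^sup>2 - a * (a * p + b * q) = - b * (a * q - b * p)"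
      unfolding r2 by (simp add: algebra_simps power2_eq_square)
    finally show ?thesis using r b by (simp add: field_simps power2_eq_square)
  qed
  ultimately show "((\<lambda>s. arccos (fst (w s) / norm (w s))) has_real_derivative (a * q - b * p) / r\<^sup>2) (at t)"
    by simp
qed

text \<open>\<open>p\<close> is the orbit written as radius over angle. The constants
  \<open>C\<close> and \<open>M\<close> are separate parameters so that they can be fixed before
  \<xi>. A derivative is required only at interior angles because the chart relation is available
  only off the axis.\<close>

definition focus_profile :: "nat \<Rightarrow> (nat \<Rightarrow> real) \<Rightarrow> real \<Rightarrow> real \<Rightarrow> real \<Rightarrow> real \<Rightarrow> bool" where
  "focus_profile n \<gamma> C M \<xi> u \<longleftrightarrow> (\<exists>p. continuous_on {0..pi} p \<and> p 0 = \<xi> \<and> p pi = u \<and>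
     (\<forall>\<theta>\<in>{0..pi}. \<xi> / M \<le> p \<theta> \<and> p \<theta> \<le> M * \<xi>) \<and>
     (\<forall>\<theta>\<in>{0<..<pi}. \<exists>d. (p has_real_derivative d) (at \<theta>) \<and>
        \<bar>d - (\<Sum>j=1..n. \<gamma> j * p \<theta> ^ j * sin \<theta> ^ (j - 1))\<bar> \<le> C * \<xi> ^ (n + 1)))"

text \<open>In polar coordinates \<open>|r' / r|\<close> is bounded by a multiple of the angular speed, and the angle
  increases by at most \<open>\<pi>\<close>, which confines the orbit.\<close>

lemma focus_normal_form_orbit:
  assumes "focus_normal_form N \<gamma> F"
  obtains \<epsilon> M C where "0 < \<epsilon>" "1 \<le> M" "0 \<le> C"
    "\<And>\<tau> w \<xi> t. half_orbit F \<tau> w \<xi> \<Longrightarrow> 0 < \<xi> \<Longrightarrow> w ` {0..\<tau>} \<subseteq> cball 0 \<epsilon> \<Longrightarrow> w \<tau> \<noteq> 0 \<Longrightarrow>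
       t \<in> {0..\<tau>} \<Longrightarrow> \<xi> / M \<le> norm (w t) \<and> norm (w t) \<le> M * \<xi>"
    "\<And>\<tau> w \<xi> u. half_orbit F \<tau> w \<xi> \<Longrightarrow> 0 < \<xi> \<Longrightarrow> w ` {0..\<tau>} \<subseteq> cball 0 \<epsilon> \<Longrightarrow> w \<tau> = (- u, 0) \<Longrightarrow>
       0 < u \<Longrightarrow> focus_profile (N + 1) \<gamma> C M \<xi> u"
proof -
  obtain C r0 where C: "0 \<le> C" and r0: "0 < r0" "r0 \<le> 1" and
    pol: "\<And>a b p q r. F (a, b) = (p, q) \<Longrightarrow> norm (a, b) = r \<Longrightarrow> r \<le> r0 \<Longrightarrow>
       \<bar>a * p + b * q - r\<^sup>2 * (\<Sum>j=1..N+1. \<gamma> j * b ^ (j - 1))\<bar> \<le> C * r ^ (N + 3) \<and>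
       \<bar>a * q - b * p - r\<^sup>2\<bar> \<le> C * r ^ (N + 3)"
    by (rule focus_normal_form_polar[OF assms]) blast
  \<comment> \<open>With \<open>C * \<epsilon>\<close> at most 1/2 the remainder is at most half of
    r^2, which keeps the angular part at least r^2 / 2.\<close>
  define \<epsilon> where "\<epsilon> = min r0 (1 / (2 * (C + 1)))"
  have \<epsilon>: "0 < \<epsilon>" "\<epsilon> \<le> r0" "\<epsilon> \<le> 1" using C r0 by (auto simp: \<epsilon>_def)
  have "C * \<epsilon> \<le> (C + 1) * (1 / (2 * (C + 1)))" using C \<epsilon> by (intro mult_mono) (auto simp: \<epsilon>_def)
  also have "\<dots> = 1 / 2" using C by (simp add: divide_simps)
  finally have C\<epsilon>: "C * \<epsilon> \<le> 1 / 2" .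
  define M0 where "M0 = (\<Sum>j=1..N+1. \<bar>\<gamma> j\<bar>)"
  have M0: "0 \<le> M0" unfolding M0_def by (intro sum_nonneg) auto
  \<comment> \<open>\<open>K\<close> bounds the logarithmic derivative of the radius with respect to
    the angle: the radial part is at most \<open>(M0 + 1)\<close> r^2 and the angular part at least
    r^2 / 2. Over an angle of at most \<open>pi\<close> the radius changes by at most the factor
    \<open>M\<close>.\<close>
  define K where "K = 2 * (M0 + 1)"
  define M where "M = exp (K * pi)"
  have M: "1 \<le> M" using M0 by (simp add: M_def K_def)
  have Sb: "\<bar>\<Sum>j=1..N+1. \<gamma> j * b ^ (j - 1)\<bar> \<le> M0" if "\<bar>b\<bar> \<le> 1" for b :: real
    unfolding M0_def using that
    by (intro order_trans[OF sum_abs] sum_mono) (simp add: abs_mult power_abs mult_left_le power_le_one)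
  \<comment> \<open>The unknown speed factor \<open>c\<close> multiplies both the radial and the
    angular derivative; every later use divides one by the other or only needs
    \<open>c > 0\<close>.\<close>
  have pt: "\<exists>c rad ang. 0 < c \<and>
      ((\<lambda>s. norm (w s)) has_real_derivative c * rad / norm (w t)) (at t) \<and>
      ((\<lambda>s. arccos (fst (w s) / norm (w s))) has_real_derivative c * ang / (norm (w t))\<^sup>2) (at t) \<and>
      \<bar>rad - (norm (w t))\<^sup>2 * (\<Sum>j=1..N+1. \<gamma> j * snd (w t) ^ (j - 1))\<bar> \<le> C * norm (w t) ^ (N + 3) \<and>
      \<bar>ang - (norm (w t))\<^sup>2\<bar> \<le> C * norm (w t) ^ (N + 3) \<and>
      \<bar>rad\<bar> \<le> (M0 + 1) * (norm (w t))\<^sup>2 \<and> (norm (w t))\<^sup>2 / 2 \<le> ang"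
    if ho: "half_orbit F \<tau> w \<xi>" and t: "t \<in> {0<..<\<tau>}" and nt: "norm (w t) \<le> \<epsilon>" for \<tau> w \<xi> t
  proof -
    obtain a b where ab: "w t = (a, b)" by (cases "w t")
    obtain p q where pq: "F (a, b) = (p, q)" by (cases "F (a, b)")
    have "snd (w t) > 0 \<and> (\<exists>c>0. (w has_vector_derivative c *\<^sub>R F (w t)) (at t))"
      using ho t unfolding half_orbit_def by blast
    then obtain c where c: "c > 0" "(w has_vector_derivative c *\<^sub>R F (w t)) (at t)" and b: "b > 0"
      using ab by auto
    define r where "r = norm (a, b)"
    have re: "r \<le> \<epsilon>" using nt ab by (simp add: r_def)
    have r: "0 < r" using b by (simp add: r_def zero_prod_def)
    define S where "S = (\<Sum>j=1..N+1. \<gamma> j * b ^ (j - 1))"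
    have P: "\<bar>a * p + b * q - r\<^sup>2 * S\<bar> \<le> C * r ^ (N + 3)" "\<bar>a * q - b * p - r\<^sup>2\<bar> \<le> C * r ^ (N + 3)"
      using pol[OF pq r_def[symmetric]] re \<epsilon> unfolding S_def by auto
    have "(w has_vector_derivative (c * p, c * q)) (at t)" using c(2) ab pq by simp
    note pd = polar_derivatives[OF this ab b, folded r_def]
    have "\<bar>b\<bar> \<le> r" unfolding r_def using norm_snd_le[of b a] by simp
    then have "\<bar>b\<bar> \<le> 1" using re \<epsilon> by linarith
    then have S: "\<bar>S\<bar> \<le> M0" unfolding S_def by (rule Sb)
    have "C * r ^ (N + 3) = (C * r ^ (N + 1)) * r\<^sup>2" by (simp add: power_add numeral_3_eq_3 power2_eq_square)
    also have "r ^ (N + 1) \<le> r ^ 1" using r re \<epsilon> by (intro power_decreasing) auto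
    then have "C * r ^ (N + 1) \<le> C * \<epsilon>" using re C by (intro mult_left_mono) simp_all
    then have "(C * r ^ (N + 1)) * r\<^sup>2 \<le> (1 / 2) * r\<^sup>2" using C\<epsilon> by (intro mult_right_mono) auto
    finally have e: "C * r ^ (N + 3) \<le> r\<^sup>2 / 2" by simp
    have "\<bar>r\<^sup>2 * S\<bar> \<le> M0 * r\<^sup>2" using S by (simp add: abs_mult mult.commute mult_right_mono)
    then have "\<bar>a * p + b * q\<bar> \<le> (M0 + 1) * r\<^sup>2"
      using P(1) e by (simp add: algebra_simps)
    moreover have "r\<^sup>2 / 2 \<le> a * q - b * p" using P(2) e by linarith
    moreover have "a * (c * p) + b * (c * q) = c * (a * p + b * q)"
      "a * (c * q) - b * (c * p) = c * (a * q - b * p)" by (simp_all add: algebra_simps)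
    note pd = pd[unfolded this]
    ultimately have "0 < c \<and>
      ((\<lambda>s. norm (w s)) has_real_derivative c * (a * p + b * q) / r) (at t) \<and>
      ((\<lambda>s. arccos (fst (w s) / norm (w s))) has_real_derivative c * (a * q - b * p) / r\<^sup>2) (at t) \<and>
      \<bar>a * p + b * q - r\<^sup>2 * S\<bar> \<le> C * r ^ (N + 3) \<and> \<bar>a * q - b * p - r\<^sup>2\<bar> \<le> C * r ^ (N + 3) \<and>
      \<bar>a * p + b * q\<bar> \<le> (M0 + 1) * r\<^sup>2 \<and> r\<^sup>2 / 2 \<le> a * q - b * p"
      using pd P c(1) by (intro conjI)
    then show ?thesis unfolding ab fst_conv snd_conv r_def[symmetric] S_def[symmetric] by blast
  qed
  have nz: "w t \<noteq> 0" if "half_orbit F \<tau> w \<xi>" "0 < \<xi>" "w \<tau> \<noteq> 0" "t \<in> {0..\<tau>}" for \<tau> w \<xi> t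
  proof (cases "t = 0 \<or> t = \<tau>")
    case False
    then have "snd (w t) > 0" using that by (auto simp: half_orbit_def)
    then show ?thesis by auto
  qed (use that in \<open>auto simp: half_orbit_def zero_prod_def\<close>)
  have cont: "continuous_on {0..\<tau>} (\<lambda>s. norm (w s))"
    "continuous_on {0..\<tau>} (\<lambda>s. arccos (fst (w s) / norm (w s)))"
    if ho: "half_orbit F \<tau> w \<xi>" "0 < \<xi>" "w \<tau> \<noteq> 0" for \<tau> w \<xi>
  proof -
    have cw: "continuous_on {0..\<tau>} w" using ho by (simp add: half_orbit_def)
    then show "continuous_on {0..\<tau>} (\<lambda>s. norm (w s))" by (intro continuous_intros)
    have le: "\<bar>fst v\<bar> \<le> norm v" for v :: "real \<times> real" using norm_fst_le[of "fst v" "snd v"] by simp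
    have "-1 \<le> fst v / norm v \<and> fst v / norm v \<le> 1" for v :: "real \<times> real"
      using le[of v] by (auto simp: field_simps abs_le_iff divide_le_eq le_divide_eq)
    moreover have "continuous_on {0..\<tau>} (\<lambda>s. fst (w s) / norm (w s))"
      using cw nz[OF ho] by (intro continuous_intros) auto
    ultimately show "continuous_on {0..\<tau>} (\<lambda>s. arccos (fst (w s) / norm (w s)))"
      by (intro continuous_on_arccos) auto
  qed
  have apriori: "\<xi> / M \<le> norm (w t) \<and> norm (w t) \<le> M * \<xi>"
    if ho: "half_orbit F \<tau> w \<xi>" "0 < \<xi>" "w \<tau> \<noteq> 0" and sub: "w ` {0..\<tau>} \<subseteq> cball 0 \<epsilon>"
      and t: "t \<in> {0..\<tau>}" for \<tau> w \<xi> t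
  proof -
    define th where "th = (\<lambda>s. arccos (fst (w s) / norm (w s)))"
    have pos: "0 < norm (w s)" if "s \<in> {0..\<tau>}" for s using nz[OF ho that] by simp
    have small: "norm (w s) \<le> \<epsilon>" if "s \<in> {0..\<tau>}" for s
      using subsetD[OF sub imageI[OF that]] by simp
    have w0: "norm (w 0) = \<xi>" using ho by (simp add: half_orbit_def norm_Pair)
    have c0: "continuous_on {0..t} (\<lambda>s. ln (norm (w s)))" "continuous_on {0..t} th"
      using cont[OF ho] t pos unfolding th_def
      by (auto intro!: continuous_on_ln elim: continuous_on_subset)
    have D: "\<exists>x y. ((\<lambda>s. ln (norm (w s))) has_real_derivative x) (at s) \<and>
        (th has_real_derivative y) (at s) \<and> \<bar>x\<bar> \<le> K * y" if s: "0 < s" "s < t" for s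
    proof -
      have s': "s \<in> {0<..<\<tau>}" "s \<in> {0..\<tau>}" using s t by auto
      obtain c rad ang where c: "0 < c"
        "((\<lambda>s. norm (w s)) has_real_derivative c * rad / norm (w s)) (at s)"
        "(th has_real_derivative c * ang / (norm (w s))\<^sup>2) (at s)"
        "\<bar>rad\<bar> \<le> (M0 + 1) * (norm (w s))\<^sup>2" "(norm (w s))\<^sup>2 / 2 \<le> ang"
        using pt[OF ho(1) s'(1) small[OF s'(2)]] unfolding th_def by blast
      define r where "r = norm (w s)"
      have r: "0 < r" using pos[OF s'(2)] by (simp add: r_def)
      have l: "((\<lambda>s. ln (norm (w s))) has_real_derivative 1 / r * (c * rad / r)) (at s)"
        using c(2) DERIV_ln_divide[OF r] unfolding r_def
        by (intro DERIV_chain2[where f = ln and g = "\<lambda>s. norm (w s)"])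
      have "(M0 + 1) * r\<^sup>2 \<le> (M0 + 1) * (2 * ang)" using c(5) M0 by (intro mult_left_mono) (auto simp: r_def)
      moreover have "K * ang = (M0 + 1) * (2 * ang)" by (simp add: K_def)
      ultimately have "\<bar>rad\<bar> \<le> K * ang" using c(4) unfolding r_def by linarith
      then have "c / r\<^sup>2 * \<bar>rad\<bar> \<le> c / r\<^sup>2 * (K * ang)" using c(1) by (intro mult_left_mono) auto
      then have "\<bar>1 / r * (c * rad / r)\<bar> \<le> K * (c * ang / r\<^sup>2)"
        using c(1) r by (simp add: abs_mult power2_eq_square mult_ac)
      then show ?thesis using l c(3) unfolding r_def by blast
    qed
    \<comment> \<open>Monotonicity of ln r - K \<theta> and of ln r + K \<theta> in time gives the
      bound without dividing by the angular speed.\<close>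
    have "ln (norm (w t)) - K * th t \<le> ln (norm (w 0)) - K * th 0"
    proof (rule DERIV_nonpos_imp_decreasing_open[where f = "\<lambda>s. ln (norm (w s)) - K * th s"])
      fix s assume "0 < s" "s < t"
      from D[OF this] obtain x y where xy: "((\<lambda>s. ln (norm (w s))) has_real_derivative x) (at s)"
        "(th has_real_derivative y) (at s)" "\<bar>x\<bar> \<le> K * y" by blast
      then show "\<exists>y. ((\<lambda>s. ln (norm (w s)) - K * th s) has_real_derivative y) (at s) \<and> y \<le> 0"
        by (intro exI[of _ "x - K * y"]) (auto intro!: DERIV_diff DERIV_cmult)
    qed (use t c0 in \<open>auto intro!: continuous_intros\<close>)
    moreover have "ln (norm (w 0)) + K * th 0 \<le> ln (norm (w t)) + K * th t"
    proof (rule DERIV_nonneg_imp_increasing_open[where f = "\<lambda>s. ln (norm (w s)) + K * th s"])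
      fix s assume "0 < s" "s < t"
      from D[OF this] obtain x y where xy: "((\<lambda>s. ln (norm (w s))) has_real_derivative x) (at s)"
        "(th has_real_derivative y) (at s)" "\<bar>x\<bar> \<le> K * y" by blast
      then show "\<exists>y. ((\<lambda>s. ln (norm (w s)) + K * th s) has_real_derivative y) (at s) \<and> 0 \<le> y"
        by (intro exI[of _ "x + K * y"]) (auto intro!: DERIV_add DERIV_cmult)
    qed (use t c0 in \<open>auto intro!: continuous_intros\<close>)
    moreover have "th 0 = 0" using ho by (simp add: th_def half_orbit_def norm_Pair)
    moreover have "K * th t \<le> K * pi"
    proof (rule mult_left_mono)
      have "\<bar>fst (w t)\<bar> \<le> norm (w t)" using norm_fst_le[of "fst (w t)" "snd (w t)"] by simp
      then show "th t \<le> pi" unfolding th_def using pos[OF t]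
        by (intro arccos_ubound) (auto simp: field_simps abs_le_iff)
    qed (use M0 in \<open>simp add: K_def\<close>)
    ultimately have "ln (norm (w t)) \<le> ln \<xi> + K * pi" "ln \<xi> - K * pi \<le> ln (norm (w t))"
      using w0 by auto
    then have "exp (ln (norm (w t))) \<le> exp (ln \<xi> + K * pi)"
      "exp (ln \<xi> - K * pi) \<le> exp (ln (norm (w t)))" by simp_all
    then show ?thesis using pos[OF t] ho(2) by (simp add: exp_add exp_diff M_def mult.commute)
  qed
  \<comment> \<open>The slope of the graph is \<open>rad * r / ang\<close>. Replacing
    \<open>rad\<close> and \<open>ang\<close> by their leading parts costs r times
    \<open>(C + C * M0)\<close> r^(N + 3) divided by \<open>ang\<close>; then \<open>ang\<close> is
    at least r^2 / 2 and r is at most \<open>M * \<xi>\<close>.\<close>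
  define C' where "C' = 2 * (C + C * M0) * M ^ (N + 2)"
  have prof: "focus_profile (N + 1) \<gamma> C' M \<xi> u"
    if ho: "half_orbit F \<tau> w \<xi>" "0 < \<xi>" and sub: "w ` {0..\<tau>} \<subseteq> cball 0 \<epsilon>"
      and end': "w \<tau> = (- u, 0)" "0 < u" for \<tau> w \<xi> u
  proof -
    have wn: "w \<tau> \<noteq> 0" using end' by (simp add: zero_prod_def)
    note ap = apriori[OF ho wn sub] note ct = cont[OF ho wn]
    define th where "th = (\<lambda>s. arccos (fst (w s) / norm (w s)))"
    have \<tau>: "0 < \<tau>" using ho by (simp add: half_orbit_def)
    have small: "norm (w s) \<le> \<epsilon>" if "s \<in> {0..\<tau>}" for s
      using subsetD[OF sub imageI[OF that]] by simp
    have th0: "th 0 = 0" "th \<tau> = pi"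
      using ho end' by (auto simp: th_def half_orbit_def norm_Pair)
    have cth: "continuous_on {0..\<tau>} th" using ct(2) by (simp add: th_def)
    have thpos: "\<exists>y. (th has_real_derivative y) (at s) \<and> 0 < y" if s: "s \<in> {0<..<\<tau>}" for s
    proof -
      have s': "s \<in> {0..\<tau>}" using s by auto
      obtain c ang where c: "0 < c" "(th has_real_derivative c * ang / (norm (w s))\<^sup>2) (at s)"
        "(norm (w s))\<^sup>2 / 2 \<le> ang"
        using pt[OF ho(1) s small[OF s']] unfolding th_def by blast
      have "0 < (norm (w s))\<^sup>2" using nz[OF ho wn s'] by simp
      moreover from this have "0 < ang" using c(3) by linarith
      ultimately have "0 < c * ang / (norm (w s))\<^sup>2" using c(1) by simp
      then show ?thesis using c(2) by blast
    qed
    have mono: "th s < th s'" if "0 \<le> s" "s < s'" "s' \<le> \<tau>" for s s'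
    proof (rule DERIV_pos_imp_increasing_open[OF that(2)])
      show "\<exists>y. (th has_real_derivative y) (at x) \<and> 0 < y" if "s < x" "x < s'" for x
        using thpos[of x] that \<open>0 \<le> s\<close> \<open>s' \<le> \<tau>\<close> by auto
      show "continuous_on {s..s'} th" using cth that by (auto elim: continuous_on_subset)
    qed
    have inj: "inj_on th {0..\<tau>}"
      by (rule linorder_inj_onI') (use mono in fastforce)
    have im: "th ` {0..\<tau>} = {0..pi}"
    proof (intro subset_antisym image_subsetI subsetI)
      fix s assume s: "s \<in> {0..\<tau>}"
      have "0 \<le> th s" using mono[of 0 s] s th0 by (cases "s = 0") auto
      moreover have "th s \<le> pi" using mono[of s \<tau>] s th0 by (cases "s = \<tau>") auto
      ultimately show "th s \<in> {0..pi}" by simp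
    next
      fix y assume "y \<in> {0..pi}"
      then have "\<exists>x\<ge>0. x \<le> \<tau> \<and> th x = y" using \<tau> th0 cth by (intro IVT') simp_all
      then obtain x where "x \<in> {0..\<tau>}" "y = th x" by auto
      then show "y \<in> th ` {0..\<tau>}" by (intro image_eqI)
    qed
    \<comment> \<open>The angle increases strictly from 0 to \<open>pi\<close>, so it replaces time
      as the parameter; \<open>g\<close> is time as a function of the angle.\<close>
    define g where "g = the_inv_into {0..\<tau>} th"
    have cg: "continuous_on {0..pi} g"
      using continuous_on_inv_into[OF cth _ inj] unfolding im g_def by simp
    have g_th: "g (th s) = s" if "s \<in> {0..\<tau>}" for s
      unfolding g_def by (rule the_inv_into_f_f[OF inj that])
    have gi: "g y \<in> {0..\<tau>}" "th (g y) = y" if "y \<in> {0..pi}" for y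
    proof -
      have y: "y \<in> th ` {0..\<tau>}" unfolding im by (rule that)
      show "g y \<in> {0..\<tau>}" unfolding g_def by (rule the_inv_into_into[OF inj y order_refl])
      show "th (g y) = y" unfolding g_def by (rule f_the_inv_into_f[OF inj y])
    qed
    have g0: "g 0 = 0" "g pi = \<tau>" using g_th[of 0] g_th[of \<tau>] th0 \<tau> by auto
    have gint: "g y \<in> {0<..<\<tau>}" if "y \<in> {0<..<pi}" for y
    proof -
      have gy: "g y \<in> {0..\<tau>}" "th (g y) = y" using gi[of y] that by auto
      then have "g y \<noteq> 0" "g y \<noteq> \<tau>" using that th0 by auto
      then show ?thesis using gy(1) by simp
    qed
    define P where "P = (\<lambda>y. norm (w (g y)))"
    have "continuous_on {0..pi} P" unfolding P_def
      by (rule continuous_on_compose2[OF ct(1) cg]) (use gi(1) in blast)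
    moreover have "P 0 = \<xi>" "P pi = u"
      using g0 ho end' by (auto simp: P_def half_orbit_def norm_Pair)
    moreover have "\<xi> / M \<le> P y \<and> P y \<le> M * \<xi>" if "y \<in> {0..pi}" for y
      unfolding P_def by (rule ap[OF gi(1)[OF that]])
    moreover have "\<exists>d. (P has_real_derivative d) (at y) \<and>
        \<bar>d - (\<Sum>j=1..N+1. \<gamma> j * P y ^ j * sin y ^ (j - 1))\<bar> \<le> C' * \<xi> ^ (N + 1 + 1)"
      if y: "y \<in> {0<..<pi}" for y
    proof -
      have y': "y \<in> {0..pi}" using y by auto
      note gy = gint[OF y] gi[OF y']
      obtain c rad ang where c: "0 < c"
        "((\<lambda>s. norm (w s)) has_real_derivative c * rad / norm (w (g y))) (at (g y))"
        "(th has_real_derivative c * ang / (norm (w (g y)))\<^sup>2) (at (g y))"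
        "\<bar>rad - (norm (w (g y)))\<^sup>2 * (\<Sum>j=1..N+1. \<gamma> j * snd (w (g y)) ^ (j - 1))\<bar> \<le> C * norm (w (g y)) ^ (N + 3)"
        "\<bar>ang - (norm (w (g y)))\<^sup>2\<bar> \<le> C * norm (w (g y)) ^ (N + 3)"
        "(norm (w (g y)))\<^sup>2 / 2 \<le> ang"
        using pt[OF ho(1) gy(1) small[OF gy(2)]] unfolding th_def by blast
      define r where "r = norm (w (g y))"
      have r: "0 < r" using nz[OF ho wn gy(2)] by (simp add: r_def)
      have ang: "0 < ang" using c(6) r unfolding r_def[symmetric] by (smt (verit) half_gt_zero zero_less_power)
      have "DERIV g y :> inverse (c * ang / r\<^sup>2)"
      proof (rule DERIV_inverse_function)
        show "DERIV th (g y) :> c * ang / r\<^sup>2" using c(3) by (simp add: r_def)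
        show "c * ang / r\<^sup>2 \<noteq> 0" using c(1) ang r by simp
        show "0 < y" "y < pi" using y by auto
        show "th (g z) = z" if "0 < z" "z < pi" for z using gi(2)[of z] that by auto
        show "isCont g y" using cg y by (auto intro: continuous_on_interior)
      qed
      from DERIV_chain2[OF c(2) this]
      have dP: "(P has_real_derivative c * rad / r * inverse (c * ang / r\<^sup>2)) (at y)"
        unfolding P_def r_def .
      have d: "c * rad / r * inverse (c * ang / r\<^sup>2) = rad * r / ang"
        using c(1) ang r by (simp add: field_simps power2_eq_square)
      have snd: "snd (w (g y)) = r * sin y"
      proof -
        obtain a b where ab: "w (g y) = (a, b)" by (cases "w (g y)")
        have "0 < snd (w (g y))" using ho(1) gy(1) unfolding half_orbit_def by blast
        then have b: "0 < b" using ab by simp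
        have r2: "r\<^sup>2 = a\<^sup>2 + b\<^sup>2" by (simp add: r_def ab norm_Pair)
        have "\<bar>a\<bar> \<le> r" using norm_fst_le[of a b] by (simp add: r_def ab)
        then have l: "-1 \<le> a / r" "a / r \<le> 1" using r by (auto simp: field_simps abs_le_iff)
        have "sin y = sin (arccos (a / r))" using gy(3) by (simp add: th_def ab r_def)
        also have "\<dots> = sqrt (1 - (a / r)\<^sup>2)" using l by (simp add: sin_arccos)
        also have "1 - (a / r)\<^sup>2 = (b / r)\<^sup>2"
        proof -
          have "(a / r)\<^sup>2 + (b / r)\<^sup>2 = r\<^sup>2 / r\<^sup>2" by (simp only: power_divide r2 add_divide_distrib)
          then show ?thesis using r by simp
        qed
        also have "sqrt ((b / r)\<^sup>2) = b / r" using r b by simp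
        finally show ?thesis using r ab by simp
      qed
      define S where "S = (\<Sum>j=1..N+1. \<gamma> j * (r * sin y) ^ (j - 1))"
      have rS: "(\<Sum>j=1..N+1. \<gamma> j * P y ^ j * sin y ^ (j - 1)) = r * S"
        unfolding S_def P_def r_def[symmetric] sum_distrib_left
      proof (rule sum.cong)
        fix j assume "j \<in> {1..N+1}"
        then obtain i where "j = Suc i" by (cases j) auto
        then show "\<gamma> j * r ^ j * sin y ^ (j - 1) = r * (\<gamma> j * (r * sin y) ^ (j - 1))"
          by (simp add: power_mult_distrib)
      qed simp
      have r1: "r \<le> 1" using small[OF gy(2)] \<epsilon> by (simp add: r_def)
      have "\<bar>r * sin y\<bar> \<le> 1 * 1" unfolding abs_mult using r r1 by (intro mult_mono) auto
      then have SM: "\<bar>S\<bar> \<le> M0" unfolding S_def by (intro Sb) simp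
      have e1: "\<bar>rad - r\<^sup>2 * S\<bar> \<le> C * r ^ (N + 3)" "\<bar>ang - r\<^sup>2\<bar> \<le> C * r ^ (N + 3)"
        using c(4,5) unfolding snd r_def[symmetric] S_def[symmetric] by auto
      have "rad * r / ang - r * S = r * ((rad - r\<^sup>2 * S) - (ang - r\<^sup>2) * S) / ang"
        using ang by (simp add: field_simps)
      then have "\<bar>rad * r / ang - r * S\<bar> = r * \<bar>(rad - r\<^sup>2 * S) - (ang - r\<^sup>2) * S\<bar> / ang"
        using r ang by (simp add: abs_mult)
      also have "\<dots> \<le> r * ((C + C * M0) * r ^ (N + 3)) / ang"
      proof (intro divide_right_mono mult_left_mono)
        have "\<bar>(rad - r\<^sup>2 * S) - (ang - r\<^sup>2) * S\<bar> \<le> \<bar>rad - r\<^sup>2 * S\<bar> + \<bar>ang - r\<^sup>2\<bar> * \<bar>S\<bar>"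
          using abs_triangle_ineq4[of "rad - r\<^sup>2 * S" "(ang - r\<^sup>2) * S"] by (simp add: abs_mult)
        also have "\<dots> \<le> C * r ^ (N + 3) + (C * r ^ (N + 3)) * M0"
          using e1 SM C r by (intro add_mono mult_mono) auto
        also have "\<dots> = (C + C * M0) * r ^ (N + 3)" by (simp add: algebra_simps)
        finally show "\<bar>(rad - r\<^sup>2 * S) - (ang - r\<^sup>2) * S\<bar> \<le> (C + C * M0) * r ^ (N + 3)" .
      qed (use r ang in auto)
      also have "\<dots> \<le> r * ((C + C * M0) * r ^ (N + 3)) / (r\<^sup>2 / 2)"
        using c(6) r C M0 unfolding r_def[symmetric]
        by (intro divide_left_mono mult_nonneg_nonneg mult_pos_pos ang) auto
      also have "\<dots> = 2 * (C + C * M0) * r ^ (N + 2)"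
        using r by (simp add: field_simps power_add numeral_3_eq_3 power2_eq_square)
      also have "\<dots> \<le> 2 * (C + C * M0) * (M * \<xi>) ^ (N + 2)"
        using ap[OF gy(2)] r C M0 unfolding r_def[symmetric] by (intro mult_left_mono power_mono) auto
      also have "\<dots> = C' * \<xi> ^ (N + 1 + 1)" by (simp add: C'_def power_mult_distrib)
      finally have "\<bar>rad * r / ang - r * S\<bar> \<le> C' * \<xi> ^ (N + 1 + 1)" .
      then show ?thesis using dP unfolding d rS by blast
    qed
    ultimately show ?thesis unfolding focus_profile_def by blast
  qed
  have C': "0 \<le> C'" using C M0 M by (simp add: C'_def)
  show ?thesis
  proof (rule that[OF \<epsilon>(1) M C'])
    fix \<tau> w \<xi> t
    assume "half_orbit F \<tau> w \<xi>" "0 < \<xi>" "w ` {0..\<tau>} \<subseteq> cball 0 \<epsilon>" "w \<tau> \<noteq> 0" "t \<in> {0..\<tau>}"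
    then show "\<xi> / M \<le> norm (w t) \<and> norm (w t) \<le> M * \<xi>" by (intro apriori)
  next
    fix \<tau> w \<xi> u
    assume "half_orbit F \<tau> w \<xi>" "0 < \<xi>" "w ` {0..\<tau>} \<subseteq> cball 0 \<epsilon>" "w \<tau> = (- u, 0)" "0 < u"
    then show "focus_profile (N + 1) \<gamma> C' M \<xi> u" by (intro prof)
  qed
qed

section \<open>Comparison of focus half-return maps\<close>

text \<open>Only the upper half of the ball is constrained because lower problems are flipped
  beforehand. The image condition puts the chart inside the ball on which \<open>passage\<close>
  supplies the differential equation.\<close>

definition chart_conjugates ::
    "real \<Rightarrow> real \<Rightarrow> (real \<times> real \<Rightarrow> real \<times> real) \<Rightarrow> (real \<Rightarrow> real) \<Rightarrow> vfield \<Rightarrow> vfield \<Rightarrow> bool" where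
  "chart_conjugates \<epsilon> \<rho> T \<phi> Z F \<longleftrightarrow> axis_chart \<epsilon> T \<phi> \<and> T ` ball 0 \<epsilon> \<subseteq> ball 0 \<rho> \<and>
     (\<forall>w\<in>ball 0 \<epsilon>. snd w > 0 \<longrightarrow>
        (\<exists>D k. k > 0 \<and> (T has_derivative D) (at w) \<and> D (F w) = k *\<^sub>R Z (T w)))"

lemma chart_conjugates_coord_map:
  assumes ad: "admissible_change q1 \<Phi> \<Psi>" and car: "carries_to 1 (coord_map q1 q2 \<Phi> \<Psi>) K Z F"
    and "0 < \<rho>"
  obtains \<epsilon> where "chart_conjugates \<epsilon> \<rho> (coord_map q1 q2 \<Phi> \<Psi>) (\<lambda>x. x + \<Phi> (x, 0)) Z F"
proof -
  let ?T = "coord_map q1 q2 \<Phi> \<Psi>" and ?\<phi> = "\<lambda>x. x + \<Phi> (x, 0)"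
  obtain e1 where ch: "axis_chart e1 ?T ?\<phi>" by (rule axis_chart_coord_map[OF ad])
  then have e1: "0 < e1" and cont: "continuous_on (ball 0 e1) ?T"
    and T0: "\<And>x. \<bar>x\<bar> < e1 \<Longrightarrow> ?T (x, 0) = (?\<phi> x, 0)" "?\<phi> 0 = 0"
    unfolding axis_chart_def by blast+
  obtain e2 where e2: "0 < e2" and c2: "\<And>w. norm w < e2 \<Longrightarrow> (snd w \<ge> 0 \<longrightarrow> K w > 0) \<and>
        (snd w > 0 \<longrightarrow> (\<exists>D. (?T has_derivative D) (at w) \<and> D (F w) = K w *\<^sub>R Z (?T w)))"
    using car unfolding carries_to_def eventually_nhds_metric by (auto simp: dist_norm)
  have "?T (0, 0) = (0, 0)" using T0(1)[of 0] T0(2) e1 by simp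
  then have "?T 0 = 0" by (simp add: zero_prod_def)
  moreover have "isCont ?T 0" using cont e1 by (simp add: continuous_on_eq_continuous_at)
  ultimately obtain e3 where e3: "0 < e3" "\<And>w. norm w < e3 \<Longrightarrow> norm (?T w) < \<rho>"
    using \<open>0 < \<rho>\<close> unfolding continuous_at_eps_delta by (metis dist_0_norm dist_commute)
  define \<epsilon> where "\<epsilon> = min e1 (min e2 e3)"
  have \<epsilon>: "0 < \<epsilon>" "\<epsilon> \<le> e1" "\<epsilon> \<le> e2" "\<epsilon> \<le> e3" using e1 e2 e3 by (auto simp: \<epsilon>_def)
  have "chart_conjugates \<epsilon> \<rho> ?T ?\<phi> Z F" unfolding chart_conjugates_def
  proof (intro conjI ballI impI)
    show "axis_chart \<epsilon> ?T ?\<phi>" by (rule axis_chart_mono[OF ch \<epsilon>(1,2)])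
    show "?T ` ball 0 \<epsilon> \<subseteq> ball 0 \<rho>" using e3(2) \<epsilon>(4) by (intro image_subsetI) simp
    fix w :: "real \<times> real" assume "w \<in> ball 0 \<epsilon>" "snd w > 0"
    then show "\<exists>D k. k > 0 \<and> (?T has_derivative D) (at w) \<and> D (F w) = k *\<^sub>R Z (?T w)"
      using c2[of w] \<epsilon>(3) by (auto simp: less_imp_le)
  qed
  then show ?thesis by (rule that)
qed

lemma axis_chart_bounds:
  assumes "axis_chart \<epsilon> T \<phi>" "\<bar>x\<bar> < \<epsilon>"
  shows "\<bar>\<phi> x - x\<bar> \<le> \<bar>x\<bar> / 2"
proof -
  have "0 < \<epsilon>" "\<phi> 0 = 0" using assms by (auto simp: axis_chart_def)
  moreover have "\<And>x x'. \<bar>x\<bar> < \<epsilon> \<Longrightarrow> \<bar>x'\<bar> < \<epsilon> \<Longrightarrow> \<bar>(\<phi> x - \<phi> x') - (x - x')\<bar> \<le> \<bar>x - x'\<bar> / 2"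
    using assms(1) unfolding axis_chart_def by blast
  from this[OF assms(2), of 0] show ?thesis using calculation by simp
qed

lemma axis_chart_axis_point:
  assumes ch: "axis_chart \<epsilon> T \<phi>" and w: "w \<in> ball 0 \<epsilon>" and Tw: "T w = (x, 0)"
  obtains v where "w = (v, 0)" "\<bar>v\<bar> < \<epsilon>" "\<phi> v = x" "sgn v = sgn x"
proof -
  have "snd w = 0" using axis_chart_sgn[OF ch w] Tw by (simp add: sgn_zero_iff)
  then obtain v where v: "w = (v, 0)" by (cases w) auto
  then have "\<bar>v\<bar> < \<epsilon>" using w by simp
  moreover from this have "\<phi> v = x" using ch Tw v unfolding axis_chart_def by auto
  moreover from axis_chart_bounds[OF ch \<open>\<bar>v\<bar> < \<epsilon>\<close>] this have "sgn v = sgn x"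
    by (auto simp: sgn_if abs_if split: if_splits)
  ultimately show ?thesis using that v by blast
qed

lemma focus_half_map:
  assumes cc: "chart_conjugates \<epsilon> \<rho> T \<phi> Z F" and nf: "focus_normal_form N \<gamma> F"
  obtains M C \<xi>0 where "1 \<le> M" "0 \<le> C" "0 < \<xi>0"
    "\<And>\<xi> x'. 0 < \<xi> \<Longrightarrow> \<xi> < \<xi>0 \<Longrightarrow> x' < 0 \<Longrightarrow> passage \<rho> Z (\<phi> \<xi>) x' \<Longrightarrow>
       \<exists>u>0. u < \<epsilon> \<and> x' = \<phi> (- u) \<and> focus_profile (N + 1) \<gamma> C M \<xi> u"
proof -
  have ch: "axis_chart \<epsilon> T \<phi>" and img: "T ` ball 0 \<epsilon> \<subseteq> ball 0 \<rho>"
    and car: "\<And>w. w \<in> ball 0 \<epsilon> \<Longrightarrow> snd w > 0 \<Longrightarrow>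
      \<exists>D k. k > 0 \<and> (T has_derivative D) (at w) \<and> D (F w) = k *\<^sub>R Z (T w)"
    using cc unfolding chart_conjugates_def by blast+
  have \<epsilon>: "0 < \<epsilon>" using ch by (simp add: axis_chart_def)
  obtain \<epsilon>1 M C where \<epsilon>1: "0 < \<epsilon>1" and M: "1 \<le> M" and C: "0 \<le> C"
    and ap: "\<And>\<tau> w \<xi> t. half_orbit F \<tau> w \<xi> \<Longrightarrow> 0 < \<xi> \<Longrightarrow> w ` {0..\<tau>} \<subseteq> cball 0 \<epsilon>1 \<Longrightarrow> w \<tau> \<noteq> 0 \<Longrightarrow>
       t \<in> {0..\<tau>} \<Longrightarrow> \<xi> / M \<le> norm (w t) \<and> norm (w t) \<le> M * \<xi>"
    and pr: "\<And>\<tau> w \<xi> u. half_orbit F \<tau> w \<xi> \<Longrightarrow> 0 < \<xi> \<Longrightarrow> w ` {0..\<tau>} \<subseteq> cball 0 \<epsilon>1 \<Longrightarrow> w \<tau> = (- u, 0) \<Longrightarrow>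
       0 < u \<Longrightarrow> focus_profile (N + 1) \<gamma> C M \<xi> u"
    by (rule focus_normal_form_orbit[OF nf]) blast
  define \<xi>0 where "\<xi>0 = min \<epsilon> \<epsilon>1 / (2 * M)"
  have \<xi>0: "0 < \<xi>0" using \<epsilon> \<epsilon>1 M by (simp add: \<xi>0_def)
  show ?thesis
  proof (rule that[OF M C \<xi>0])
    fix \<xi> x' assume \<xi>: "0 < \<xi>" "\<xi> < \<xi>0" and x': "x' < 0" and pas: "passage \<rho> Z (\<phi> \<xi>) x'"
    have "2 * M * \<xi> < 2 * M * \<xi>0" using \<xi> M by simp
    then have small: "2 * M * \<xi> < \<epsilon>" "2 * M * \<xi> \<le> \<epsilon>1" using M by (auto simp: \<xi>0_def)
    have "1 * \<xi> \<le> M * \<xi>" using M \<xi> by (intro mult_right_mono) auto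
    then have \<xi>M: "\<xi> < 2 * M * \<xi>" using \<xi> by linarith
    \<comment> \<open>The radius is twice the a priori bound \<open>M * \<xi>\<close>, so an orbit
      in the closure is pushed strictly inside. The bound presupposes a nonzero endpoint; the origin
      itself lies in \<open>U\<close> trivially.\<close>
    define U where "U = ball (0 :: real \<times> real) (2 * M * \<xi>)"
    have cU: "closure U = cball 0 (2 * M * \<xi>)" using M \<xi> by (simp add: U_def)
    have U: "open U" "closure U \<subseteq> ball 0 \<epsilon>" "(\<xi>, 0) \<in> U"
      unfolding cU unfolding U_def using small \<xi>M \<xi> by (simp_all add: norm_Pair cball_subset_ball_iff)
    have c1: "closure U \<subseteq> cball 0 \<epsilon>1" unfolding cU using small by (simp add: subset_cball)
    have trap: "w \<sigma> \<in> U" if "half_orbit F \<sigma> w \<xi>" "w ` {0..\<sigma>} \<subseteq> closure U" for \<sigma> w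
    proof (cases "w \<sigma> = 0")
      case False
      have "0 < \<sigma>" using that(1) by (simp add: half_orbit_def)
      then have "norm (w \<sigma>) \<le> M * \<xi>"
        using ap[OF that(1) \<xi>(1) order_trans[OF that(2) c1] False, of \<sigma>] by simp
      also have "\<dots> < 2 * M * \<xi>" using \<xi> M by simp
      finally show ?thesis by (simp add: U_def)
    qed (use \<xi> M in \<open>simp add: U_def\<close>)
    have "\<exists>\<tau> w. half_orbit F \<tau> w \<xi> \<and> w ` {0..\<tau>} \<subseteq> U \<and> T (w \<tau>) = (x', 0)"
      by (rule passage_in_chart[where \<epsilon> = \<epsilon> and \<phi> = \<phi> and Z = Z and \<rho> = \<rho>])
        (rule ch img pas U | rule car trap, assumption, assumption)+
    then obtain \<tau> w where w: "half_orbit F \<tau> w \<xi>" "w ` {0..\<tau>} \<subseteq> U" "T (w \<tau>) = (x', 0)"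
      by blast
    have UU: "U \<subseteq> cball 0 \<epsilon>1" "U \<subseteq> ball 0 \<epsilon>" using order_trans[OF closure_subset c1] order_trans[OF closure_subset U(2)] .
    have "0 < \<tau>" using w(1) by (simp add: half_orbit_def)
    then have "w \<tau> \<in> ball 0 \<epsilon>" using w(2) UU(2) by (intro subsetD[OF UU(2)] subsetD[OF w(2)] imageI) simp
    then obtain v where v: "w \<tau> = (v, 0)" "\<bar>v\<bar> < \<epsilon>" "\<phi> v = x'" "sgn v = sgn x'"
      by (rule axis_chart_axis_point[OF ch _ w(3)])
    have "v < 0" using v(4) x' by (simp add: sgn_if split: if_splits)
    moreover have "focus_profile (N + 1) \<gamma> C M \<xi> (- v)"
      using \<open>v < 0\<close> v(1) by (intro pr[OF w(1) \<xi>(1) order_trans[OF w(2) UU(1)]]) auto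
    ultimately show "\<exists>u>0. u < \<epsilon> \<and> x' = \<phi> (- u) \<and> focus_profile (N + 1) \<gamma> C M \<xi> u"
      using v by (intro exI[of _ "- v"]) auto
  qed
qed

lemma focus_profile_weaken:
  assumes "focus_profile n \<gamma> C M \<xi> u" "C \<le> C'" "M \<le> M'" "1 \<le> M" "0 < \<xi>"
  shows "focus_profile n \<gamma> C' M' \<xi> u"
proof -
  have "\<xi> / M' \<le> \<xi> / M" "M * \<xi> \<le> M' * \<xi>" "C * \<xi> ^ (n + 1) \<le> C' * \<xi> ^ (n + 1)"
    using assms(2-5) by (auto intro!: divide_left_mono mult_right_mono)
  note le = this
  obtain p where p: "continuous_on {0..pi} p" "p 0 = \<xi>" "p pi = u"
    "\<And>\<theta>. \<theta> \<in> {0..pi} \<Longrightarrow> \<xi> / M \<le> p \<theta> \<and> p \<theta> \<le> M * \<xi>"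
    "\<And>\<theta>. \<theta> \<in> {0<..<pi} \<Longrightarrow> \<exists>d. (p has_real_derivative d) (at \<theta>) \<and>
      \<bar>d - (\<Sum>j=1..n. \<gamma> j * p \<theta> ^ j * sin \<theta> ^ (j - 1))\<bar> \<le> C * \<xi> ^ (n + 1)"
    using assms(1) unfolding focus_profile_def by blast
  show ?thesis unfolding focus_profile_def
  proof (intro exI[of _ p] conjI ballI p(1-3))
    fix \<theta> assume "\<theta> \<in> {0..pi}"
    then show "\<xi> / M' \<le> p \<theta>" "p \<theta> \<le> M' * \<xi>" using p(4)[of \<theta>] le by linarith+
  next
    fix \<theta> assume "\<theta> \<in> {0<..<pi}"
    then show "\<exists>d. (p has_real_derivative d) (at \<theta>) \<and>
        \<bar>d - (\<Sum>j=1..n. \<gamma> j * p \<theta> ^ j * sin \<theta> ^ (j - 1))\<bar> \<le> C' * \<xi> ^ (n + 1)"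
      using p(5)[of \<theta>] le(3) by (blast intro: order_trans)
  qed
qed

text \<open>With vanishing coefficients circles are exact profiles; comparison with one measures the
  displacement of a single half map.\<close>

lemma focus_profile_const:
  assumes "0 \<le> C" "1 \<le> M" "0 < \<xi>"
  shows "focus_profile n (\<lambda>_. 0) C M \<xi> \<xi>"
proof -
  have "\<xi> / M \<le> \<xi>" "\<xi> \<le> M * \<xi>" using assms by (auto simp: field_simps)
  then show ?thesis unfolding focus_profile_def using assms
    by (intro exI[of _ "\<lambda>_. \<xi>"]) (auto intro!: exI[of _ 0])
qed

lemma abs_increment_le:
  fixes f :: "real \<Rightarrow> real"
  assumes "a \<le> b" "continuous_on {a..b} f"
    and "\<And>x. a < x \<Longrightarrow> x < b \<Longrightarrow> \<exists>d. (f has_real_derivative d) (at x) \<and> \<bar>d\<bar> \<le> K"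
  shows "\<bar>f b - f a\<bar> \<le> K * (b - a)"
proof -
  have "f a + K * a \<le> f b + K * b"
  proof (rule DERIV_nonneg_imp_increasing_open[where f = "\<lambda>x. f x + K * x"])
    fix x assume "a < x" "x < b"
    then obtain d where d: "(f has_real_derivative d) (at x)" "\<bar>d\<bar> \<le> K" using assms(3) by blast
    have "((\<lambda>x. f x + K * x) has_real_derivative d + K * 1) (at x)"
      by (intro DERIV_add d DERIV_cmult DERIV_ident)
    then show "\<exists>y. ((\<lambda>x. f x + K * x) has_real_derivative y) (at x) \<and> 0 \<le> y" using d(2) by fastforce
  qed (use assms in \<open>auto intro!: continuous_intros\<close>)
  moreover have "f b - K * b \<le> f a - K * a"
  proof (rule DERIV_nonpos_imp_decreasing_open[where f = "\<lambda>x. f x - K * x"])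
    fix x assume "a < x" "x < b"
    then obtain d where d: "(f has_real_derivative d) (at x)" "\<bar>d\<bar> \<le> K" using assms(3) by blast
    have "((\<lambda>x. f x - K * x) has_real_derivative d - K * 1) (at x)"
      by (intro DERIV_diff d DERIV_cmult DERIV_ident)
    then show "\<exists>y. ((\<lambda>x. f x - K * x) has_real_derivative y) (at x) \<and> y \<le> 0" using d(2) by fastforce
  qed (use assms in \<open>auto intro!: continuous_intros\<close>)
  ultimately show ?thesis by (simp add: abs_le_iff algebra_simps)
qed

lemma interior_antiderivative:
  fixes f :: "real \<Rightarrow> real"
  assumes "continuous_on {a..b} f"
  obtains A where "continuous_on {a..b} A" "\<And>x. a < x \<Longrightarrow> x < b \<Longrightarrow> (A has_real_derivative f x) (at x)"
proof -
  obtain A where A: "\<And>x. x \<in> {a..b} \<Longrightarrow> (A has_vector_derivative f x) (at x within {a..b})"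
    by (rule antiderivative_continuous[OF assms]) blast
  have "continuous_on {a..b} A"
    using A by (meson continuous_on_eq_continuous_within has_vector_derivative_continuous)
  moreover have "(A has_real_derivative f x) (at x)" if "a < x" "x < b" for x
    using A[of x] that by (simp add: at_within_Icc_at has_real_derivative_iff_has_vector_derivative)
  ultimately show ?thesis by (rule that)
qed

text \<open>The difference of two profiles solves a linear equation \<open>D' = L D + R\<close> in which \<open>R\<close> has the sign
  of \<open>\<gamma> k - \<gamma>' k\<close> up to order \<open>k + 1\<close>; an integrating factor removes \<open>L\<close>.\<close>

lemma focus_profile_compare:
  assumes M: "1 \<le> M" and C: "0 \<le> C" and k: "1 \<le> k" "k \<le> n"
    and eq: "\<And>j. 1 \<le> j \<Longrightarrow> j < k \<Longrightarrow> \<gamma> j = \<gamma>' j"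
  obtains a b \<xi>1 where "0 < \<xi>1" "\<gamma> k \<noteq> \<gamma>' k \<Longrightarrow> 0 < a"
    "\<And>\<xi> u u'. 0 < \<xi> \<Longrightarrow> \<xi> < \<xi>1 \<Longrightarrow> focus_profile n \<gamma> C M \<xi> u \<Longrightarrow> focus_profile n \<gamma>' C M \<xi> u' \<Longrightarrow>
       \<bar>u - u'\<bar> \<le> b * \<xi> ^ k \<and> a * \<xi> ^ k \<le> sgn (\<gamma> k - \<gamma>' k) * (u - u')"
proof -
  define W where "W = \<gamma> k - \<gamma>' k"
  \<comment> \<open>\<open>B\<close> bounds the coefficient \<open>L\<close> of the linear equation,
    since both radii are at most \<open>M\<close> when \<xi> is at most 1; \<open>E\<close> then
    bounds the integrating factor and its inverse.\<close>
  define B where "B = (\<Sum>j=1..n. \<bar>\<gamma>' j\<bar> * (\<Sum>i<j. M ^ (j - Suc i) * M ^ i))"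
  have B: "0 \<le> B" using M unfolding B_def by (intro sum_nonneg mult_nonneg_nonneg) auto
  define E where "E = exp (B * pi)"
  have E: "1 \<le> E" using B by (simp add: E_def)
  \<comment> \<open>Everything of order \<xi> ^ (k + 1): the errors of both profiles and the
    coefficients of index above \<open>k\<close>. Those below \<open>k\<close> cancel by
    hypothesis.\<close>
  define C1 where "C1 = 2 * C + (\<Sum>j\<in>{1..n} - {k}. \<bar>\<gamma> j - \<gamma>' j\<bar> * M ^ j)"
  have C1: "0 \<le> C1" unfolding C1_def using C M by (intro add_nonneg_nonneg sum_nonneg) auto
  have "continuous_on {0..pi} (\<lambda>\<theta>. sin \<theta> ^ (k - 1) :: real)" by (intro continuous_intros)
  then obtain S where S: "continuous_on {0..pi} S"
    "\<And>\<theta>. 0 < \<theta> \<Longrightarrow> \<theta> < pi \<Longrightarrow> (S has_real_derivative sin \<theta> ^ (k - 1)) (at \<theta>)"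
    by (rule interior_antiderivative) blast
  define s0 where "s0 = S pi - S 0"
  have "S 0 < S pi"
    by (rule DERIV_pos_imp_increasing_open) (use S in \<open>auto intro!: exI zero_less_power sin_gt_zero\<close>)
  then have s0: "0 < s0" by (simp add: s0_def)
  \<comment> \<open>|W| times the lower bounds \<open>1 / M ^ k\<close> for the power of the radius
    over \<xi> ^ k and \<open>1 / E\<close> for the integrating factor.\<close>
  define c where "c = \<bar>W\<bar> / (M ^ k * E)"
  have c: "0 \<le> c" using M E by (simp add: c_def)
  \<comment> \<open>Below this threshold the terms of order \<xi> ^ (k + 1) use up at most half of
    the leading term \<open>c * \<xi> ^ k * s0\<close>.\<close>
  define \<xi>1 where "\<xi>1 = (if W = 0 then 1 else min 1 (c * s0 / (2 * (E * C1 * pi + 1))))"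
  have \<xi>1: "0 < \<xi>1" "\<xi>1 \<le> 1"
  proof -
    have "0 < c * s0 / (2 * (E * C1 * pi + 1))" if "W \<noteq> 0"
    proof -
      have "0 < c" using that M E by (simp add: c_def)
      moreover have "0 \<le> E * C1 * pi" using E C1 by simp
      ultimately show ?thesis using s0 by (intro divide_pos_pos mult_pos_pos) auto
    qed
    then show "0 < \<xi>1" "\<xi>1 \<le> 1" by (auto simp: \<xi>1_def)
  qed
  show ?thesis
  proof (rule that[of \<xi>1 "c * s0 / (2 * E)" "E * (E * (\<bar>W\<bar> * M ^ k + C1) * pi)"])
    show "0 < \<xi>1" by (rule \<xi>1)
    show "0 < c * s0 / (2 * E)" if "\<gamma> k \<noteq> \<gamma>' k"
      using that M E s0 by (simp add: c_def W_def)
    fix \<xi> u u' assume \<xi>: "0 < \<xi>" "\<xi> < \<xi>1" and P: "focus_profile n \<gamma> C M \<xi> u" "focus_profile n \<gamma>' C M \<xi> u'"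
    have \<xi>le: "\<xi> \<le> 1" using \<xi> \<xi>1 by simp
    obtain p where p: "continuous_on {0..pi} p" "p 0 = \<xi>" "p pi = u"
      "\<And>\<theta>. \<theta> \<in> {0..pi} \<Longrightarrow> \<xi> / M \<le> p \<theta> \<and> p \<theta> \<le> M * \<xi>"
      "\<And>\<theta>. \<theta> \<in> {0<..<pi} \<Longrightarrow> \<exists>d. (p has_real_derivative d) (at \<theta>) \<and>
        \<bar>d - (\<Sum>j=1..n. \<gamma> j * p \<theta> ^ j * sin \<theta> ^ (j - 1))\<bar> \<le> C * \<xi> ^ (n + 1)"
      using P(1) unfolding focus_profile_def by blast
    obtain q where q: "continuous_on {0..pi} q" "q 0 = \<xi>" "q pi = u'"
      "\<And>\<theta>. \<theta> \<in> {0..pi} \<Longrightarrow> \<xi> / M \<le> q \<theta> \<and> q \<theta> \<le> M * \<xi>"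
      "\<And>\<theta>. \<theta> \<in> {0<..<pi} \<Longrightarrow> \<exists>d. (q has_real_derivative d) (at \<theta>) \<and>
        \<bar>d - (\<Sum>j=1..n. \<gamma>' j * q \<theta> ^ j * sin \<theta> ^ (j - 1))\<bar> \<le> C * \<xi> ^ (n + 1)"
      using P(2) unfolding focus_profile_def by blast
    have pq0: "0 \<le> p \<theta>" "p \<theta> \<le> M" "0 \<le> q \<theta>" "q \<theta> \<le> M" if "\<theta> \<in> {0..pi}" for \<theta>
    proof -
      have "0 \<le> \<xi> / M" "M * \<xi> \<le> M * 1" using \<xi> \<xi>le M by (auto intro!: mult_left_mono)
      then show "0 \<le> p \<theta>" "p \<theta> \<le> M" "0 \<le> q \<theta>" "q \<theta> \<le> M" using p(4)[OF that] q(4)[OF that] by linarith+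
    qed
    \<comment> \<open>\<open>L\<close> is built from \<gamma>' and the difference quotients of the
      powers, so that subtracting \<open>L * (p - q)\<close> leaves only the differences \<gamma> -
      \<gamma>' multiplied by powers of \<open>p\<close>.\<close>
    define L where "L = (\<lambda>\<theta>. \<Sum>j=1..n. \<gamma>' j * sin \<theta> ^ (j - 1) * (\<Sum>i<j. q \<theta> ^ (j - Suc i) * p \<theta> ^ i))"
    have LB: "\<bar>L \<theta>\<bar> \<le> B" if "\<theta> \<in> {0..pi}" for \<theta>
      unfolding L_def B_def
    proof (rule order_trans[OF sum_abs sum_mono])
      fix j
      have "\<bar>\<Sum>i<j. q \<theta> ^ (j - Suc i) * p \<theta> ^ i\<bar> \<le> (\<Sum>i<j. M ^ (j - Suc i) * M ^ i)"
      proof (rule order_trans[OF sum_abs sum_mono])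
        fix i show "\<bar>q \<theta> ^ (j - Suc i) * p \<theta> ^ i\<bar> \<le> M ^ (j - Suc i) * M ^ i"
          using pq0[OF that] M by (simp only: abs_mult power_abs) (intro mult_mono power_mono; simp)
      qed
      moreover have "\<bar>sin \<theta> ^ (j - 1)\<bar> \<le> 1" by (simp add: power_abs power_le_one)
      ultimately have "\<bar>\<gamma>' j\<bar> * \<bar>sin \<theta> ^ (j - 1)\<bar> * \<bar>\<Sum>i<j. q \<theta> ^ (j - Suc i) * p \<theta> ^ i\<bar> \<le>
          \<bar>\<gamma>' j\<bar> * 1 * (\<Sum>i<j. M ^ (j - Suc i) * M ^ i)"
        by (intro mult_mono mult_nonneg_nonneg) auto
      then show "\<bar>\<gamma>' j * sin \<theta> ^ (j - 1) * (\<Sum>i<j. q \<theta> ^ (j - Suc i) * p \<theta> ^ i)\<bar> \<le>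
          \<bar>\<gamma>' j\<bar> * (\<Sum>i<j. M ^ (j - Suc i) * M ^ i)"
        by (simp only: abs_mult mult_1_right)
    qed
    have "continuous_on {0..pi} L" unfolding L_def using p(1) q(1) by (intro continuous_intros)
    then obtain A where A: "continuous_on {0..pi} A"
      "\<And>\<theta>. 0 < \<theta> \<Longrightarrow> \<theta> < pi \<Longrightarrow> (A has_real_derivative L \<theta>) (at \<theta>)"
      by (rule interior_antiderivative) blast
    define e where "e = (\<lambda>\<theta>. exp (A 0 - A \<theta>))"
    have eE: "1 / E \<le> e \<theta>" "e \<theta> \<le> E" "0 < e \<theta>" if "\<theta> \<in> {0..pi}" for \<theta>
    proof -
      have "\<bar>A \<theta> - A 0\<bar> \<le> B * (\<theta> - 0)"
      proof (rule abs_increment_le)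
        show "continuous_on {0..\<theta>} A" using A(1) that by (auto elim: continuous_on_subset)
        show "\<exists>d. (A has_real_derivative d) (at x) \<and> \<bar>d\<bar> \<le> B" if "0 < x" "x < \<theta>" for x
          using A(2)[of x] LB[of x] that \<open>\<theta> \<in> {0..pi}\<close> by auto
      qed (use that in simp)
      also have "\<dots> \<le> B * pi" using B that by (intro mult_left_mono) auto
      finally have "- (B * pi) \<le> A 0 - A \<theta>" "A 0 - A \<theta> \<le> B * pi" by linarith+
      then have "exp (- (B * pi)) \<le> e \<theta>" "e \<theta> \<le> exp (B * pi)" unfolding e_def by simp_all
      then show "1 / E \<le> e \<theta>" "e \<theta> \<le> E" by (simp_all add: E_def exp_minus inverse_eq_divide)
      show "0 < e \<theta>" by (simp add: e_def)
    qed
    define h where "h = (\<lambda>\<theta>. e \<theta> * (p \<theta> - q \<theta>))"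
    have ch: "continuous_on {0..pi} h" unfolding h_def e_def using A(1) p(1) q(1) by (intro continuous_intros)
    have h0: "h 0 = 0" using p(2) q(2) by (simp add: h_def)
    have dh: "\<exists>R. (h has_real_derivative e \<theta> * R) (at \<theta>) \<and>
        \<bar>R - W * p \<theta> ^ k * sin \<theta> ^ (k - 1)\<bar> \<le> C1 * \<xi> ^ (k + 1)" if \<theta>: "0 < \<theta>" "\<theta> < pi" for \<theta>
    proof -
      have \<theta>': "\<theta> \<in> {0..pi}" using \<theta> by simp
      obtain d where d: "(p has_real_derivative d) (at \<theta>)"
        "\<bar>d - (\<Sum>j=1..n. \<gamma> j * p \<theta> ^ j * sin \<theta> ^ (j - 1))\<bar> \<le> C * \<xi> ^ (n + 1)"
        using p(5)[of \<theta>] \<theta> by auto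
      obtain d' where d': "(q has_real_derivative d') (at \<theta>)"
        "\<bar>d' - (\<Sum>j=1..n. \<gamma>' j * q \<theta> ^ j * sin \<theta> ^ (j - 1))\<bar> \<le> C * \<xi> ^ (n + 1)"
        using q(5)[of \<theta>] \<theta> by auto
      have "(e has_real_derivative e \<theta> * (0 - L \<theta>)) (at \<theta>)"
        unfolding e_def by (intro DERIV_fun_exp DERIV_diff DERIV_const A(2) \<theta>)
      from DERIV_mult[OF this DERIV_diff[OF d(1) d'(1)]]
      have "(h has_real_derivative e \<theta> * (0 - L \<theta>) * (p \<theta> - q \<theta>) + (d - d') * e \<theta>) (at \<theta>)"
        unfolding h_def .
      also have "e \<theta> * (0 - L \<theta>) * (p \<theta> - q \<theta>) + (d - d') * e \<theta> = e \<theta> * (d - d' - L \<theta> * (p \<theta> - q \<theta>))"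
        by (simp add: algebra_simps)
      finally have hd: "(h has_real_derivative e \<theta> * (d - d' - L \<theta> * (p \<theta> - q \<theta>))) (at \<theta>)" .
      define X where "X = (\<Sum>j=1..n. \<gamma> j * p \<theta> ^ j * sin \<theta> ^ (j - 1))"
      define Y where "Y = (\<Sum>j=1..n. \<gamma>' j * q \<theta> ^ j * sin \<theta> ^ (j - 1))"
      define Q where "Q = (\<Sum>j\<in>{1..n} - {k}. (\<gamma> j - \<gamma>' j) * p \<theta> ^ j * sin \<theta> ^ (j - 1))"
      have "X - Y - L \<theta> * (p \<theta> - q \<theta>) = (\<Sum>j=1..n. (\<gamma> j - \<gamma>' j) * p \<theta> ^ j * sin \<theta> ^ (j - 1))"
        unfolding X_def Y_def L_def sum_distrib_right sum_subtractf[symmetric]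
      proof (rule sum.cong)
        fix j
        have pd: "(\<Sum>i<j. q \<theta> ^ (j - Suc i) * p \<theta> ^ i) * (p \<theta> - q \<theta>) = p \<theta> ^ j - q \<theta> ^ j"
          by (simp only: power_diff_sumr2 mult.commute)
        have "\<gamma> j * p \<theta> ^ j * sin \<theta> ^ (j - 1) - \<gamma>' j * q \<theta> ^ j * sin \<theta> ^ (j - 1) -
            \<gamma>' j * sin \<theta> ^ (j - 1) * ((\<Sum>i<j. q \<theta> ^ (j - Suc i) * p \<theta> ^ i) * (p \<theta> - q \<theta>)) =
            (\<gamma> j - \<gamma>' j) * p \<theta> ^ j * sin \<theta> ^ (j - 1)"
          unfolding pd by (simp add: algebra_simps)
        then show "\<gamma> j * p \<theta> ^ j * sin \<theta> ^ (j - 1) - \<gamma>' j * q \<theta> ^ j * sin \<theta> ^ (j - 1) -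
            \<gamma>' j * sin \<theta> ^ (j - 1) * (\<Sum>i<j. q \<theta> ^ (j - Suc i) * p \<theta> ^ i) * (p \<theta> - q \<theta>) =
            (\<gamma> j - \<gamma>' j) * p \<theta> ^ j * sin \<theta> ^ (j - 1)" by (simp only: mult.assoc)
      qed simp
      also have "\<dots> = W * p \<theta> ^ k * sin \<theta> ^ (k - 1) + Q"
        unfolding Q_def W_def using k by (intro sum.remove) auto
      finally have XY: "X - Y - L \<theta> * (p \<theta> - q \<theta>) = W * p \<theta> ^ k * sin \<theta> ^ (k - 1) + Q" .
      have "\<bar>Q\<bar> \<le> (\<Sum>j\<in>{1..n} - {k}. \<bar>\<gamma> j - \<gamma>' j\<bar> * M ^ j * \<xi> ^ (k + 1))" unfolding Q_def
      proof (rule order_trans[OF sum_abs sum_mono])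
        fix j assume j: "j \<in> {1..n} - {k}"
        show "\<bar>(\<gamma> j - \<gamma>' j) * p \<theta> ^ j * sin \<theta> ^ (j - 1)\<bar> \<le> \<bar>\<gamma> j - \<gamma>' j\<bar> * M ^ j * \<xi> ^ (k + 1)"
        proof (cases "j < k")
          case True
          then show ?thesis using eq[of j] j by simp
        next
          case False
          then have jk: "k + 1 \<le> j" using j by auto
          have "p \<theta> ^ j \<le> (M * \<xi>) ^ j" using p(4)[OF \<theta>'] pq0[OF \<theta>'] by (intro power_mono) auto
          also have "\<dots> = M ^ j * \<xi> ^ j" by (rule power_mult_distrib)
          also have "\<dots> \<le> M ^ j * \<xi> ^ (k + 1)"
            using \<xi> \<xi>le M jk by (intro mult_left_mono power_decreasing) auto
          finally have 1: "\<bar>p \<theta> ^ j\<bar> \<le> M ^ j * \<xi> ^ (k + 1)" using pq0[OF \<theta>'] by simp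
          have 2: "\<bar>sin \<theta> ^ (j - 1)\<bar> \<le> 1" by (simp add: power_abs power_le_one)
          have "\<bar>\<gamma> j - \<gamma>' j\<bar> * \<bar>p \<theta> ^ j\<bar> * \<bar>sin \<theta> ^ (j - 1)\<bar> \<le> \<bar>\<gamma> j - \<gamma>' j\<bar> * (M ^ j * \<xi> ^ (k + 1)) * 1"
            using 1 2 M \<xi> by (intro mult_mono mult_left_mono mult_nonneg_nonneg) auto
          then show ?thesis by (simp add: abs_mult mult.assoc)
        qed
      qed
      also have "\<dots> = (C1 - 2 * C) * \<xi> ^ (k + 1)" by (simp add: C1_def sum_distrib_right)
      finally have Q: "\<bar>Q\<bar> \<le> (C1 - 2 * C) * \<xi> ^ (k + 1)" .
      have "C * \<xi> ^ (n + 1) \<le> C * \<xi> ^ (k + 1)"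
        using C \<xi> \<xi>le k by (intro mult_left_mono power_decreasing) auto
      then have "\<bar>(d - d' - L \<theta> * (p \<theta> - q \<theta>)) - W * p \<theta> ^ k * sin \<theta> ^ (k - 1)\<bar> \<le> 2 * (C * \<xi> ^ (k + 1)) + (C1 - 2 * C) * \<xi> ^ (k + 1)"
        using d(2) d'(2) Q XY unfolding X_def[symmetric] Y_def[symmetric] by linarith
      also have "\<dots> = C1 * \<xi> ^ (k + 1)" by (simp add: algebra_simps)
      finally show ?thesis using hd by blast
    qed
    have sp: "0 \<le> sin \<theta> ^ (k - 1)" "sin \<theta> ^ (k - 1) \<le> 1" if "0 < \<theta>" "\<theta> < pi" for \<theta> :: real
      using that sin_gt_zero[of \<theta>] by (auto intro!: power_le_one)
    have pk: "\<xi> ^ k / M ^ k \<le> p \<theta> ^ k" "p \<theta> ^ k \<le> M ^ k * \<xi> ^ k" if "\<theta> \<in> {0..pi}" for \<theta>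
    proof -
      have "(\<xi> / M) ^ k \<le> p \<theta> ^ k" using p(4)[OF that] \<xi> M by (intro power_mono) auto
      then show "\<xi> ^ k / M ^ k \<le> p \<theta> ^ k" by (simp add: power_divide)
      have "p \<theta> ^ k \<le> (M * \<xi>) ^ k" using p(4)[OF that] pq0[OF that] by (intro power_mono) auto
      then show "p \<theta> ^ k \<le> M ^ k * \<xi> ^ k" by (simp add: power_mult_distrib)
    qed
    have \<xi>k: "\<xi> ^ (k + 1) \<le> \<xi> ^ k" using \<xi> \<xi>le by (intro power_decreasing) auto
    have hpi: "h pi = e pi * (u - u')" using p(3) q(3) by (simp add: h_def)
    have pin: "pi \<in> {0..pi}" by simp
    have "\<bar>h pi - h 0\<bar> \<le> (E * ((\<bar>W\<bar> * M ^ k + C1) * \<xi> ^ k)) * (pi - 0)"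
    proof (rule abs_increment_le[OF _ ch])
      fix \<theta> :: real assume \<theta>: "0 < \<theta>" "\<theta> < pi"
      then have \<theta>': "\<theta> \<in> {0..pi}" by simp
      obtain R where R: "(h has_real_derivative e \<theta> * R) (at \<theta>)"
        "\<bar>R - W * p \<theta> ^ k * sin \<theta> ^ (k - 1)\<bar> \<le> C1 * \<xi> ^ (k + 1)" using dh[OF \<theta>] by blast
      have "\<bar>W * p \<theta> ^ k * sin \<theta> ^ (k - 1)\<bar> = \<bar>W\<bar> * p \<theta> ^ k * sin \<theta> ^ (k - 1)"
        using sp[OF \<theta>] pq0[OF \<theta>'] by (simp add: abs_mult)
      also have "\<dots> \<le> \<bar>W\<bar> * (M ^ k * \<xi> ^ k) * 1"
        using sp[OF \<theta>] pq0[OF \<theta>'] pk[OF \<theta>'] M \<xi> by (intro mult_mono mult_left_mono mult_nonneg_nonneg) auto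
      finally have "\<bar>W * p \<theta> ^ k * sin \<theta> ^ (k - 1)\<bar> \<le> \<bar>W\<bar> * (M ^ k * \<xi> ^ k)" by simp
      moreover have "C1 * \<xi> ^ (k + 1) \<le> C1 * \<xi> ^ k" using C1 \<xi>k by (rule mult_left_mono[rotated])
      ultimately have "\<bar>R\<bar> \<le> \<bar>W\<bar> * (M ^ k * \<xi> ^ k) + C1 * \<xi> ^ k" using R(2) by linarith
      also have "\<dots> = (\<bar>W\<bar> * M ^ k + C1) * \<xi> ^ k" by (simp add: algebra_simps)
      finally have "e \<theta> * \<bar>R\<bar> \<le> E * ((\<bar>W\<bar> * M ^ k + C1) * \<xi> ^ k)"
        using eE[OF \<theta>'] by (intro mult_mono) auto
      then show "\<exists>d. (h has_real_derivative d) (at \<theta>) \<and> \<bar>d\<bar> \<le> E * ((\<bar>W\<bar> * M ^ k + C1) * \<xi> ^ k)"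
        using R(1) eE(3)[OF \<theta>'] by (intro exI[of _ "e \<theta> * R"]) (simp add: abs_mult)
    qed simp
    then have "e pi * \<bar>u - u'\<bar> \<le> E * ((\<bar>W\<bar> * M ^ k + C1) * \<xi> ^ k) * pi"
      using h0 hpi eE(3)[OF pin] by (simp add: abs_mult)
    moreover have "1 / E * \<bar>u - u'\<bar> \<le> e pi * \<bar>u - u'\<bar>" using eE(1)[OF pin] by (rule mult_right_mono) simp
    ultimately have "1 / E * \<bar>u - u'\<bar> \<le> E * ((\<bar>W\<bar> * M ^ k + C1) * \<xi> ^ k) * pi" by linarith
    then have "E * (1 / E * \<bar>u - u'\<bar>) \<le> E * (E * ((\<bar>W\<bar> * M ^ k + C1) * \<xi> ^ k) * pi)"
      using E by (intro mult_left_mono) auto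
    then have upper: "\<bar>u - u'\<bar> \<le> E * (E * (\<bar>W\<bar> * M ^ k + C1) * pi) * \<xi> ^ k"
      using E by (simp add: mult_ac)
    have lower: "c * s0 / (2 * E) * \<xi> ^ k \<le> sgn (\<gamma> k - \<gamma>' k) * (u - u')"
    proof (cases "W = 0")
      case True
      then show ?thesis by (simp add: c_def flip: W_def)
    next
      case False
      define s where "s = sgn W"
      have sW: "s * W = \<bar>W\<bar>" "\<bar>s\<bar> = 1" using False by (auto simp: s_def sgn_if)
      \<comment> \<open>The function on the right increases because the leading source term
        dominates \<open>c * \<xi> ^ k\<close> times the derivative of \<open>S\<close>, while the
        linear term in \<theta> absorbs the higher order error. Its endpoint values give the lower
        bound for \<open>h pi\<close>.\<close>
      have "s * h 0 - c * \<xi> ^ k * S 0 + E * C1 * \<xi> ^ (k + 1) * 0 \<le>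
          s * h pi - c * \<xi> ^ k * S pi + E * C1 * \<xi> ^ (k + 1) * pi"
      proof (rule DERIV_nonneg_imp_increasing_open[where
            f = "\<lambda>\<theta>. s * h \<theta> - c * \<xi> ^ k * S \<theta> + E * C1 * \<xi> ^ (k + 1) * \<theta>"])
        show "continuous_on {0..pi} (\<lambda>\<theta>. s * h \<theta> - c * \<xi> ^ k * S \<theta> + E * C1 * \<xi> ^ (k + 1) * \<theta>)"
          using ch S(1) by (intro continuous_intros)
        fix \<theta> :: real assume \<theta>: "0 < \<theta>" "\<theta> < pi"
        then have \<theta>': "\<theta> \<in> {0..pi}" by simp
        obtain R where R: "(h has_real_derivative e \<theta> * R) (at \<theta>)"
          "\<bar>R - W * p \<theta> ^ k * sin \<theta> ^ (k - 1)\<bar> \<le> C1 * \<xi> ^ (k + 1)" using dh[OF \<theta>] by blast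
        have der: "((\<lambda>\<theta>. s * h \<theta> - c * \<xi> ^ k * S \<theta> + E * C1 * \<xi> ^ (k + 1) * \<theta>) has_real_derivative
            s * (e \<theta> * R) - c * \<xi> ^ k * sin \<theta> ^ (k - 1) + E * C1 * \<xi> ^ (k + 1) * 1) (at \<theta>)"
          by (intro DERIV_add DERIV_diff DERIV_cmult R(1) S(2) \<theta> DERIV_ident)
        have "\<bar>s * (R - W * p \<theta> ^ k * sin \<theta> ^ (k - 1))\<bar> \<le> C1 * \<xi> ^ (k + 1)"
          using R(2) sW(2) by (simp add: abs_mult)
        moreover have "s * (R - W * p \<theta> ^ k * sin \<theta> ^ (k - 1)) = s * R - \<bar>W\<bar> * p \<theta> ^ k * sin \<theta> ^ (k - 1)"
          unfolding sW(1)[symmetric] by (simp add: algebra_simps)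
        ultimately have sR: "\<bar>W\<bar> * p \<theta> ^ k * sin \<theta> ^ (k - 1) - C1 * \<xi> ^ (k + 1) \<le> s * R" by linarith
        have "c * \<xi> ^ k * sin \<theta> ^ (k - 1) = 1 / E * (\<bar>W\<bar> * (\<xi> ^ k / M ^ k) * sin \<theta> ^ (k - 1))"
          by (simp add: c_def)
        also have "\<dots> \<le> e \<theta> * (\<bar>W\<bar> * p \<theta> ^ k * sin \<theta> ^ (k - 1))"
          using eE[OF \<theta>'] pk[OF \<theta>'] sp[OF \<theta>] E M \<xi>
          by (intro mult_mono mult_left_mono mult_right_mono mult_nonneg_nonneg) auto
        finally have 1: "c * \<xi> ^ k * sin \<theta> ^ (k - 1) \<le> e \<theta> * (\<bar>W\<bar> * p \<theta> ^ k * sin \<theta> ^ (k - 1))" .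
        have 2: "e \<theta> * (C1 * \<xi> ^ (k + 1)) \<le> E * (C1 * \<xi> ^ (k + 1))"
          using eE[OF \<theta>'] C1 \<xi> by (intro mult_right_mono) auto
        have "e \<theta> * (\<bar>W\<bar> * p \<theta> ^ k * sin \<theta> ^ (k - 1) - C1 * \<xi> ^ (k + 1)) \<le> e \<theta> * (s * R)"
          using sR eE(3)[OF \<theta>'] by (intro mult_left_mono) auto
        then have "0 \<le> s * (e \<theta> * R) - c * \<xi> ^ k * sin \<theta> ^ (k - 1) + E * C1 * \<xi> ^ (k + 1) * 1"
          using 1 2 by (simp add: algebra_simps)
        then show "\<exists>y. ((\<lambda>\<theta>. s * h \<theta> - c * \<xi> ^ k * S \<theta> + E * C1 * \<xi> ^ (k + 1) * \<theta>)
            has_real_derivative y) (at \<theta>) \<and> 0 \<le> y" using der by blast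
      qed simp
      then have "c * \<xi> ^ k * s0 - E * C1 * \<xi> ^ (k + 1) * pi \<le> s * h pi"
        using h0 by (simp add: s0_def algebra_simps)
      moreover have "E * C1 * \<xi> ^ (k + 1) * pi \<le> c * \<xi> ^ k * s0 / 2"
      proof -
        have nn: "0 \<le> E * C1 * pi" using E C1 by simp
        have "\<xi> \<le> c * s0 / (2 * (E * C1 * pi + 1))" using \<xi> False by (simp add: \<xi>1_def)
        then have "\<xi> * (E * C1 * pi + 1) \<le> c * s0 / 2" using nn by (simp add: field_simps)
        then have "\<xi> * (E * C1 * pi) \<le> c * s0 / 2" using \<xi> by (simp add: algebra_simps)
        then have "\<xi> ^ k * (\<xi> * (E * C1 * pi)) \<le> \<xi> ^ k * (c * s0 / 2)" using \<xi> by (intro mult_left_mono) auto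
        then show ?thesis by (simp add: mult_ac)
      qed
      ultimately have "c * \<xi> ^ k * s0 / 2 \<le> s * h pi" by linarith
      also have "\<dots> = e pi * (s * (u - u'))" by (simp add: hpi)
      finally have f: "c * \<xi> ^ k * s0 / 2 \<le> e pi * (s * (u - u'))" .
      have "0 \<le> c * \<xi> ^ k * s0 / 2" using c \<xi> s0 by simp
      then have "0 \<le> s * (u - u')" using f eE(3)[OF pin] by (meson order_trans zero_le_mult_iff less_imp_le not_le)
      then have "e pi * (s * (u - u')) \<le> E * (s * (u - u'))" using eE(2)[OF pin] by (rule mult_right_mono[rotated])
      then have "c * \<xi> ^ k * s0 / 2 \<le> E * (s * (u - u'))" using f by linarith
      then show ?thesis using E unfolding W_def[symmetric] s_def[symmetric] by (simp add: field_simps)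
    qed
    show "\<bar>u - u'\<bar> \<le> E * (E * (\<bar>W\<bar> * M ^ k + C1) * pi) * \<xi> ^ k \<and>
        c * s0 / (2 * E) * \<xi> ^ k \<le> sgn (\<gamma> k - \<gamma>' k) * (u - u')"
      using upper lower by blast
  qed
qed

section \<open>Parabolic half-return maps\<close>

definition parabolic_potential :: "nat \<Rightarrow> nat \<Rightarrow> (nat \<Rightarrow> real) \<Rightarrow> real \<Rightarrow> real" where
  "parabolic_potential N l \<sigma> x =
     x ^ (2 * l) / (2 * l) + (\<Sum>i=1..N. \<sigma> (i + 1) * x ^ (2 * l + i) / (2 * l + i))"

lemma parabolic_potential_deriv:
  assumes "l \<ge> 1"
  shows "(parabolic_potential N l \<sigma> has_real_derivative
    x ^ (2 * l - 1) + (\<Sum>i=1..N. \<sigma> (i + 1) * x ^ (2 * l - 1 + i))) (at x)"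
proof -
  have 1: "((\<lambda>x. c * x ^ n / real n) has_real_derivative c * x ^ (n - 1)) (at x)" if "n \<ge> 1" for n and c :: real
  proof -
    have "((\<lambda>x. c * x ^ n / real n) has_real_derivative c * (real n * x ^ (n - Suc 0)) / real n) (at x)"
      by (intro DERIV_cdivide DERIV_cmult DERIV_pow)
    then show ?thesis using that by simp
  qed
  have 2: "((\<lambda>x. \<sigma> (i + 1) * x ^ (2 * l + i) / real (2 * l + i)) has_real_derivative
      \<sigma> (i + 1) * x ^ (2 * l - 1 + i)) (at x)" for i
  proof -
    have "2 * l + i - 1 = 2 * l - 1 + i" using assms by simp
    then show ?thesis using 1[of "2 * l + i" "\<sigma> (i + 1)"] assms by (simp only:)
  qed
  have "((\<lambda>x. 1 * x ^ (2 * l) / real (2 * l) + (\<Sum>i=1..N. \<sigma> (i + 1) * x ^ (2 * l + i) / real (2 * l + i)))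
      has_real_derivative 1 * x ^ (2 * l - 1) + (\<Sum>i=1..N. \<sigma> (i + 1) * x ^ (2 * l - 1 + i))) (at x)"
    using assms by (intro DERIV_add 1 DERIV_sum 2) auto
  then show ?thesis unfolding parabolic_potential_def by simp
qed

text \<open>\<open>half_orbit\<close> fixes the sign only at interior times; the trapping argument
  also needs it at the final time, where it follows by continuity.\<close>

lemma half_orbit_snd_nonneg:
  assumes "half_orbit F \<tau> w \<xi>"
  shows "0 \<le> snd (w \<tau>)"
proof -
  have \<tau>: "0 < \<tau>" and cw: "continuous_on {0..\<tau>} w" and p: "\<And>t. t \<in> {0<..<\<tau>} \<Longrightarrow> 0 < snd (w t)"
    using assms by (auto simp: half_orbit_def)
  have "closed ({0..\<tau>} \<inter> (\<lambda>t. snd (w t)) -` {0..})"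
    using cw by (intro continuous_closed_preimage continuous_intros) auto
  moreover have "{0<..<\<tau>} \<subseteq> {0..\<tau>} \<inter> (\<lambda>t. snd (w t)) -` {0..}" using p by (auto simp: less_imp_le)
  ultimately have "closure {0<..<\<tau>} \<subseteq> {0..\<tau>} \<inter> (\<lambda>t. snd (w t)) -` {0..}" by (rule closure_minimal[rotated])
  then have "{0..\<tau>} \<subseteq> {0..\<tau>} \<inter> (\<lambda>t. snd (w t)) -` {0..}" using \<tau> by (simp add: closure_greaterThanLessThan)
  from subsetD[OF this, of \<tau>] show ?thesis using \<tau> by simp
qed

text \<open>The potential plus \<open>y\<close> is a first integral of the truncated normal form, so along orbits of the
  full one it changes only by terms of higher quasi-homogeneous order.\<close>

lemma upper_parabolic_orbit:
  assumes nf: "upper_parabolic_normal_form N l \<sigma> F" and l: "l \<ge> 1"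
  obtains K \<xi>0 where "0 \<le> K" "0 < \<xi>0" "\<xi>0 \<le> 1 / 4"
    "\<And>\<tau> w \<xi>. half_orbit F \<tau> w \<xi> \<Longrightarrow> 0 < \<xi> \<Longrightarrow> \<xi> < \<xi>0 \<Longrightarrow>
       w ` {0..\<tau>} \<subseteq> {- (4 * \<xi>)..4 * \<xi>} \<times> {- (\<xi> ^ (2 * l))..\<xi> ^ (2 * l)} \<Longrightarrow>
       \<bar>snd (w \<tau>) + parabolic_potential N l \<sigma> (fst (w \<tau>)) - parabolic_potential N l \<sigma> \<xi>\<bar>
         \<le> K * \<xi> ^ (N + 2 * l + 1)"
proof -
  obtain R where R: "quasi_homogeneous_from l N R" and
    F: "\<And>x y. F (x, y) = (-1, x ^ (2 * l - 1) + (\<Sum>i=1..N. \<sigma> (i + 1) * x ^ (2 * l - 1 + i))) + R (x, y)"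
    using nf by (auto simp: upper_parabolic_normal_form_def)
  obtain A B where AB: "expands_at_0 (\<lambda>w. fst (R w)) A" "expands_at_0 (\<lambda>w. snd (R w)) B"
    "\<And>i j. i + 2 * l * j < N + 1 \<Longrightarrow> A i j = 0" "\<And>i j. i + 2 * l * j < N + 2 * l \<Longrightarrow> B i j = 0"
    using R by (auto simp: quasi_homogeneous_from_def)
  obtain C1 r1 where C1: "0 \<le> C1" "0 < r1" "r1 \<le> 1" "\<And>s x y. 0 \<le> s \<Longrightarrow> s \<le> 1 \<Longrightarrow> \<bar>x\<bar> \<le> r1 * s \<Longrightarrow>
      \<bar>y\<bar> \<le> r1 * s ^ (2 * l) \<Longrightarrow> \<bar>fst (R (x, y))\<bar> \<le> C1 * s ^ (N + 1)"
    by (rule expands_at_0_quasi_homogeneous_bound[OF AB(1), of "2 * l" "N + 1"]) (use AB(3) l in auto)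
  obtain C2 r2 where C2: "0 \<le> C2" "0 < r2" "r2 \<le> 1" "\<And>s x y. 0 \<le> s \<Longrightarrow> s \<le> 1 \<Longrightarrow> \<bar>x\<bar> \<le> r2 * s \<Longrightarrow>
      \<bar>y\<bar> \<le> r2 * s ^ (2 * l) \<Longrightarrow> \<bar>snd (R (x, y))\<bar> \<le> C2 * s ^ (N + 2 * l)"
    by (rule expands_at_0_quasi_homogeneous_bound[OF AB(2), of "2 * l" "N + 2 * l"]) (use AB(4) l in auto)
  \<comment> \<open>The box with |x| at most 4 \<xi> and |y| at most \<xi> ^ (2l) fits into the
    quasi-homogeneous box of scale \<open>4 / r * \<xi>\<close>, so the remainder bounds hold on
    it.\<close>
  have box: "\<bar>a\<bar> \<le> r * (4 / r * \<xi>)" "\<bar>b\<bar> \<le> r * (4 / r * \<xi>) ^ (2 * l)"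
    if "0 < r" "r \<le> 1" "0 < \<xi>" "\<bar>a\<bar> \<le> 4 * \<xi>" "\<bar>b\<bar> \<le> \<xi> ^ (2 * l)" for r \<xi> a b :: real
  proof -
    show "\<bar>a\<bar> \<le> r * (4 / r * \<xi>)" using that by simp
    have "1 \<le> 4 / r" using that by (simp add: field_simps)
    then have "(4 / r) ^ 1 \<le> (4 / r) ^ (2 * l)" using l by (intro power_increasing) auto
    then have "r * (4 / r) ^ 1 \<le> r * (4 / r) ^ (2 * l)" using that by (intro mult_left_mono) auto
    then have "1 \<le> r * (4 / r) ^ (2 * l)" using that by simp
    then have "1 * \<xi> ^ (2 * l) \<le> (r * (4 / r) ^ (2 * l)) * \<xi> ^ (2 * l)"
      using that by (intro mult_right_mono) auto
    then show "\<bar>b\<bar> \<le> r * (4 / r * \<xi>) ^ (2 * l)" using that(5) by (simp only: power_mult_distrib mult.assoc mult_1_left)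
  qed
  define D1 where "D1 = C1 * (4 / r1) ^ (N + 1)"
  define D2 where "D2 = C2 * (4 / r2) ^ (N + 2 * l)"
  define P where "P = 4 ^ (2 * l - 1) * (1 + (\<Sum>i=1..N. \<bar>\<sigma> (i + 1)\<bar>))"
  have nn: "0 \<le> D1" "0 \<le> D2" "0 \<le> P" using C1 C2 by (auto simp: D1_def D2_def P_def intro!: add_nonneg_nonneg sum_nonneg)
  \<comment> \<open>Along an orbit the derivative of y + h(x) is the second remainder plus h' times
    the first one; \<open>D2\<close> and \<open>P * D1\<close> bound these two
    contributions.\<close>
  define K where "K = D2 + P * D1"
  have K: "0 \<le> K" using nn by (simp add: K_def)
  \<comment> \<open>The entries \<open>r1 / 4\<close> and \<open>r2 / 4\<close> keep the scale below
    1; the last one keeps the first remainder below 1/2, so that x decreases along the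
    orbit.\<close>
  define \<xi>0 where "\<xi>0 = Min {1 / 4, r1 / 4, r2 / 4, 1 / (2 * (D1 + 1))}"
  have \<xi>0: "0 < \<xi>0" "\<xi>0 \<le> 1 / 4" "\<xi>0 \<le> r1 / 4" "\<xi>0 \<le> r2 / 4" "\<xi>0 \<le> 1 / (2 * (D1 + 1))"
    using C1 C2 nn by (auto simp: \<xi>0_def)
  show ?thesis
  proof (rule that[of "10 * K" \<xi>0])
    show "0 \<le> 10 * K" "0 < \<xi>0" "\<xi>0 \<le> 1 / 4" using K \<xi>0 by auto
    fix \<tau> w \<xi>
    assume ho: "half_orbit F \<tau> w \<xi>" and \<xi>: "0 < \<xi>" "\<xi> < \<xi>0"
      and sub: "w ` {0..\<tau>} \<subseteq> {- (4 * \<xi>)..4 * \<xi>} \<times> {- (\<xi> ^ (2 * l))..\<xi> ^ (2 * l)}"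
    have \<tau>: "0 < \<tau>" and cw: "continuous_on {0..\<tau>} w" and w0: "w 0 = (\<xi>, 0)"
      using ho by (auto simp: half_orbit_def)
    let ?h = "parabolic_potential N l \<sigma>"
    define H where "H = (\<lambda>t. snd (w t) + ?h (fst (w t)))"
    have conth: "continuous_on UNIV ?h"
      using parabolic_potential_deriv[OF l] by (meson DERIV_continuous continuous_at_imp_continuous_on)
    have cH: "continuous_on {0..\<tau>} H" unfolding H_def
      by (intro continuous_intros continuous_on_compose2[OF conth] cw) auto
    have cf: "continuous_on {0..\<tau>} (\<lambda>t. fst (w t))" using cw by (intro continuous_intros)
    have bx: "\<bar>fst (w t)\<bar> \<le> 4 * \<xi>" "\<bar>snd (w t)\<bar> \<le> \<xi> ^ (2 * l)" if "t \<in> {0..\<tau>}" for t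
      using subsetD[OF sub imageI[OF that]] by (auto simp: mem_Times_iff abs_le_iff)
    \<comment> \<open>The rate of change of \<open>H\<close> is bounded by a multiple of the speed
      of -x. The unknown time factor thus disappears, and the total change of \<open>H\<close> is
      controlled by the distance travelled in x.\<close>
    have dd: "\<exists>x y. ((\<lambda>t. fst (w t)) has_real_derivative x) (at t) \<and> (H has_real_derivative y) (at t) \<and>
        x \<le> 0 \<and> \<bar>y\<bar> \<le> 2 * K * \<xi> ^ (N + 2 * l) * (- x)" if t: "0 < t" "t < \<tau>" for t
    proof -
      have t': "t \<in> {0<..<\<tau>}" "t \<in> {0..\<tau>}" using t by auto
      obtain a b where ab: "w t = (a, b)" by (cases "w t")
      have "\<exists>c>0. (w has_vector_derivative c *\<^sub>R F (w t)) (at t)"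
        using ho t'(1) unfolding half_orbit_def by blast
      then obtain c where c: "0 < c" "(w has_vector_derivative c *\<^sub>R F (a, b)) (at t)" using ab by auto
      define p where "p = a ^ (2 * l - 1) + (\<Sum>i=1..N. \<sigma> (i + 1) * a ^ (2 * l - 1 + i))"
      define q1 where "q1 = fst (R (a, b))"
      define q2 where "q2 = snd (R (a, b))"
      have Fab: "c *\<^sub>R F (a, b) = (c * (-1 + q1), c * (p + q2))"
        unfolding F p_def q1_def q2_def by (simp add: prod_eq_iff)
      have f: "((\<lambda>s. fst (w s)) has_real_derivative c * (-1 + q1)) (at t)"
        using bounded_linear.has_vector_derivative[OF bounded_linear_fst c(2)[unfolded Fab]]
        by (simp add: has_real_derivative_iff_has_vector_derivative)
      have g: "((\<lambda>s. snd (w s)) has_real_derivative c * (p + q2)) (at t)"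
        using bounded_linear.has_vector_derivative[OF bounded_linear_snd c(2)[unfolded Fab]]
        by (simp add: has_real_derivative_iff_has_vector_derivative)
      have "(?h has_real_derivative p) (at (fst (w t)))"
        using parabolic_potential_deriv[OF l] ab unfolding p_def by simp
      from DERIV_add[OF g DERIV_chain2[OF this f]]
      have "(H has_real_derivative c * (p + q2) + p * (c * (-1 + q1))) (at t)" unfolding H_def .
      moreover have "c * (p + q2) + p * (c * (-1 + q1)) = c * (q2 + p * q1)" by (simp add: algebra_simps)
      ultimately have Hd: "(H has_real_derivative c * (q2 + p * q1)) (at t)" by simp
      have a4: "\<bar>a\<bar> \<le> 4 * \<xi>" and b4: "\<bar>b\<bar> \<le> \<xi> ^ (2 * l)" using bx[OF t'(2)] ab by auto
      have "\<bar>q1\<bar> \<le> C1 * (4 / r1 * \<xi>) ^ (N + 1)" unfolding q1_def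
        using C1(2,3) \<xi> \<xi>0
        by (intro C1(4) box(1)[OF C1(2,3) \<xi>(1) a4 b4] box(2)[OF C1(2,3) \<xi>(1) a4 b4]) (auto simp: field_simps)
      then have q1: "\<bar>q1\<bar> \<le> D1 * \<xi> ^ (N + 1)" by (simp only: power_mult_distrib D1_def mult.assoc)
      have "\<bar>q2\<bar> \<le> C2 * (4 / r2 * \<xi>) ^ (N + 2 * l)" unfolding q2_def
        using C2(2,3) \<xi> \<xi>0
        by (intro C2(4) box(1)[OF C2(2,3) \<xi>(1) a4 b4] box(2)[OF C2(2,3) \<xi>(1) a4 b4]) (auto simp: field_simps)
      then have q2: "\<bar>q2\<bar> \<le> D2 * \<xi> ^ (N + 2 * l)" by (simp only: power_mult_distrib D2_def mult.assoc)
      have "\<xi> ^ (N + 1) \<le> \<xi> ^ 1" using \<xi> \<xi>0 by (intro power_decreasing) auto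
      then have "D1 * \<xi> ^ (N + 1) \<le> D1 * \<xi>" using nn by (intro mult_left_mono) auto
      also have "\<dots> \<le> (D1 + 1) * (1 / (2 * (D1 + 1)))" using \<xi> \<xi>0 nn by (intro mult_mono) auto
      also have "\<dots> = 1 / 2" using nn by (simp add: divide_simps)
      finally have q1h: "\<bar>q1\<bar> \<le> 1 / 2" using q1 by linarith
      have "\<bar>p\<bar> \<le> \<bar>a\<bar> ^ (2 * l - 1) + (\<Sum>i=1..N. \<bar>\<sigma> (i + 1)\<bar> * \<bar>a\<bar> ^ (2 * l - 1 + i))"
        unfolding p_def by (intro order_trans[OF abs_triangle_ineq] add_mono order_trans[OF sum_abs])
          (simp_all add: abs_mult power_abs)
      also have "\<dots> \<le> (4 * \<xi>) ^ (2 * l - 1) + (\<Sum>i=1..N. \<bar>\<sigma> (i + 1)\<bar> * (4 * \<xi>) ^ (2 * l - 1))"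
      proof (intro add_mono sum_mono mult_left_mono)
        show "\<bar>a\<bar> ^ (2 * l - 1) \<le> (4 * \<xi>) ^ (2 * l - 1)" using a4 by (intro power_mono) auto
        fix i
        have "\<bar>a\<bar> ^ (2 * l - 1 + i) \<le> (4 * \<xi>) ^ (2 * l - 1 + i)" using a4 by (intro power_mono) auto
        also have "\<dots> \<le> (4 * \<xi>) ^ (2 * l - 1)" using \<xi> \<xi>0 by (intro power_decreasing) auto
        finally show "\<bar>a\<bar> ^ (2 * l - 1 + i) \<le> (4 * \<xi>) ^ (2 * l - 1)" .
      qed auto
      also have "\<dots> = P * \<xi> ^ (2 * l - 1)"
        by (simp add: P_def power_mult_distrib sum_distrib_right[symmetric] algebra_simps)
      finally have p: "\<bar>p\<bar> \<le> P * \<xi> ^ (2 * l - 1)" .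
      have "\<bar>p * q1\<bar> \<le> (P * \<xi> ^ (2 * l - 1)) * (D1 * \<xi> ^ (N + 1))"
        unfolding abs_mult using p q1 nn \<xi> by (intro mult_mono) auto
      also have "\<dots> = P * D1 * (\<xi> ^ (2 * l - 1) * \<xi> ^ (N + 1))" by (simp only: mult_ac)
      also have "\<xi> ^ (2 * l - 1) * \<xi> ^ (N + 1) = \<xi> ^ (N + 2 * l)"
        using l by (simp only: power_add[symmetric]) (simp add: add.commute)
      finally have "\<bar>q2 + p * q1\<bar> \<le> K * \<xi> ^ (N + 2 * l)" using q2 by (simp add: K_def algebra_simps)
      then have "c * \<bar>q2 + p * q1\<bar> \<le> c * (K * \<xi> ^ (N + 2 * l))" using c by (intro mult_left_mono) auto
      also have "c * (K * \<xi> ^ (N + 2 * l)) \<le> 2 * K * \<xi> ^ (N + 2 * l) * (- (c * (-1 + q1)))"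
      proof -
        have "c * (K * \<xi> ^ (N + 2 * l)) * 1 \<le> c * (K * \<xi> ^ (N + 2 * l)) * (2 * (1 - q1))"
          using c K \<xi> q1h by (intro mult_left_mono) auto
        then show ?thesis by (simp add: algebra_simps)
      qed
      finally have "\<bar>c * (q2 + p * q1)\<bar> \<le> 2 * K * \<xi> ^ (N + 2 * l) * (- (c * (-1 + q1)))"
        using c by (simp add: abs_mult)
      moreover have "c * (-1 + q1) \<le> 0" using c q1h by (intro mult_nonneg_nonpos) auto
      ultimately show ?thesis using f Hd by blast
    qed
    define m where "m = 2 * K * \<xi> ^ (N + 2 * l)"
    have m: "0 \<le> m" using K \<xi> by (simp add: m_def)
    have "H \<tau> + m * fst (w \<tau>) \<le> H 0 + m * fst (w 0)"
    proof (rule DERIV_nonpos_imp_decreasing_open[where f = "\<lambda>t. H t + m * fst (w t)"])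
      fix t assume "0 < t" "t < \<tau>"
      from dd[OF this] obtain x y where xy: "((\<lambda>t. fst (w t)) has_real_derivative x) (at t)"
        "(H has_real_derivative y) (at t)" "\<bar>y\<bar> \<le> m * (- x)" unfolding m_def by blast
      then show "\<exists>y. ((\<lambda>t. H t + m * fst (w t)) has_real_derivative y) (at t) \<and> y \<le> 0"
        by (intro exI[of _ "y + m * x"] conjI DERIV_add DERIV_cmult) auto
    qed (use \<tau> cH cf in \<open>auto intro!: continuous_intros\<close>)
    moreover have "H 0 - m * fst (w 0) \<le> H \<tau> - m * fst (w \<tau>)"
    proof (rule DERIV_nonneg_imp_increasing_open[where f = "\<lambda>t. H t - m * fst (w t)"])
      fix t assume "0 < t" "t < \<tau>"
      from dd[OF this] obtain x y where xy: "((\<lambda>t. fst (w t)) has_real_derivative x) (at t)"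
        "(H has_real_derivative y) (at t)" "\<bar>y\<bar> \<le> m * (- x)" unfolding m_def by blast
      then show "\<exists>y. ((\<lambda>t. H t - m * fst (w t)) has_real_derivative y) (at t) \<and> 0 \<le> y"
        by (intro exI[of _ "y - m * x"] conjI DERIV_diff DERIV_cmult) auto
    qed (use \<tau> cH cf in \<open>auto intro!: continuous_intros\<close>)
    moreover have "fst (w 0) = \<xi>" "H 0 = ?h \<xi>" using w0 by (auto simp: H_def)
    \<comment> \<open>The abscissa falls from \<xi> to no less than -4 \<xi>, a distance of at most
      5 \<xi>; with the factor 2 in \<open>m\<close> this is the origin of the constant 10.\<close>
    moreover have "m * (\<xi> - fst (w \<tau>)) \<le> m * (5 * \<xi>)"
      using m bx[of \<tau>] \<tau> by (intro mult_left_mono) (auto simp: abs_le_iff)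
    moreover have "m * (5 * \<xi>) = 10 * K * \<xi> ^ (N + 2 * l + 1)" by (simp add: m_def)
    ultimately have "\<bar>H \<tau> - ?h \<xi>\<bar> \<le> 10 * K * \<xi> ^ (N + 2 * l + 1)"
      by (simp only: abs_le_iff right_diff_distrib) linarith
    then show "\<bar>snd (w \<tau>) + ?h (fst (w \<tau>)) - ?h \<xi>\<bar> \<le> 10 * K * \<xi> ^ (N + 2 * l + 1)" by (simp add: H_def)
  qed
qed

lemma parabolic_potential_leading:
  assumes "\<bar>x\<bar> \<le> s" "s \<le> 1"
  shows "\<bar>parabolic_potential N l \<sigma> x - x ^ (2 * l) / (2 * l)\<bar> \<le> (\<Sum>i=1..N. \<bar>\<sigma> (i + 1)\<bar>) * s ^ (2 * l + 1)"
proof -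
  have "\<bar>\<Sum>i=1..N. \<sigma> (i + 1) * x ^ (2 * l + i) / (2 * l + i)\<bar> \<le> (\<Sum>i=1..N. \<bar>\<sigma> (i + 1)\<bar> * s ^ (2 * l + 1))"
  proof (rule order_trans[OF sum_abs sum_mono])
    fix i assume i: "i \<in> {1..N}"
    have "\<bar>x\<bar> ^ (2 * l + i) \<le> s ^ (2 * l + i)" using assms by (intro power_mono) auto
    also have "\<dots> \<le> s ^ (2 * l + 1)" using assms i by (intro power_decreasing) auto
    finally have "\<bar>\<sigma> (i + 1)\<bar> * \<bar>x\<bar> ^ (2 * l + i) / 1 \<le> \<bar>\<sigma> (i + 1)\<bar> * s ^ (2 * l + 1)"
      by (simp add: mult_left_mono)
    moreover have "\<bar>\<sigma> (i + 1)\<bar> * \<bar>x\<bar> ^ (2 * l + i) / real (2 * l + i) \<le> \<bar>\<sigma> (i + 1)\<bar> * \<bar>x\<bar> ^ (2 * l + i) / 1"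
      using i by (intro divide_left_mono) auto
    ultimately show "\<bar>\<sigma> (i + 1) * x ^ (2 * l + i) / real (2 * l + i)\<bar> \<le> \<bar>\<sigma> (i + 1)\<bar> * s ^ (2 * l + 1)"
      by (simp add: abs_mult power_abs)
  qed
  then show ?thesis by (simp add: parabolic_potential_def sum_distrib_right)
qed

text \<open>The trapping region is a box of quasi-homogeneous shape. Near conservation of y + h(x),
  with y nonnegative, bounds both y and x ^ (2l) / (2l) by slightly more than their initial sum,
  which lies strictly inside the box.\<close>

lemma parabolic_half_map:
  assumes cc: "chart_conjugates \<epsilon> \<rho> T \<phi> Z F" and nf: "upper_parabolic_normal_form N l \<sigma> F"
    and l: "l \<ge> 1" and N: "N \<ge> 1"
  obtains K \<xi>0 where "0 \<le> K" "0 < \<xi>0"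
    "\<And>\<xi> x'. 0 < \<xi> \<Longrightarrow> \<xi> < \<xi>0 \<Longrightarrow> x' < 0 \<Longrightarrow> passage \<rho> Z (\<phi> \<xi>) x' \<Longrightarrow>
       \<exists>u>0. u < \<epsilon> \<and> x' = \<phi> (- u) \<and> u \<le> 4 * \<xi> \<and>
         \<bar>parabolic_potential N l \<sigma> (- u) - parabolic_potential N l \<sigma> \<xi>\<bar> \<le> K * \<xi> ^ (N + 2 * l + 1)"
proof -
  have ch: "axis_chart \<epsilon> T \<phi>" and img: "T ` ball 0 \<epsilon> \<subseteq> ball 0 \<rho>"
    and car: "\<And>w. w \<in> ball 0 \<epsilon> \<Longrightarrow> snd w > 0 \<Longrightarrow>
      \<exists>D k. k > 0 \<and> (T has_derivative D) (at w) \<and> D (F w) = k *\<^sub>R Z (T w)"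
    using cc unfolding chart_conjugates_def by blast+
  have \<epsilon>: "0 < \<epsilon>" using ch by (simp add: axis_chart_def)
  obtain K \<xi>1 where K: "0 \<le> K" and \<xi>1: "0 < \<xi>1" "\<xi>1 \<le> 1 / 4"
    and orb: "\<And>\<tau> w \<xi>. half_orbit F \<tau> w \<xi> \<Longrightarrow> 0 < \<xi> \<Longrightarrow> \<xi> < \<xi>1 \<Longrightarrow>
       w ` {0..\<tau>} \<subseteq> {- (4 * \<xi>)..4 * \<xi>} \<times> {- (\<xi> ^ (2 * l))..\<xi> ^ (2 * l)} \<Longrightarrow>
       \<bar>snd (w \<tau>) + parabolic_potential N l \<sigma> (fst (w \<tau>)) - parabolic_potential N l \<sigma> \<xi>\<bar>
         \<le> K * \<xi> ^ (N + 2 * l + 1)"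
    by (rule upper_parabolic_orbit[OF nf l]) blast
  define Sg where "Sg = (\<Sum>i=1..N. \<bar>\<sigma> (i + 1)\<bar>)"
  have Sg: "0 \<le> Sg" unfolding Sg_def by (intro sum_nonneg) auto
  \<comment> \<open>Total coefficient of \<xi> ^ (2l + 1): the corrections of the potential at \<xi>
    and on the wider interval, and the error of the first integral.\<close>
  define B where "B = Sg + Sg * 4 ^ (2 * l + 1) + K"
  have B: "0 \<le> B" using Sg K by (simp add: B_def)
  \<comment> \<open>\<open>\<epsilon> / 5\<close> places the box inside the chart; the last entry
    makes all errors smaller than half of the leading value \<xi> ^ (2l) / (2l).\<close>
  define \<xi>0 where "\<xi>0 = Min {\<xi>1, \<epsilon> / 5, 1 / (4 * l * (B + 1))}"
  have \<xi>0: "0 < \<xi>0" "\<xi>0 \<le> \<xi>1" "\<xi>0 \<le> \<epsilon> / 5" "\<xi>0 \<le> 1 / (4 * l * (B + 1))"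
    using \<xi>1 \<epsilon> B l by (auto simp: \<xi>0_def)
  show ?thesis
  proof (rule that[OF K \<xi>0(1)])
    fix \<xi> x' assume \<xi>: "0 < \<xi>" "\<xi> < \<xi>0" and x': "x' < 0" and pas: "passage \<rho> Z (\<phi> \<xi>) x'"
    have \<xi>4: "4 * \<xi> \<le> 1" "\<xi> \<le> 1" "\<xi> < \<xi>1" using \<xi> \<xi>0 \<xi>1 by auto
    define U where "U = {- (4 * \<xi>)<..<4 * \<xi>} \<times> {- (\<xi> ^ (2 * l))<..<\<xi> ^ (2 * l)}"
    have \<xi>l: "0 < \<xi> ^ (2 * l)" using \<xi> by simp
    have cU: "closure U = {- (4 * \<xi>)..4 * \<xi>} \<times> {- (\<xi> ^ (2 * l))..\<xi> ^ (2 * l)}"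
      unfolding U_def using \<xi> \<xi>l by (simp add: closure_Times closure_greaterThanLessThan)
    have "\<xi> ^ (2 * l) \<le> \<xi> ^ 1" using \<xi> \<xi>4 l by (intro power_decreasing) auto
    then have \<xi>ll: "\<xi> ^ (2 * l) \<le> \<xi>" by simp
    have U: "open U" "closure U \<subseteq> ball 0 \<epsilon>" "(\<xi>, 0) \<in> U"
    proof -
      show "open U" unfolding U_def by (intro open_Times) auto
      show "(\<xi>, 0) \<in> U" unfolding U_def using \<xi> \<xi>l by simp
      show "closure U \<subseteq> ball 0 \<epsilon>"
      proof
        fix w assume "w \<in> closure U"
        then obtain a b where ab: "w = (a, b)" "\<bar>a\<bar> \<le> 4 * \<xi>" "\<bar>b\<bar> \<le> \<xi> ^ (2 * l)"
          unfolding cU by (auto simp: abs_le_iff)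
        have "norm w \<le> \<bar>a\<bar> + \<bar>b\<bar>" unfolding ab(1) by (simp add: norm_Pair sqrt_sum_squares_le_sum_abs)
        then have "norm w \<le> 5 * \<xi>" using ab \<xi>ll by linarith
        then show "w \<in> ball 0 \<epsilon>" using \<xi> \<xi>0 by simp
      qed
    qed
    have trap: "w \<sigma>' \<in> U" if ho: "half_orbit F \<sigma>' w \<xi>" and sub: "w ` {0..\<sigma>'} \<subseteq> closure U" for \<sigma>' w
    proof -
      obtain a b where ab: "w \<sigma>' = (a, b)" by (cases "w \<sigma>'")
      have "0 < \<sigma>'" using ho by (simp add: half_orbit_def)
      then have "w \<sigma>' \<in> closure U" by (intro subsetD[OF sub] imageI) simp
      then have a4: "\<bar>a\<bar> \<le> 4 * \<xi>" unfolding cU ab by (auto simp: abs_le_iff)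
      have b: "0 \<le> b" using half_orbit_snd_nonneg[OF ho] ab by simp
      have "\<bar>b + parabolic_potential N l \<sigma> a - parabolic_potential N l \<sigma> \<xi>\<bar> \<le> K * \<xi> ^ (N + 2 * l + 1)"
        using orb[OF ho \<xi>(1) \<xi>4(3)] sub ab unfolding cU by simp
      moreover have "K * \<xi> ^ (N + 2 * l + 1) \<le> K * \<xi> ^ (2 * l + 1)"
        using K \<xi> \<xi>4 by (intro mult_left_mono power_decreasing) auto
      moreover have "\<bar>parabolic_potential N l \<sigma> a - a ^ (2 * l) / (2 * l)\<bar> \<le> Sg * (4 * \<xi>) ^ (2 * l + 1)"
        unfolding Sg_def by (rule parabolic_potential_leading[OF a4 \<xi>4(1)])
      moreover have "\<bar>parabolic_potential N l \<sigma> \<xi> - \<xi> ^ (2 * l) / (2 * l)\<bar> \<le> Sg * \<xi> ^ (2 * l + 1)"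
        unfolding Sg_def using \<xi> \<xi>4 by (intro parabolic_potential_leading) auto
      ultimately have le: "b + a ^ (2 * l) / (2 * l) \<le> \<xi> ^ (2 * l) / (2 * l) +
          (Sg * \<xi> ^ (2 * l + 1) + Sg * (4 * \<xi>) ^ (2 * l + 1) + K * \<xi> ^ (2 * l + 1))" by linarith
      have "Sg * \<xi> ^ (2 * l + 1) + Sg * (4 * \<xi>) ^ (2 * l + 1) + K * \<xi> ^ (2 * l + 1) = \<xi> ^ (2 * l) * (B * \<xi>)"
        by (simp add: B_def power_mult_distrib algebra_simps)
      also have "\<dots> < \<xi> ^ (2 * l) * (1 / (4 * l))"
      proof (rule mult_strict_left_mono[OF _ \<xi>l])
        have "\<xi> < 1 / (4 * l * (B + 1))" using \<xi> \<xi>0 by linarith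
        moreover have "0 < 4 * l * (B + 1)" using B l by simp
        ultimately have "\<xi> * (4 * l * (B + 1)) < 1" by (simp only: pos_less_divide_eq)
        then have "\<xi> * (B + 1) < 1 / (4 * l)" using l by (simp add: pos_less_divide_eq mult_ac)
        then show "B * \<xi> < 1 / (4 * l)" using \<xi> by (simp add: algebra_simps)
      qed
      finally have lt: "Sg * \<xi> ^ (2 * l + 1) + Sg * (4 * \<xi>) ^ (2 * l + 1) + K * \<xi> ^ (2 * l + 1)
        < \<xi> ^ (2 * l) * (1 / (4 * l))" .
      have "\<xi> ^ (2 * l) / real (2 * l) + \<xi> ^ (2 * l) * (1 / (4 * real l)) = 3 / (4 * l) * \<xi> ^ (2 * l)"
        using l by (simp add: field_simps)
      then have s: "b + a ^ (2 * l) / (2 * l) < 3 / (4 * l) * \<xi> ^ (2 * l)" using le lt by linarith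
      have aa: "a ^ (2 * l) = \<bar>a\<bar> ^ (2 * l)" by (simp add: power_even_abs)
      have "b < 3 / (4 * l) * \<xi> ^ (2 * l)" using s by (smt (verit) aa divide_nonneg_nonneg of_nat_0_le_iff zero_le_power abs_ge_zero)
      moreover have "3 / (4 * l) * \<xi> ^ (2 * l) \<le> 1 * \<xi> ^ (2 * l)"
        using l \<xi>l by (intro mult_right_mono) (auto simp: field_simps)
      ultimately have b2: "b < \<xi> ^ (2 * l)" by linarith
      have "a ^ (2 * l) / (2 * l) < 3 / (4 * l) * \<xi> ^ (2 * l)" using s b by linarith
      \<comment> \<open>The potential alone confines |a| to a factor (3/2) ^ (1 / (2l)) of \<xi>;
        the width 4 \<xi> of the box leaves generous room.\<close>
      then have "\<bar>a\<bar> ^ (2 * l) < 3 / 2 * \<xi> ^ (2 * l)" using l aa by (simp add: field_simps)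
      also have "\<dots> \<le> 4 ^ (2 * l) * \<xi> ^ (2 * l)"
      proof (rule mult_right_mono)
        have "(4::real) ^ 1 \<le> 4 ^ (2 * l)" using l by (intro power_increasing) auto
        then show "3 / 2 \<le> (4::real) ^ (2 * l)" by simp
      qed (use \<xi>l in simp)
      also have "\<dots> = (4 * \<xi>) ^ (2 * l)" by (simp add: power_mult_distrib)
      finally have "\<bar>a\<bar> < 4 * \<xi>" using \<xi> by (meson less_imp_le mult_pos_pos power_less_imp_less_base zero_less_numeral)
      then show ?thesis unfolding ab U_def using b b2 \<xi>l by auto
    qed
    have "\<exists>\<tau> w. half_orbit F \<tau> w \<xi> \<and> w ` {0..\<tau>} \<subseteq> U \<and> T (w \<tau>) = (x', 0)"
      by (rule passage_in_chart[where \<epsilon> = \<epsilon> and \<phi> = \<phi> and Z = Z and \<rho> = \<rho>])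
        (rule ch img pas U | rule car trap, assumption, assumption)+
    then obtain \<tau> w where w: "half_orbit F \<tau> w \<xi>" "w ` {0..\<tau>} \<subseteq> U" "T (w \<tau>) = (x', 0)"
      by blast
    have UU: "U \<subseteq> ball 0 \<epsilon>" using closure_subset U(2) by (rule order_trans)
    have \<tau>: "0 < \<tau>" using w(1) by (simp add: half_orbit_def)
    have wU: "w \<tau> \<in> U" using \<tau> by (intro subsetD[OF w(2)] imageI) simp
    then have "w \<tau> \<in> ball 0 \<epsilon>" by (rule subsetD[OF UU])
    then obtain v where v: "w \<tau> = (v, 0)" "\<bar>v\<bar> < \<epsilon>" "\<phi> v = x'" "sgn v = sgn x'"
      by (rule axis_chart_axis_point[OF ch _ w(3)])
    have "v < 0" using v(4) x' by (simp add: sgn_if split: if_splits)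
    moreover have "- v \<le> 4 * \<xi>" using wU v(1) by (simp add: U_def)
    moreover have "\<bar>parabolic_potential N l \<sigma> v - parabolic_potential N l \<sigma> \<xi>\<bar> \<le> K * \<xi> ^ (N + 2 * l + 1)"
      using orb[OF w(1) \<xi>(1) \<xi>4(3)] order_trans[OF w(2) closure_subset] v(1) unfolding cU by simp
    ultimately show "\<exists>u>0. u < \<epsilon> \<and> x' = \<phi> (- u) \<and> u \<le> 4 * \<xi> \<and>
         \<bar>parabolic_potential N l \<sigma> (- u) - parabolic_potential N l \<sigma> \<xi>\<bar> \<le> K * \<xi> ^ (N + 2 * l + 1)"
      using v by (intro exI[of _ "- v"]) auto
  qed
qed

text \<open>Two expressions are balanced: h(-u) - h(-\<xi>) is u - \<xi> times a factor of exact
  order \<xi> ^ (2l - 1), while h(\<xi>) - h(-\<xi>) contains only the odd powers of h and starts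
  with order \<xi> ^ (2l + k - 1). Their quotient has order \<xi> ^ k and the sign of the first
  surviving coefficient.\<close>

lemma parabolic_compare:
  assumes l: "l \<ge> 1" and k: "1 \<le> k" "k \<le> N + 1" and K: "0 \<le> K"
    and zero: "\<And>j. 1 \<le> j \<Longrightarrow> j < k \<Longrightarrow> (1 + (-1) ^ j) * \<sigma> j = 0"
  obtains a b \<xi>1 where "0 < \<xi>1" "(1 + (-1) ^ k) * \<sigma> k \<noteq> 0 \<Longrightarrow> 0 < a"
    "\<And>\<xi> u. 0 < \<xi> \<Longrightarrow> \<xi> < \<xi>1 \<Longrightarrow> 0 < u \<Longrightarrow> u \<le> 4 * \<xi> \<Longrightarrow>
       \<bar>parabolic_potential N l \<sigma> (- u) - parabolic_potential N l \<sigma> \<xi>\<bar> \<le> K * \<xi> ^ (N + 2 * l + 1) \<Longrightarrow>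
       \<bar>u - \<xi>\<bar> \<le> b * \<xi> ^ k \<and> a * \<xi> ^ k \<le> sgn ((1 + (-1) ^ k) * \<sigma> k) * (u - \<xi>)"
proof -
  define S where "S = (\<lambda>j. (1 + (-1) ^ j) * \<sigma> j)"
  \<comment> \<open>Coefficient of \<xi> ^ (2l + k - 1) in h(\<xi>) - h(-\<xi>); the denominator
    comes from integrating the field term of index \<open>k\<close>.\<close>
  define W where "W = S k / (2 * l + (k - 1))"
  have sW: "sgn W = sgn (S k)" using l by (auto simp: W_def sgn_divide)
  define C where "C = (\<Sum>i\<in>{0..N} - {k - 1}. \<bar>S (i + 1)\<bar>) + K"
  have C: "0 \<le> C" unfolding C_def using K by (intro add_nonneg_nonneg sum_nonneg) auto
  define Sg where "Sg = (\<Sum>i=1..N. \<bar>\<sigma> (i + 1)\<bar>) * 4 ^ (2 * l)"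
  have Sg: "0 \<le> Sg" unfolding Sg_def by (intro mult_nonneg_nonneg sum_nonneg) auto
  define Q2 where "Q2 = (4::real) ^ (2 * l - 1) + 1"
  have Q2: "0 < Q2" unfolding Q2_def by (intro add_pos_pos) auto
  \<comment> \<open>In this order: 4 \<xi> stays below 1, the corrections use up at most half of the
    leading part of \<open>Q\<close>, and the error is at most half of the leading term with
    coefficient \<open>W\<close>.\<close>
  define \<xi>1 where "\<xi>1 = Min {1 / 4, 1 / (4 * l * (Sg + 1)), (if W = 0 then 1 else \<bar>W\<bar> / (2 * (C + 1)))}"
  have \<xi>1: "0 < \<xi>1" "\<xi>1 \<le> 1 / 4" "\<xi>1 \<le> 1 / (4 * l * (Sg + 1))" "W \<noteq> 0 \<Longrightarrow> \<xi>1 \<le> \<bar>W\<bar> / (2 * (C + 1))"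
    using l Sg C by (auto simp: \<xi>1_def)
  show ?thesis
  proof (rule that[of \<xi>1 "\<bar>W\<bar> / (2 * Q2)" "4 * l * (\<bar>W\<bar> + C)"])
    show "0 < \<xi>1" by (rule \<xi>1(1))
    show "0 < \<bar>W\<bar> / (2 * Q2)" if "(1 + (-1) ^ k) * \<sigma> k \<noteq> 0"
    proof -
      have "W \<noteq> 0" using that l by (simp add: W_def S_def)
      then show ?thesis using Q2 by simp
    qed
    fix \<xi> u :: real
    assume \<xi>: "0 < \<xi>" "\<xi> < \<xi>1" and u: "0 < u" "u \<le> 4 * \<xi>"
      and hu: "\<bar>parabolic_potential N l \<sigma> (- u) - parabolic_potential N l \<sigma> \<xi>\<bar> \<le> K * \<xi> ^ (N + 2 * l + 1)"
    let ?h = "parabolic_potential N l \<sigma>"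
    have \<xi>4: "4 * \<xi> \<le> 1" "\<xi> \<le> 1" using \<xi> \<xi>1 by auto
    have hneg: "?h (- x) = x ^ (2 * l) / (2 * l) + (\<Sum>i=1..N. (-1) ^ i * \<sigma> (i + 1) * x ^ (2 * l + i) / (2 * l + i))" for x
    proof -
      have "(- x) ^ (2 * l + i) = (-1) ^ i * x ^ (2 * l + i)" for i
        by (simp only: power_add power_mult power2_minus power_minus[of x i]) (simp only: mult_ac)
      from this[of 0] this show ?thesis unfolding parabolic_potential_def
        by (intro arg_cong2[where f = "(+)"] sum.cong) (simp_all add: mult_ac)
    qed
    define X where "X = ?h (- u) - ?h (- \<xi>)"
    have dp: "x ^ n / real n - y ^ n / real n = (x - y) * ((\<Sum>m<n. y ^ (n - Suc m) * x ^ m) / real n)" for x y :: real and n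
      by (simp add: power_diff_sumr2 flip: diff_divide_distrib)
    define q where "q = (\<lambda>n. (\<Sum>m<n. \<xi> ^ (n - Suc m) * u ^ m) / real n)"
    define Q where "Q = q (2 * l) + (\<Sum>i=1..N. (-1) ^ i * \<sigma> (i + 1) * q (2 * l + i))"
    have XQ: "X = (u - \<xi>) * Q"
    proof -
      have "X = (u ^ (2 * l) / real (2 * l) - \<xi> ^ (2 * l) / real (2 * l)) +
          (\<Sum>i=1..N. (-1) ^ i * \<sigma> (i + 1) * (u ^ (2 * l + i) / real (2 * l + i) - \<xi> ^ (2 * l + i) / real (2 * l + i)))"
        unfolding X_def hneg by (simp add: right_diff_distrib sum_subtractf)
      also have "\<dots> = (u - \<xi>) * q (2 * l) + (\<Sum>i=1..N. (-1) ^ i * \<sigma> (i + 1) * ((u - \<xi>) * q (2 * l + i)))"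
        unfolding dp q_def by simp
      also have "\<dots> = (u - \<xi>) * Q" unfolding Q_def distrib_left sum_distrib_left
        by (intro arg_cong2[where f = "(+)"] sum.cong) (simp_all add: mult_ac)
      finally show ?thesis .
    qed
    have q_up: "\<bar>q n\<bar> \<le> (4 * \<xi>) ^ (n - 1)" if "n \<ge> 1" for n
    proof -
      have "\<bar>\<Sum>m<n. \<xi> ^ (n - Suc m) * u ^ m\<bar> \<le> (\<Sum>m<n. (4 * \<xi>) ^ (n - 1))"
      proof (rule order_trans[OF sum_abs sum_mono])
        fix m assume m: "m \<in> {..<n}"
        have "\<xi> ^ (n - Suc m) * u ^ m \<le> (4 * \<xi>) ^ (n - Suc m) * (4 * \<xi>) ^ m"
          using \<xi> u by (intro mult_mono power_mono) auto
        also have "\<dots> = (4 * \<xi>) ^ (n - Suc m + m)" by (simp only: power_add)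
        also have "n - Suc m + m = n - 1" using m by auto
        finally show "\<bar>\<xi> ^ (n - Suc m) * u ^ m\<bar> \<le> (4 * \<xi>) ^ (n - 1)" using \<xi> u by simp
      qed
      also have "\<dots> = real n * (4 * \<xi>) ^ (n - 1)" by simp
      finally show ?thesis using that by (simp add: q_def field_simps)
    qed
    \<comment> \<open>All summands of the difference quotient are nonnegative, so the single term
      \<open>m = 0\<close> bounds it from below however small \<open>u\<close> is.\<close>
    have q_lo: "\<xi> ^ (2 * l - 1) / (2 * l) \<le> q (2 * l)"
    proof -
      have "(\<Sum>m\<in>{0}. \<xi> ^ (2 * l - Suc m) * u ^ m) \<le> (\<Sum>m<2 * l. \<xi> ^ (2 * l - Suc m) * u ^ m)"
        using l \<xi> u by (intro sum_mono2) auto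
      then show ?thesis unfolding q_def by (intro divide_right_mono) auto
    qed
    define Q1 where "Q1 = (\<Sum>i=1..N. (-1) ^ i * \<sigma> (i + 1) * q (2 * l + i))"
    have "\<bar>Q1\<bar> \<le> (\<Sum>i=1..N. \<bar>\<sigma> (i + 1)\<bar> * (4 * \<xi>) ^ (2 * l))" unfolding Q1_def
    proof (rule order_trans[OF sum_abs sum_mono])
      fix i assume i: "i \<in> {1..N}"
      have "\<bar>q (2 * l + i)\<bar> \<le> (4 * \<xi>) ^ (2 * l + i - 1)" using l by (intro q_up) auto
      also have "\<dots> \<le> (4 * \<xi>) ^ (2 * l)" using \<xi> \<xi>4 i by (intro power_decreasing) auto
      finally have "\<bar>\<sigma> (i + 1)\<bar> * \<bar>q (2 * l + i)\<bar> \<le> \<bar>\<sigma> (i + 1)\<bar> * (4 * \<xi>) ^ (2 * l)" by (intro mult_left_mono) auto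
      then show "\<bar>(-1) ^ i * \<sigma> (i + 1) * q (2 * l + i)\<bar> \<le> \<bar>\<sigma> (i + 1)\<bar> * (4 * \<xi>) ^ (2 * l)"
        by (simp add: abs_mult power_abs)
    qed
    also have "\<dots> = Sg * \<xi> ^ (2 * l)" by (simp add: Sg_def power_mult_distrib sum_distrib_right[symmetric])
    also have "\<dots> = \<xi> ^ (2 * l - 1) * (Sg * \<xi>)" using l by (cases l) auto
    finally have Q1: "\<bar>Q1\<bar> \<le> \<xi> ^ (2 * l - 1) * (Sg * \<xi>)" .
    have \<xi>p: "0 < \<xi> ^ (2 * l - 1)" using \<xi> by simp
    have Sgx: "Sg * \<xi> \<le> 1 / (4 * l)"
    proof -
      have "\<xi> \<le> 1 / (4 * l * (Sg + 1))" using \<xi> \<xi>1 by linarith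
      moreover have "0 < 4 * l * (Sg + 1)" using Sg l by simp
      ultimately have "\<xi> * (4 * l * (Sg + 1)) \<le> 1" by (simp only: pos_le_divide_eq)
      then have "\<xi> * (Sg + 1) \<le> 1 / (4 * l)" using l by (simp add: pos_le_divide_eq mult_ac)
      then show ?thesis using \<xi> by (simp add: algebra_simps)
    qed
    then have "\<xi> ^ (2 * l - 1) * (Sg * \<xi>) \<le> \<xi> ^ (2 * l - 1) * (1 / (4 * l))" using \<xi>p by (intro mult_left_mono) auto
    then have Q1': "\<bar>Q1\<bar> \<le> \<xi> ^ (2 * l - 1) * (1 / (4 * l))" using Q1 by linarith
    have QQ: "Q = q (2 * l) + Q1" by (simp add: Q_def Q1_def)
    have Qlo: "\<xi> ^ (2 * l - 1) / (4 * l) \<le> Q"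
    proof -
      have "\<xi> ^ (2 * l - 1) / (2 * l) - \<xi> ^ (2 * l - 1) * (1 / (4 * l)) = \<xi> ^ (2 * l - 1) / (4 * l)"
        using l by (simp add: field_simps)
      then show ?thesis using q_lo Q1' QQ by linarith
    qed
    have Qup: "Q \<le> Q2 * \<xi> ^ (2 * l - 1)"
    proof -
      have "\<bar>q (2 * l)\<bar> \<le> (4 * \<xi>) ^ (2 * l - 1)" using l by (intro q_up) auto
      moreover have "\<xi> ^ (2 * l - 1) * (1 / (4 * l)) \<le> \<xi> ^ (2 * l - 1) * 1"
        using l \<xi>p by (intro mult_left_mono) (auto simp: field_simps)
      ultimately have "Q \<le> (4 * \<xi>) ^ (2 * l - 1) + \<xi> ^ (2 * l - 1)" using Q1' QQ by linarith
      then show ?thesis by (simp add: Q2_def power_mult_distrib algebra_simps)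
    qed
    have Qpos: "0 < Q" using Qlo \<xi>p l by (smt (verit) divide_pos_pos of_nat_0_less_iff mult_pos_pos zero_less_numeral less_eq_Suc_le One_nat_def)
    \<comment> \<open>The sum may start at \<open>i = 0\<close> because \<open>S 1\<close> is 0;
      this lets \<open>k = 1\<close> be treated like the other indices.\<close>
    have hh: "?h \<xi> - ?h (- \<xi>) = (\<Sum>i=0..N. S (i + 1) * \<xi> ^ (2 * l + i) / (2 * l + i))"
    proof -
      have "?h \<xi> - ?h (- \<xi>) = (\<Sum>i=1..N. S (i + 1) * \<xi> ^ (2 * l + i) / (2 * l + i))"
        unfolding hneg unfolding parabolic_potential_def S_def
        by (simp add: sum_subtractf[symmetric] algebra_simps add_divide_distrib diff_divide_distrib)
      also have "\<dots> = (\<Sum>i=0..N. S (i + 1) * \<xi> ^ (2 * l + i) / (2 * l + i))"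
        by (rule sum.mono_neutral_left) (auto simp: S_def Suc_le_eq)
      finally show ?thesis .
    qed
    define Y where "Y = (\<Sum>i\<in>{0..N} - {k - 1}. S (i + 1) * \<xi> ^ (2 * l + i) / (2 * l + i))"
    have hY: "?h \<xi> - ?h (- \<xi>) = W * \<xi> ^ (2 * l + (k - 1)) + Y"
      unfolding hh Y_def W_def using k
      by (subst sum.remove[of _ "k - 1"]) (auto simp: of_nat_diff)
    have "\<bar>Y\<bar> \<le> (\<Sum>i\<in>{0..N} - {k - 1}. \<bar>S (i + 1)\<bar> * \<xi> ^ (2 * l + k))" unfolding Y_def
    proof (rule order_trans[OF sum_abs sum_mono])
      fix i assume i: "i \<in> {0..N} - {k - 1}"
      show "\<bar>S (i + 1) * \<xi> ^ (2 * l + i) / real (2 * l + i)\<bar> \<le> \<bar>S (i + 1)\<bar> * \<xi> ^ (2 * l + k)"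
      proof (cases "i + 1 < k")
        case True
        then have "S (i + 1) = 0" unfolding S_def by (intro zero) auto
        then show ?thesis by simp
      next
        case False
        then have "k \<le> i" using i by auto
        then have "\<xi> ^ (2 * l + i) \<le> \<xi> ^ (2 * l + k)" using \<xi> \<xi>4 by (intro power_decreasing) auto
        then have "\<bar>S (i + 1)\<bar> * \<xi> ^ (2 * l + i) \<le> \<bar>S (i + 1)\<bar> * \<xi> ^ (2 * l + k)" by (intro mult_left_mono) auto
        moreover have "\<bar>S (i + 1)\<bar> * \<xi> ^ (2 * l + i) / real (2 * l + i) \<le> \<bar>S (i + 1)\<bar> * \<xi> ^ (2 * l + i) / 1"
          using l \<xi> by (intro divide_left_mono) auto
        ultimately show ?thesis using \<xi> by (simp add: abs_mult)
      qed
    qed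
    also have "\<dots> = (C - K) * \<xi> ^ (2 * l + k)" by (simp add: C_def sum_distrib_right)
    finally have Y: "\<bar>Y\<bar> \<le> (C - K) * \<xi> ^ (2 * l + k)" .
    have "K * \<xi> ^ (N + 2 * l + 1) \<le> K * \<xi> ^ (2 * l + k)" using K k \<xi> \<xi>4 by (intro mult_left_mono power_decreasing) auto
    then have "\<bar>X - W * \<xi> ^ (2 * l + (k - 1))\<bar> \<le> K * \<xi> ^ (2 * l + k) + (C - K) * \<xi> ^ (2 * l + k)"
      using hu hY Y unfolding X_def by linarith
    also have "\<dots> = C * \<xi> ^ (2 * l + k)" by (simp add: algebra_simps)
    finally have X: "\<bar>X - W * \<xi> ^ (2 * l + (k - 1))\<bar> \<le> C * \<xi> ^ (2 * l + k)" .
    have e1: "\<xi> ^ (2 * l + (k - 1)) = \<xi> ^ (2 * l - 1) * \<xi> ^ k" using l k by (simp flip: power_add)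
    have e2: "\<xi> ^ (2 * l + k) = \<xi> ^ (2 * l - 1) * \<xi> ^ k * \<xi>"
    proof -
      have "2 * l + k = Suc (2 * l - 1 + k)" using l by simp
      then show ?thesis by (simp only: power_Suc2 power_add)
    qed
    have \<xi>k: "0 < \<xi> ^ k" using \<xi> by simp
    have upper: "\<bar>u - \<xi>\<bar> \<le> 4 * l * (\<bar>W\<bar> + C) * \<xi> ^ k"
    proof -
      have "\<xi> ^ (2 * l - 1) * \<xi> ^ k * \<xi> \<le> \<xi> ^ (2 * l - 1) * \<xi> ^ k * 1" using \<xi>4 \<xi>p \<xi>k by (intro mult_left_mono) auto
      then have "C * \<xi> ^ (2 * l + k) \<le> C * (\<xi> ^ (2 * l - 1) * \<xi> ^ k)" unfolding e2 using C by (intro mult_left_mono) auto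
      moreover have "\<bar>W * \<xi> ^ (2 * l + (k - 1))\<bar> = \<bar>W\<bar> * (\<xi> ^ (2 * l - 1) * \<xi> ^ k)"
        unfolding e1 using \<xi> by (simp add: abs_mult)
      ultimately have "\<bar>X\<bar> \<le> \<bar>W\<bar> * (\<xi> ^ (2 * l - 1) * \<xi> ^ k) + C * (\<xi> ^ (2 * l - 1) * \<xi> ^ k)" using X by linarith
      moreover have "\<bar>u - \<xi>\<bar> * (\<xi> ^ (2 * l - 1) / (4 * l)) \<le> \<bar>X\<bar>"
        unfolding XQ abs_mult using Qlo Qpos by (intro mult_left_mono) auto
      ultimately have "\<bar>u - \<xi>\<bar> * (\<xi> ^ (2 * l - 1) / (4 * l)) \<le> (\<bar>W\<bar> + C) * \<xi> ^ k * \<xi> ^ (2 * l - 1)"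
        by (simp add: algebra_simps)
      then have "\<bar>u - \<xi>\<bar> / (4 * l) * \<xi> ^ (2 * l - 1) \<le> (\<bar>W\<bar> + C) * \<xi> ^ k * \<xi> ^ (2 * l - 1)" by simp
      then have "\<bar>u - \<xi>\<bar> / (4 * l) \<le> (\<bar>W\<bar> + C) * \<xi> ^ k" using \<xi>p by (rule mult_right_le_imp_le)
      then show ?thesis using l by (simp add: field_simps)
    qed
    have lower: "\<bar>W\<bar> / (2 * Q2) * \<xi> ^ k \<le> sgn (S k) * (u - \<xi>)"
    proof (cases "W = 0")
      case True
      then show ?thesis by (simp flip: sW)
    next
      case False
      have "\<xi> \<le> \<bar>W\<bar> / (2 * (C + 1))" using \<xi> \<xi>1(4)[OF False] by linarith
      then have "\<xi> * (C + 1) \<le> \<bar>W\<bar> / 2" using C by (simp add: field_simps)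
      then have "C * \<xi> \<le> \<bar>W\<bar> / 2" using \<xi> by (simp add: algebra_simps)
      then have "(\<xi> ^ (2 * l - 1) * \<xi> ^ k) * (C * \<xi>) \<le> (\<xi> ^ (2 * l - 1) * \<xi> ^ k) * (\<bar>W\<bar> / 2)"
        using \<xi>p \<xi>k by (intro mult_left_mono) auto
      then have Cx: "C * \<xi> ^ (2 * l + k) \<le> (\<xi> ^ (2 * l - 1) * \<xi> ^ k) * (\<bar>W\<bar> / 2)" unfolding e2 by (simp only: mult_ac)
      define s where "s = sgn W"
      have s: "s * W = \<bar>W\<bar>" "\<bar>s\<bar> = 1" using False by (auto simp: s_def sgn_if)
      have "\<bar>s * (X - W * \<xi> ^ (2 * l + (k - 1)))\<bar> \<le> C * \<xi> ^ (2 * l + k)" using X s(2) by (simp add: abs_mult)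
      moreover have "s * (X - W * \<xi> ^ (2 * l + (k - 1))) = s * X - \<bar>W\<bar> * (\<xi> ^ (2 * l - 1) * \<xi> ^ k)"
        unfolding s(1)[symmetric] e1 by (simp add: algebra_simps)
      ultimately have "\<bar>W\<bar> * (\<xi> ^ (2 * l - 1) * \<xi> ^ k) - (\<xi> ^ (2 * l - 1) * \<xi> ^ k) * (\<bar>W\<bar> / 2) \<le> s * X" using Cx by linarith
      moreover have "s * X = s * (u - \<xi>) * Q" by (simp add: XQ)
      ultimately have sQ: "\<bar>W\<bar> / 2 * \<xi> ^ k * \<xi> ^ (2 * l - 1) \<le> s * (u - \<xi>) * Q" by (simp add: algebra_simps)
      have "0 \<le> \<bar>W\<bar> / 2 * \<xi> ^ k * \<xi> ^ (2 * l - 1)" using \<xi>k \<xi>p by simp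
      then have "0 \<le> s * (u - \<xi>) * Q" using sQ by linarith
      then have "0 \<le> s * (u - \<xi>)" using Qpos by (simp only: zero_le_mult_iff) linarith
      then have "s * (u - \<xi>) * Q \<le> s * (u - \<xi>) * (Q2 * \<xi> ^ (2 * l - 1))" using Qup by (intro mult_left_mono)
      from order_trans[OF sQ this]
      have "\<bar>W\<bar> / 2 * \<xi> ^ k * \<xi> ^ (2 * l - 1) \<le> (s * (u - \<xi>) * Q2) * \<xi> ^ (2 * l - 1)"
        by (simp only: mult.assoc)
      then have "\<bar>W\<bar> / 2 * \<xi> ^ k \<le> s * (u - \<xi>) * Q2" using \<xi>p by (rule mult_right_le_imp_le)
      then show ?thesis using Q2 unfolding sW[symmetric] s_def by (simp add: field_simps)
    qed
    show "\<bar>u - \<xi>\<bar> \<le> 4 * l * (\<bar>W\<bar> + C) * \<xi> ^ k \<and>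
        \<bar>W\<bar> / (2 * Q2) * \<xi> ^ k \<le> sgn ((1 + (-1) ^ k) * \<sigma> k) * (u - \<xi>)"
      using upper lower unfolding S_def by blast
  qed
qed

section \<open>Lyapunov constants\<close>

text \<open>Division by \<open>x ^ k\<close> leaves a power series with constant term
  \<open>V k\<close>. Although the sum is given only for positive arguments, convergence at one of
  them gives convergence on a full neighbourhood, hence continuity at 0.\<close>

lemma power_series_leading_coeff:
  fixes V :: "nat \<Rightarrow> real"
  assumes "\<forall>\<^sub>F x in at_right 0. (\<lambda>n. V (Suc n) * x ^ Suc n) sums f x"
    and "k \<ge> 1" and zero: "\<And>j. 1 \<le> j \<Longrightarrow> j < k \<Longrightarrow> V j = 0"
  shows "((\<lambda>x. f x / x ^ k) \<longlongrightarrow> V k) (at_right 0)"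
proof -
  obtain r where r: "r > 0" and s: "\<And>x. 0 < x \<Longrightarrow> x < r \<Longrightarrow> (\<lambda>n. V (Suc n) * x ^ Suc n) sums f x"
    using assms(1) unfolding eventually_at_right_field by auto
  have s': "(\<lambda>n. V (n + k) * x ^ n) sums (f x / x ^ k)" if "0 < x" "x < r" for x
  proof -
    have "(\<lambda>n. V (Suc (n + (k - 1))) * x ^ Suc (n + (k - 1))) sums f x"
      using s[OF that] zero by (subst sums_zero_iff_shift) auto
    moreover have "Suc (n + (k - 1)) = n + k" for n using \<open>k \<ge> 1\<close> by simp
    ultimately have "(\<lambda>n. V (n + k) * x ^ (n + k)) sums f x" by (simp only:)
    from sums_divide[OF this, of "x ^ k"] show ?thesis using that by (simp add: power_add)
  qed
  define g where "g = (\<lambda>x. \<Sum>n. V (n + k) * x ^ n)"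
  have "(g \<longlongrightarrow> V (0 + k)) (at 0)"
  proof (rule powser_limit_0[where s = "r / 2"])
    show "0 < r / 2" using r by simp
    fix x :: real assume "norm x < r / 2"
    then show "(\<lambda>n. V (n + k) * x ^ n) sums g x"
      unfolding g_def using s'[of "r / 2"] r
      by (intro summable_sums powser_inside[of _ "r / 2" x]) (auto simp: sums_iff)
  qed
  then have "(g \<longlongrightarrow> V k) (at_right 0)" by (simp add: filterlim_at_split)
  moreover have "\<forall>\<^sub>F x in at_right 0. g x = f x / x ^ k"
    unfolding eventually_at_right_field g_def using r s' by (intro exI[of _ r]) (auto simp: sums_iff)
  ultimately show ?thesis by (rule Lim_transform_eventually)
qed

text \<open>Algebraic equivalence only involves the order and the sign of the first nonzero coefficient,
  so one-sided bounds of the right order suffice.\<close>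

lemma algebraically_equivalentI:
  fixes V U :: "nat \<Rightarrow> real"
  assumes ser: "\<forall>\<^sub>F x in at_right 0. (\<lambda>n. V (Suc n) * x ^ Suc n) sums f x"
    and bnd: "\<And>k. 1 \<le> k \<Longrightarrow> (\<And>j. 1 \<le> j \<Longrightarrow> j < k \<Longrightarrow> U j = 0) \<Longrightarrow>
      \<exists>a b. (U k \<noteq> 0 \<longrightarrow> 0 < a) \<and>
        (\<forall>\<^sub>F x in at_right 0. \<bar>f x\<bar> \<le> b * x ^ k \<and> a * x ^ k \<le> sgn (U k) * f x)"
  shows "algebraically_equivalent V U"
proof -
  \<comment> \<open>Once \<open>U\<close> vanishes up to index \<open>j\<close>, the estimate of
    order \<open>j + 1\<close> is available and forces the quotient by \<open>x ^ j\<close> to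
    0.\<close>
  have V0: "V j = 0" if "1 \<le> j" "\<And>i. 1 \<le> i \<Longrightarrow> i \<le> j \<Longrightarrow> U i = 0" for j
    using that
  proof (induction j rule: less_induct)
    case (less j)
    have lim: "((\<lambda>x. f x / x ^ j) \<longlongrightarrow> V j) (at_right 0)"
      using less by (intro power_series_leading_coeff[OF ser]) auto
    obtain b where b: "\<forall>\<^sub>F x in at_right 0. \<bar>f x\<bar> \<le> b * x ^ (j + 1)"
    proof -
      have "\<exists>a b. (U (j + 1) \<noteq> 0 \<longrightarrow> 0 < a) \<and> (\<forall>\<^sub>F x in at_right 0.
          \<bar>f x\<bar> \<le> b * x ^ (j + 1) \<and> a * x ^ (j + 1) \<le> sgn (U (j + 1)) * f x)"
        using less.prems by (intro bnd) auto
      then obtain a b where "\<forall>\<^sub>F x in at_right 0.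
          \<bar>f x\<bar> \<le> b * x ^ (j + 1) \<and> a * x ^ (j + 1) \<le> sgn (U (j + 1)) * f x" by blast
      then show ?thesis by (intro that[of b]) (rule eventually_mono, blast+)
    qed
    have "\<forall>\<^sub>F x in at_right 0. norm (f x / x ^ j) \<le> b * x"
      using b eventually_at_right_less[of 0]
    proof eventually_elim
      case (elim x)
      then have "\<bar>f x\<bar> \<le> (b * x) * x ^ j" by (simp add: mult_ac)
      then show ?case using elim by (simp add: pos_divide_le_eq)
    qed
    moreover have "((\<lambda>x. b * x) \<longlongrightarrow> b * 0) (at_right 0)" by (intro tendsto_intros)
    then have "((\<lambda>x. b * x) \<longlongrightarrow> 0) (at_right 0)" by simp
    ultimately have "((\<lambda>x. f x / x ^ j) \<longlongrightarrow> 0) (at_right 0)" by (rule Lim_null_comparison)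
    from tendsto_unique[OF _ lim this] show ?case by simp
  qed
  show ?thesis
  proof (cases "\<forall>k\<ge>1. U k = 0")
    case True
    then show ?thesis using V0 unfolding algebraically_equivalent_def by blast
  next
    case False
    define k where "k = (LEAST k. k \<ge> 1 \<and> U k \<noteq> 0)"
    have "\<exists>k. k \<ge> 1 \<and> U k \<noteq> 0" using False by blast
    then have k: "k \<ge> 1 \<and> U k \<noteq> 0" unfolding k_def by (rule LeastI_ex)
    have kl: "U j = 0" if "1 \<le> j" "j < k" for j
      using not_less_Least[of j "\<lambda>k. k \<ge> 1 \<and> U k \<noteq> 0"] that unfolding k_def by blast
    have Vl: "V j = 0" if "1 \<le> j" "j < k" for j using that kl by (intro V0) auto
    have lim: "((\<lambda>x. f x / x ^ k) \<longlongrightarrow> V k) (at_right 0)"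
      using k Vl by (intro power_series_leading_coeff[OF ser]) auto
    obtain a where a: "0 < a" "\<forall>\<^sub>F x in at_right 0. a * x ^ k \<le> sgn (U k) * f x"
    proof -
      obtain a b where ab: "0 < a" "\<forall>\<^sub>F x in at_right 0.
          \<bar>f x\<bar> \<le> b * x ^ k \<and> a * x ^ k \<le> sgn (U k) * f x"
        using bnd[of k] k kl by blast
      from ab(2) have "\<forall>\<^sub>F x in at_right 0. a * x ^ k \<le> sgn (U k) * f x"
        by (rule eventually_mono) blast
      then show ?thesis by (rule that[OF ab(1)])
    qed
    have "\<forall>\<^sub>F x in at_right 0. a \<le> sgn (U k) * (f x / x ^ k)"
      using a(2) eventually_at_right_less[of 0]
      by eventually_elim (simp add: field_simps)
    moreover have "((\<lambda>x. sgn (U k) * (f x / x ^ k)) \<longlongrightarrow> sgn (U k) * V k) (at_right 0)"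
      by (intro tendsto_intros lim)
    ultimately have "a \<le> sgn (U k) * V k" by (intro tendsto_lowerbound) auto
    then have pos: "0 < sgn (U k) * V k" using a by linarith
    then have "0 < V k / U k" using k by (auto simp: sgn_if zero_less_divide_iff split: if_splits)
    moreover have "V k = V k / U k * U k" using k by simp
    moreover have "V k \<noteq> 0" using pos by auto
    ultimately show ?thesis unfolding algebraically_equivalent_def first_nonzero_at_def
      using k kl Vl by blast
  qed
qed

section \<open>From estimates in charts back to the return maps\<close>

lemma chart_conjugates_mono:
  assumes "chart_conjugates \<epsilon> \<rho> T \<phi> Z F" "0 < \<epsilon>'" "\<epsilon>' \<le> \<epsilon>"
  shows "chart_conjugates \<epsilon>' \<rho> T \<phi> Z F"
proof -
  have "ball 0 \<epsilon>' \<subseteq> (ball 0 \<epsilon> :: (real \<times> real) set)" using assms by (simp add: subset_ball)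
  then show ?thesis using assms axis_chart_mono[of \<epsilon> T \<phi> \<epsilon>'] unfolding chart_conjugates_def by blast
qed

text \<open>Flipping fixes the axis, so the agreement of the two coordinate changes there gives both
  charts the same axis map; entry and exit points of both sides are then measured by one
  coordinate.\<close>

lemma transforms_to_charts:
  assumes "transforms_to Wp Wm Fp Fm" "0 < \<rho>p" "0 < \<rho>m"
  obtains \<epsilon> Tp Tm \<phi>p \<phi>m where "chart_conjugates \<epsilon> \<rho>p Tp \<phi>p Wp Fp"
    "chart_conjugates \<epsilon> \<rho>m Tm \<phi>m (flip_field Wm) (flip_field Fm)"
    "\<And>x. \<bar>x\<bar> < \<epsilon> \<Longrightarrow> \<phi>m x = \<phi>p x"
proof -
  obtain q1p q2p \<Phi>p \<Psi>p Kp q1m q2m \<Phi>m \<Psi>m Km where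
    ad: "admissible_change q1p \<Phi>p \<Psi>p" "admissible_change q1m \<Phi>m \<Psi>m"
    and ev: "\<forall>\<^sub>F x in nhds 0. \<Phi>p (x, 0) = \<Phi>m (x, 0)"
    and ca: "carries_to 1 (coord_map q1p q2p \<Phi>p \<Psi>p) Kp Wp Fp"
      "carries_to (-1) (coord_map q1m q2m \<Phi>m \<Psi>m) Km Wm Fm"
    using assms(1) unfolding transforms_to_def by blast
  obtain e1 where e1: "chart_conjugates e1 \<rho>p (coord_map q1p q2p \<Phi>p \<Psi>p) (\<lambda>x. x + \<Phi>p (x, 0)) Wp Fp"
    by (rule chart_conjugates_coord_map[OF ad(1) ca(1) assms(2)])
  obtain e2 where e2: "chart_conjugates e2 \<rho>m
      (coord_map q1m (- q2m) (\<lambda>w. \<Phi>m (fst w, - snd w)) (\<lambda>w. - \<Psi>m (fst w, - snd w)))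
      (\<lambda>x. x + \<Phi>m (fst (x, 0 :: real), - snd (x, 0 :: real))) (flip_field Wm) (flip_field Fm)"
    by (rule chart_conjugates_coord_map[OF admissible_change_flip[OF ad(2)] carries_to_flip[OF ca(2)] assms(3)])
  obtain e3 where e3: "0 < e3" "\<And>x. \<bar>x\<bar> < e3 \<Longrightarrow> \<Phi>p (x, 0) = \<Phi>m (x, 0)"
    using ev unfolding eventually_nhds_metric by (auto simp: dist_real_def)
  define \<epsilon> where "\<epsilon> = min e1 (min e2 e3)"
  have "0 < e1" "0 < e2" using e1 e2 by (auto simp: chart_conjugates_def axis_chart_def)
  then have \<epsilon>: "0 < \<epsilon>" "\<epsilon> \<le> e1" "\<epsilon> \<le> e2" "\<epsilon> \<le> e3" using e3 by (auto simp: \<epsilon>_def)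
  show ?thesis
    by (rule that[OF chart_conjugates_mono[OF e1 \<epsilon>(1,2)] chart_conjugates_mono[OF e2 \<epsilon>(1,3)]])
       (use e3 \<epsilon> in simp)
qed

text \<open>The image of a small ball is open and contains the origin, hence every small axis point;
  preservation of signs puts its preimage on the positive axis.\<close>

lemma axis_chart_hits_small:
  assumes ch: "axis_chart \<epsilon> T \<phi>" and "0 < \<eta>"
  shows "\<forall>\<^sub>F x in at_right 0. \<exists>\<xi>. 0 < \<xi> \<and> \<xi> < \<eta> \<and> \<xi> < \<epsilon> \<and> \<phi> \<xi> = x"
proof -
  define e where "e = min \<epsilon> \<eta>"
  have e: "0 < e" "e \<le> \<epsilon>" using assms by (auto simp: e_def axis_chart_def)
  note ch' = axis_chart_mono[OF ch e]
  have op: "open (T ` ball 0 e)" by (rule axis_chart_open_image[OF ch']) auto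
  have "T (0, 0) = (0, 0)" using ch' unfolding axis_chart_def by auto
  moreover have "(0, 0) \<in> ball (0 :: real \<times> real) e" using e by (simp add: norm_Pair)
  ultimately have "(0, 0) \<in> T ` ball 0 e" by (metis imageI)
  then obtain r where r: "0 < r" "ball (0, 0) r \<subseteq> T ` ball 0 e" using op open_contains_ball by blast
  have "\<exists>\<xi>. 0 < \<xi> \<and> \<xi> < \<eta> \<and> \<xi> < \<epsilon> \<and> \<phi> \<xi> = x" if x: "0 < x" "x < r" for x
  proof -
    have "(x, 0) \<in> ball (0, 0 :: real) r" using x by (simp add: dist_Pair_Pair)
    then have "(x, 0) \<in> T ` ball 0 e" using r(2) by (rule rev_subsetD)
    then obtain w where w: "w \<in> ball 0 e" "T w = (x, 0)" by (metis imageE)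
    from w obtain v where "\<bar>v\<bar> < e" "\<phi> v = x" "sgn v = sgn x" by (rule axis_chart_axis_point[OF ch'])
    then show ?thesis using x by (intro exI[of _ v]) (auto simp: e_def sgn_if split: if_splits)
  qed
  then show ?thesis unfolding eventually_at_right_field using r by blast
qed

text \<open>One predicate for two uses. For nonzero \<open>s\<close> it fixes order \<open>k\<close>
  and the sign of u - \<xi>; for \<open>s = 0\<close> the constant \<open>a\<close> may be
  nonpositive, and only the bound of |u - \<xi>| by a multiple of \<xi> ^ k has content.\<close>

definition displacement_estimate ::
    "real \<Rightarrow> real \<Rightarrow> (real \<Rightarrow> real) \<Rightarrow> vfield \<Rightarrow> nat \<Rightarrow> real \<Rightarrow> bool" where
  "displacement_estimate \<epsilon> \<rho> \<phi> Z k s \<longleftrightarrow> (\<exists>\<xi>0>0. \<exists>a b. (s \<noteq> 0 \<longrightarrow> 0 < a) \<and>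
     (\<forall>\<xi> x'. 0 < \<xi> \<longrightarrow> \<xi> < \<xi>0 \<longrightarrow> x' < 0 \<longrightarrow> passage \<rho> Z (\<phi> \<xi>) x' \<longrightarrow>
        (\<exists>u>0. u < \<epsilon> \<and> x' = \<phi> (- u) \<and> \<bar>u - \<xi>\<bar> \<le> b * \<xi> ^ k \<and> a * \<xi> ^ k \<le> sgn s * (u - \<xi>))))"

text \<open>\<open>u\<close> and \<open>u'\<close> are the exit distances of the upper and of the
  flipped lower passage from the same point, so u - u' is the displacement function seen in the
  chart.\<close>

definition gap_estimate ::
    "real \<Rightarrow> real \<Rightarrow> real \<Rightarrow> (real \<Rightarrow> real) \<Rightarrow> (real \<Rightarrow> real) \<Rightarrow> vfield \<Rightarrow> vfield \<Rightarrow> nat \<Rightarrow> real \<Rightarrow> bool" where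
  "gap_estimate \<epsilon> \<rho>p \<rho>m \<phi>p \<phi>m Zp Zm k s \<longleftrightarrow> (\<exists>\<xi>0>0. \<exists>a b. (s \<noteq> 0 \<longrightarrow> 0 < a) \<and>
     (\<forall>\<xi> x' x''. 0 < \<xi> \<longrightarrow> \<xi> < \<xi>0 \<longrightarrow> x' < 0 \<longrightarrow> x'' < 0 \<longrightarrow>
        passage \<rho>p Zp (\<phi>p \<xi>) x' \<longrightarrow> passage \<rho>m Zm (\<phi>m \<xi>) x'' \<longrightarrow>
        (\<exists>u>0. \<exists>u'>0. u < \<epsilon> \<and> u' < \<epsilon> \<and> x' = \<phi>p (- u) \<and> x'' = \<phi>m (- u') \<and>
           \<bar>u - u'\<bar> \<le> b * \<xi> ^ k \<and> a * \<xi> ^ k \<le> sgn s * (u - u'))))"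

lemma displacement_estimateI:
  assumes "0 < \<xi>0" "s \<noteq> 0 \<Longrightarrow> 0 < a"
    and "\<And>\<xi> x'. 0 < \<xi> \<Longrightarrow> \<xi> < \<xi>0 \<Longrightarrow> x' < 0 \<Longrightarrow> passage \<rho> Z (\<phi> \<xi>) x' \<Longrightarrow>
      \<exists>u>0. u < \<epsilon> \<and> x' = \<phi> (- u) \<and> \<bar>u - \<xi>\<bar> \<le> b * \<xi> ^ k \<and> a * \<xi> ^ k \<le> sgn s * (u - \<xi>)"
  shows "displacement_estimate \<epsilon> \<rho> \<phi> Z k s"
  unfolding displacement_estimate_def using assms by blast

lemma gap_estimateI:
  assumes "0 < \<xi>0" "s \<noteq> 0 \<Longrightarrow> 0 < a"
    and "\<And>\<xi> x' x''. 0 < \<xi> \<Longrightarrow> \<xi> < \<xi>0 \<Longrightarrow> x' < 0 \<Longrightarrow> x'' < 0 \<Longrightarrow>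
      passage \<rho>p Zp (\<phi>p \<xi>) x' \<Longrightarrow> passage \<rho>m Zm (\<phi>m \<xi>) x'' \<Longrightarrow>
      \<exists>u>0. \<exists>u'>0. u < \<epsilon> \<and> u' < \<epsilon> \<and> x' = \<phi>p (- u) \<and> x'' = \<phi>m (- u') \<and>
        \<bar>u - u'\<bar> \<le> b * \<xi> ^ k \<and> a * \<xi> ^ k \<le> sgn s * (u - u')"
  shows "gap_estimate \<epsilon> \<rho>p \<rho>m \<phi>p \<phi>m Zp Zm k s"
  unfolding gap_estimate_def using assms by blast

lemma focus_displacement:
  assumes cc: "chart_conjugates \<epsilon> \<rho> T \<phi> Z F" and nf: "focus_normal_form N \<gamma> F"
    and k: "1 \<le> k" "k \<le> N" and zero: "\<And>j. 1 \<le> j \<Longrightarrow> j < k \<Longrightarrow> \<gamma> j = 0"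
  shows "displacement_estimate \<epsilon> \<rho> \<phi> Z k (\<gamma> k)"
proof -
  obtain M C \<xi>0 where M: "1 \<le> M" and C: "0 \<le> C" and \<xi>0: "0 < \<xi>0" and
    hm: "\<And>\<xi> x'. 0 < \<xi> \<Longrightarrow> \<xi> < \<xi>0 \<Longrightarrow> x' < 0 \<Longrightarrow> passage \<rho> Z (\<phi> \<xi>) x' \<Longrightarrow>
       \<exists>u>0. u < \<epsilon> \<and> x' = \<phi> (- u) \<and> focus_profile (N + 1) \<gamma> C M \<xi> u"
    by (rule focus_half_map[OF cc nf]) blast
  have kN: "k \<le> N + 1" using k by simp
  obtain a b \<xi>1 where \<xi>1: "0 < \<xi>1" and a: "\<gamma> k \<noteq> 0 \<Longrightarrow> 0 < a" and
    cmp: "\<And>\<xi> u u'. 0 < \<xi> \<Longrightarrow> \<xi> < \<xi>1 \<Longrightarrow> focus_profile (N + 1) \<gamma> C M \<xi> u \<Longrightarrow>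
       focus_profile (N + 1) (\<lambda>_. 0) C M \<xi> u' \<Longrightarrow>
       \<bar>u - u'\<bar> \<le> b * \<xi> ^ k \<and> a * \<xi> ^ k \<le> sgn (\<gamma> k - 0) * (u - u')"
    by (rule focus_profile_compare[OF M C k(1) kN, of \<gamma> "\<lambda>_. 0"]) (use zero in blast)+
  show ?thesis
  proof (rule displacement_estimateI[where a = a and b = b])
    show "0 < min \<xi>0 \<xi>1" using \<xi>0 \<xi>1 by simp
    show "0 < a" if "\<gamma> k \<noteq> 0" using a that by simp
    fix \<xi> x' assume h: "0 < \<xi>" "\<xi> < min \<xi>0 \<xi>1" "x' < 0" "passage \<rho> Z (\<phi> \<xi>) x'"
    then obtain u where u: "u > 0" "u < \<epsilon>" "x' = \<phi> (- u)" "focus_profile (N + 1) \<gamma> C M \<xi> u"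
      using hm[of \<xi> x'] by auto
    then show "\<exists>u>0. u < \<epsilon> \<and> x' = \<phi> (- u) \<and> \<bar>u - \<xi>\<bar> \<le> b * \<xi> ^ k \<and> a * \<xi> ^ k \<le> sgn (\<gamma> k) * (u - \<xi>)"
      using cmp[OF h(1) _ u(4) focus_profile_const[OF C M h(1)]] h(2) by (intro exI[of _ u]) simp
  qed
qed

lemma parabolic_displacement:
  assumes cc: "chart_conjugates \<epsilon> \<rho> T \<phi> Z F" and nf: "upper_parabolic_normal_form N l \<sigma> F"
    and l: "l \<ge> 1" and N: "N \<ge> 1" and k: "1 \<le> k" "k \<le> N + 1"
    and zero: "\<And>j. 1 \<le> j \<Longrightarrow> j < k \<Longrightarrow> (1 + (-1) ^ j) * \<sigma> j = 0"
  shows "displacement_estimate \<epsilon> \<rho> \<phi> Z k ((1 + (-1) ^ k) * \<sigma> k)"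
proof -
  obtain K \<xi>0 where K: "0 \<le> K" and \<xi>0: "0 < \<xi>0" and
    hm: "\<And>\<xi> x'. 0 < \<xi> \<Longrightarrow> \<xi> < \<xi>0 \<Longrightarrow> x' < 0 \<Longrightarrow> passage \<rho> Z (\<phi> \<xi>) x' \<Longrightarrow>
       \<exists>u>0. u < \<epsilon> \<and> x' = \<phi> (- u) \<and> u \<le> 4 * \<xi> \<and>
         \<bar>parabolic_potential N l \<sigma> (- u) - parabolic_potential N l \<sigma> \<xi>\<bar> \<le> K * \<xi> ^ (N + 2 * l + 1)"
    by (rule parabolic_half_map[OF cc nf l N]) blast
  obtain a b \<xi>1 where \<xi>1: "0 < \<xi>1" and a: "(1 + (-1) ^ k) * \<sigma> k \<noteq> 0 \<Longrightarrow> 0 < a" and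
    cmp: "\<And>\<xi> u. 0 < \<xi> \<Longrightarrow> \<xi> < \<xi>1 \<Longrightarrow> 0 < u \<Longrightarrow> u \<le> 4 * \<xi> \<Longrightarrow>
       \<bar>parabolic_potential N l \<sigma> (- u) - parabolic_potential N l \<sigma> \<xi>\<bar> \<le> K * \<xi> ^ (N + 2 * l + 1) \<Longrightarrow>
       \<bar>u - \<xi>\<bar> \<le> b * \<xi> ^ k \<and> a * \<xi> ^ k \<le> sgn ((1 + (-1) ^ k) * \<sigma> k) * (u - \<xi>)"
    by (rule parabolic_compare[OF l k K, of \<sigma>]) (use zero in blast)+
  show ?thesis
  proof (rule displacement_estimateI[where a = a and b = b])
    show "0 < min \<xi>0 \<xi>1" using \<xi>0 \<xi>1 by simp
    show "0 < a" if "(1 + (-1) ^ k) * \<sigma> k \<noteq> 0" using a that by simp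
    fix \<xi> x' assume h: "0 < \<xi>" "\<xi> < min \<xi>0 \<xi>1" "x' < 0" "passage \<rho> Z (\<phi> \<xi>) x'"
    then obtain u where u: "u > 0" "u < \<epsilon>" "x' = \<phi> (- u)" "u \<le> 4 * \<xi>"
      "\<bar>parabolic_potential N l \<sigma> (- u) - parabolic_potential N l \<sigma> \<xi>\<bar> \<le> K * \<xi> ^ (N + 2 * l + 1)"
      using hm[of \<xi> x'] by auto
    then show "\<exists>u>0. u < \<epsilon> \<and> x' = \<phi> (- u) \<and> \<bar>u - \<xi>\<bar> \<le> b * \<xi> ^ k \<and>
        a * \<xi> ^ k \<le> sgn ((1 + (-1) ^ k) * \<sigma> k) * (u - \<xi>)"
      using cmp[OF h(1) _ u(1,4,5)] h(2) by (intro exI[of _ u]) simp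
  qed
qed

text \<open>The two half maps are compared directly, since the vanishing of the lower differences of
  coefficients says nothing about the displacement of either map by itself.\<close>

lemma gap_estimate_focus_focus:
  assumes cp: "chart_conjugates \<epsilon> \<rho>p Tp \<phi>p Zp Fp" and cm: "chart_conjugates \<epsilon> \<rho>m Tm \<phi>m Zm Fm"
    and nf: "focus_normal_form N \<gamma> Fp" "focus_normal_form N \<gamma>' Fm"
    and agree: "\<And>x. \<bar>x\<bar> < \<epsilon> \<Longrightarrow> \<phi>m x = \<phi>p x"
    and k: "1 \<le> k" "k \<le> N" and eq: "\<And>j. 1 \<le> j \<Longrightarrow> j < k \<Longrightarrow> \<gamma> j = \<gamma>' j"
  shows "gap_estimate \<epsilon> \<rho>p \<rho>m \<phi>p \<phi>m Zp Zm k (\<gamma> k - \<gamma>' k)"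
proof -
  obtain M1 C1 \<xi>1 where M1: "1 \<le> M1" and C1: "0 \<le> C1" and \<xi>1: "0 < \<xi>1" and
    hp: "\<And>\<xi> x'. 0 < \<xi> \<Longrightarrow> \<xi> < \<xi>1 \<Longrightarrow> x' < 0 \<Longrightarrow> passage \<rho>p Zp (\<phi>p \<xi>) x' \<Longrightarrow>
       \<exists>u>0. u < \<epsilon> \<and> x' = \<phi>p (- u) \<and> focus_profile (N + 1) \<gamma> C1 M1 \<xi> u"
    by (rule focus_half_map[OF cp nf(1)]) blast
  obtain M2 C2 \<xi>2 where M2: "1 \<le> M2" and C2: "0 \<le> C2" and \<xi>2: "0 < \<xi>2" and
    hm: "\<And>\<xi> x'. 0 < \<xi> \<Longrightarrow> \<xi> < \<xi>2 \<Longrightarrow> x' < 0 \<Longrightarrow> passage \<rho>m Zm (\<phi>m \<xi>) x' \<Longrightarrow>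
       \<exists>u>0. u < \<epsilon> \<and> x' = \<phi>m (- u) \<and> focus_profile (N + 1) \<gamma>' C2 M2 \<xi> u"
    by (rule focus_half_map[OF cm nf(2)]) blast
  define M where "M = max M1 M2"
  define C where "C = max C1 C2"
  have MC: "1 \<le> M" "0 \<le> C" using M1 C1 by (auto simp: M_def C_def)
  have kN: "k \<le> N + 1" using k by simp
  obtain a b \<xi>3 where \<xi>3: "0 < \<xi>3" and a: "\<gamma> k \<noteq> \<gamma>' k \<Longrightarrow> 0 < a" and
    cmp: "\<And>\<xi> u u'. 0 < \<xi> \<Longrightarrow> \<xi> < \<xi>3 \<Longrightarrow> focus_profile (N + 1) \<gamma> C M \<xi> u \<Longrightarrow>
       focus_profile (N + 1) \<gamma>' C M \<xi> u' \<Longrightarrow>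
       \<bar>u - u'\<bar> \<le> b * \<xi> ^ k \<and> a * \<xi> ^ k \<le> sgn (\<gamma> k - \<gamma>' k) * (u - u')"
    by (rule focus_profile_compare[OF MC k(1) kN, of \<gamma> \<gamma>']) (use eq in blast)+
  define \<xi>0 where "\<xi>0 = min \<xi>1 (min \<xi>2 \<xi>3)"
  show ?thesis
  proof (rule gap_estimateI[where a = a and b = b])
    show "0 < \<xi>0" using \<xi>1 \<xi>2 \<xi>3 by (simp add: \<xi>0_def)
    show "0 < a" if "\<gamma> k - \<gamma>' k \<noteq> 0" using a that by simp
    fix \<xi> x' x'' assume h: "0 < \<xi>" "\<xi> < \<xi>0" "x' < 0" "x'' < 0"
      "passage \<rho>p Zp (\<phi>p \<xi>) x'" "passage \<rho>m Zm (\<phi>m \<xi>) x''"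
    have s: "\<xi> < \<xi>1" "\<xi> < \<xi>2" "\<xi> < \<xi>3" using h(2) by (auto simp: \<xi>0_def)
    obtain u where u: "u > 0" "u < \<epsilon>" "x' = \<phi>p (- u)" "focus_profile (N + 1) \<gamma> C1 M1 \<xi> u"
      using hp[OF h(1) s(1) h(3,5)] by blast
    obtain u' where u': "u' > 0" "u' < \<epsilon>" "x'' = \<phi>m (- u')" "focus_profile (N + 1) \<gamma>' C2 M2 \<xi> u'"
      using hm[OF h(1) s(2) h(4,6)] by blast
    have "focus_profile (N + 1) \<gamma> C M \<xi> u" "focus_profile (N + 1) \<gamma>' C M \<xi> u'"
      using focus_profile_weaken[OF u(4) _ _ M1 h(1), of C M] focus_profile_weaken[OF u'(4) _ _ M2 h(1), of C M]
      by (auto simp: C_def M_def)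
    from cmp[OF h(1) s(3) this]
    show "\<exists>u>0. \<exists>u'>0. u < \<epsilon> \<and> u' < \<epsilon> \<and> x' = \<phi>p (- u) \<and> x'' = \<phi>m (- u') \<and>
           \<bar>u - u'\<bar> \<le> b * \<xi> ^ k \<and> a * \<xi> ^ k \<le> sgn (\<gamma> k - \<gamma>' k) * (u - u')"
      using u(1-3) u'(1-3) by blast
  qed
qed

text \<open>A lower map that is the identity up to order \<open>k + 1\<close> cannot affect the term
  of order \<open>k\<close> contributed by the upper one.\<close>

lemma gap_estimate_displacement:
  assumes p: "displacement_estimate \<epsilon> \<rho>p \<phi>p Zp k s" and m: "displacement_estimate \<epsilon> \<rho>m \<phi>m Zm (k + 1) 0"
  shows "gap_estimate \<epsilon> \<rho>p \<rho>m \<phi>p \<phi>m Zp Zm k s"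
proof -
  obtain \<xi>1 a b where \<xi>1: "0 < \<xi>1" and a: "s \<noteq> 0 \<Longrightarrow> 0 < a" and
    hp: "\<And>\<xi> x'. 0 < \<xi> \<Longrightarrow> \<xi> < \<xi>1 \<Longrightarrow> x' < 0 \<Longrightarrow> passage \<rho>p Zp (\<phi>p \<xi>) x' \<Longrightarrow>
      \<exists>u>0. u < \<epsilon> \<and> x' = \<phi>p (- u) \<and> \<bar>u - \<xi>\<bar> \<le> b * \<xi> ^ k \<and> a * \<xi> ^ k \<le> sgn s * (u - \<xi>)"
    using p unfolding displacement_estimate_def by blast
  obtain \<xi>2 b' where \<xi>2: "0 < \<xi>2" and
    hm: "\<And>\<xi> x'. 0 < \<xi> \<Longrightarrow> \<xi> < \<xi>2 \<Longrightarrow> x' < 0 \<Longrightarrow> passage \<rho>m Zm (\<phi>m \<xi>) x' \<Longrightarrow>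
      \<exists>u>0. u < \<epsilon> \<and> x' = \<phi>m (- u) \<and> \<bar>u - \<xi>\<bar> \<le> b' * \<xi> ^ (k + 1)"
    using m unfolding displacement_estimate_def by blast
  define B where "B = max b' 0"
  \<comment> \<open>The last entry makes the lower displacement at most half of the upper
    lower-bound \<open>a * \<xi> ^ k\<close>.\<close>
  define \<xi>0 where "\<xi>0 = Min {1, \<xi>1, \<xi>2, if s = 0 then 1 else a / (2 * (B + 1))}"
  have \<xi>0: "0 < \<xi>0" "\<xi>0 \<le> 1" "\<xi>0 \<le> \<xi>1" "\<xi>0 \<le> \<xi>2" "s \<noteq> 0 \<Longrightarrow> \<xi>0 \<le> a / (2 * (B + 1))"
    using \<xi>1 \<xi>2 a by (auto simp: \<xi>0_def B_def)
  show ?thesis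
  proof (rule gap_estimateI[where a = "if s = 0 then 0 else a / 2" and b = "b + B"])
    show "0 < \<xi>0" by (rule \<xi>0)
    show "0 < (if s = 0 then 0 else a / 2)" if "s \<noteq> 0" using a that by simp
    fix \<xi> x' x'' assume h: "0 < \<xi>" "\<xi> < \<xi>0" "x' < 0" "x'' < 0"
      "passage \<rho>p Zp (\<phi>p \<xi>) x'" "passage \<rho>m Zm (\<phi>m \<xi>) x''"
    have sm: "\<xi> < \<xi>1" "\<xi> < \<xi>2" "\<xi> \<le> 1" using h(2) \<xi>0 by auto
    obtain u where u: "u > 0" "u < \<epsilon>" "x' = \<phi>p (- u)" "\<bar>u - \<xi>\<bar> \<le> b * \<xi> ^ k" "a * \<xi> ^ k \<le> sgn s * (u - \<xi>)"
      using hp[OF h(1) sm(1) h(3,5)] by blast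
    obtain u' where u': "u' > 0" "u' < \<epsilon>" "x'' = \<phi>m (- u')" "\<bar>u' - \<xi>\<bar> \<le> b' * \<xi> ^ (k + 1)"
      using hm[OF h(1) sm(2) h(4,6)] by blast
    have "b' * \<xi> ^ (k + 1) \<le> B * \<xi> ^ (k + 1)" using h(1) by (intro mult_right_mono) (auto simp: B_def)
    then have u'B: "\<bar>u' - \<xi>\<bar> \<le> B * \<xi> ^ (k + 1)" using u'(4) by linarith
    have "B * \<xi> ^ (k + 1) \<le> B * \<xi> ^ k"
      using h(1) sm(3) by (intro mult_left_mono power_decreasing) (auto simp: B_def)
    then have "\<bar>u - u'\<bar> \<le> b * \<xi> ^ k + B * \<xi> ^ k" using u(4) u'B by linarith
    then have 1: "\<bar>u - u'\<bar> \<le> (b + B) * \<xi> ^ k" by (simp add: algebra_simps)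
    have 2: "(if s = 0 then 0 else a / 2) * \<xi> ^ k \<le> sgn s * (u - u')"
    proof (cases "s = 0")
      case False
      have B0: "0 \<le> B" by (simp add: B_def)
      have "\<xi> \<le> a / (2 * (B + 1))" using h(2) \<xi>0(5)[OF False] by linarith
      then have "\<xi> * (B + 1) \<le> a / 2" using B0 by (simp add: field_simps)
      then have "B * \<xi> \<le> a / 2" using h(1) by (simp add: algebra_simps)
      then have "(B * \<xi>) * \<xi> ^ k \<le> (a / 2) * \<xi> ^ k" using h(1) by (intro mult_right_mono) auto
      then have "B * \<xi> ^ (k + 1) \<le> a / 2 * \<xi> ^ k" by (simp add: mult_ac)
      then have "\<bar>u' - \<xi>\<bar> \<le> a / 2 * \<xi> ^ k" using u'B by linarith
      moreover have "\<bar>sgn s * (u' - \<xi>)\<bar> = \<bar>u' - \<xi>\<bar>" using False by (simp add: abs_mult abs_sgn_eq)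
      ultimately have "sgn s * (u' - \<xi>) \<le> a / 2 * \<xi> ^ k" by linarith
      moreover have "sgn s * (u - u') = sgn s * (u - \<xi>) - sgn s * (u' - \<xi>)" by (simp add: algebra_simps)
      moreover have "a * \<xi> ^ k = a / 2 * \<xi> ^ k + a / 2 * \<xi> ^ k" by simp
      ultimately have "a / 2 * \<xi> ^ k \<le> sgn s * (u - u')" using u(5) by linarith
      then show ?thesis using False by (simp only: if_False)
    qed simp
    show "\<exists>u>0. \<exists>u'>0. u < \<epsilon> \<and> u' < \<epsilon> \<and> x' = \<phi>p (- u) \<and> x'' = \<phi>m (- u') \<and>
           \<bar>u - u'\<bar> \<le> (b + B) * \<xi> ^ k \<and> (if s = 0 then 0 else a / 2) * \<xi> ^ k \<le> sgn s * (u - u')"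
      using u(1-3) u'(1-3) 1 2 by blast
  qed
qed

text \<open>The axis map changes both the gap and the starting abscissa by factors between 1/2 and
  3/2, so order and sign in the chart are those in the original coordinate.\<close>

lemma gap_estimate_return_maps:
  assumes cp: "chart_conjugates \<epsilon> \<rho>p Tp \<phi>p Wp Fp"
    and agree: "\<And>x. \<bar>x\<bar> < \<epsilon> \<Longrightarrow> \<phi>m x = \<phi>p x"
    and cont: "continuous_on (ball 0 \<rho>p) Wp" "continuous_on (ball 0 \<rho>m) Wm"
    and gap: "gap_estimate \<epsilon> \<rho>p \<rho>m \<phi>p \<phi>m Wp (flip_field Wm) k s"
    and hr: "0 < \<delta>" "half_return_maps Wp Wm \<delta> \<Pi>p \<Pi>m" "inj_on \<Pi>m {-\<delta>..0}"
    and dom: "\<forall>\<^sub>F x in at_right 0. x \<in> \<Pi>m ` {-\<delta>..0}"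
  shows "\<exists>a b. (s \<noteq> 0 \<longrightarrow> 0 < a) \<and> (\<forall>\<^sub>F x in at_right 0.
      \<bar>the_inv_into {-\<delta>..0} \<Pi>m x - \<Pi>p x\<bar> \<le> b * x ^ k \<and>
      a * x ^ k \<le> sgn s * (the_inv_into {-\<delta>..0} \<Pi>m x - \<Pi>p x))"
proof -
  have ch: "axis_chart \<epsilon> Tp \<phi>p" using cp by (simp add: chart_conjugates_def)
  obtain \<xi>0 a b where \<xi>0: "0 < \<xi>0" and a: "s \<noteq> 0 \<Longrightarrow> 0 < a" and
    gp: "\<And>\<xi> x' x''. 0 < \<xi> \<Longrightarrow> \<xi> < \<xi>0 \<Longrightarrow> x' < 0 \<Longrightarrow> x'' < 0 \<Longrightarrow>
        passage \<rho>p Wp (\<phi>p \<xi>) x' \<Longrightarrow> passage \<rho>m (flip_field Wm) (\<phi>m \<xi>) x'' \<Longrightarrow>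
        \<exists>u>0. \<exists>u'>0. u < \<epsilon> \<and> u' < \<epsilon> \<and> x' = \<phi>p (- u) \<and> x'' = \<phi>m (- u') \<and>
           \<bar>u - u'\<bar> \<le> b * \<xi> ^ k \<and> a * \<xi> ^ k \<le> sgn s * (u - u')"
    using gap unfolding gap_estimate_def by blast
  \<comment> \<open>The factor 1/2 is the smallest stretching of the gap by the axis map, and
    \<open>2 / 3\<close> comes from \<xi> being at least 2/3 of x. In \<open>b'\<close> the gap is
    stretched by at most 3/2 and \<xi> is at most 2 x.\<close>
  define a' where "a' = (if s = 0 then 0 else a / 2 * (2 / 3) ^ k)"
  define b' where "b' = 3 / 2 * b * 2 ^ k"
  have small: "\<forall>\<^sub>F x in at_right 0. x \<le> \<delta>"
    using hr(1) unfolding eventually_at_right_field by (auto intro: exI[of _ \<delta>])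
  have "\<forall>\<^sub>F x in at_right 0. \<bar>the_inv_into {-\<delta>..0} \<Pi>m x - \<Pi>p x\<bar> \<le> b' * x ^ k \<and>
      a' * x ^ k \<le> sgn s * (the_inv_into {-\<delta>..0} \<Pi>m x - \<Pi>p x)"
    using dom axis_chart_hits_small[OF ch \<xi>0] eventually_at_right_less[of 0] small
  proof eventually_elim
    case (elim x)
    obtain \<xi> where \<xi>: "0 < \<xi>" "\<xi> < \<xi>0" "\<xi> < \<epsilon>" "\<phi>p \<xi> = x" using elim by blast
    define v where "v = the_inv_into {-\<delta>..0} \<Pi>m x"
    have v: "v \<in> {-\<delta>..0}" "\<Pi>m v = x"
      unfolding v_def
      by (rule the_inv_into_into[OF hr(3) elim(1) order_refl], rule f_the_inv_into_f[OF hr(3) elim(1)])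
    have "\<Pi>m 0 = 0" using hr(2) by (simp add: half_return_maps_def)
    then have "v \<noteq> 0" using v(2) elim by auto
    then have v': "v \<in> {-\<delta>..<0}" using v(1) by simp
    have tr: "travels_to Wp Wm (-1) v x" "travels_to Wp Wm 1 x (\<Pi>p x)" "\<Pi>p x < 0"
      using hr(2) v' v(2) elim unfolding half_return_maps_def by auto
    have pas: "passage \<rho>p Wp (\<phi>p \<xi>) (\<Pi>p x)" "passage \<rho>m (flip_field Wm) (\<phi>m \<xi>) v"
      using travels_to_upper_passage[OF tr(2) cont(1)] travels_to_lower_passage[OF tr(1) cont(2)]
        agree[of \<xi>] \<xi> by auto
    have "v < 0" using v' by simp
    obtain u u' where u: "u > 0" "u' > 0" "u < \<epsilon>" "u' < \<epsilon>" "\<Pi>p x = \<phi>p (- u)" "v = \<phi>m (- u')"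
      "\<bar>u - u'\<bar> \<le> b * \<xi> ^ k" "a * \<xi> ^ k \<le> sgn s * (u - u')"
      using gp[OF \<xi>(1,2) tr(3) \<open>v < 0\<close> pas] by blast
    define d where "d = u - u'"
    define \<Delta> where "\<Delta> = v - \<Pi>p x"
    \<comment> \<open>Both exit points are negative, so the difference of their abscissas is close
      to -u' + u, with the sign of u - u'.\<close>
    have "\<bar>(\<phi>p (- u') - \<phi>p (- u)) - (- u' - (- u))\<bar> \<le> \<bar>- u' - (- u)\<bar> / 2"
      using ch u(1-4) unfolding axis_chart_def by (metis abs_minus_cancel abs_of_pos)
    moreover have "\<phi>m (- u') = \<phi>p (- u')" using u by (intro agree) simp
    ultimately have D: "\<bar>\<Delta> - d\<bar> \<le> \<bar>d\<bar> / 2" using u(5,6) by (simp add: \<Delta>_def d_def)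
    have x\<xi>: "\<xi> \<le> 2 * x" "x \<le> 3 / 2 * \<xi>"
    proof -
      have "\<bar>\<phi>p \<xi> - \<xi>\<bar> \<le> \<bar>\<xi>\<bar> / 2" using \<xi> by (intro axis_chart_bounds[OF ch]) simp
      then show "\<xi> \<le> 2 * x" "x \<le> 3 / 2 * \<xi>" using \<xi> by linarith+
    qed
    have \<xi>k: "0 < \<xi> ^ k" using \<xi> by simp
    have "0 \<le> b * \<xi> ^ k" using u(7) by linarith
    then have b: "0 \<le> b" using \<xi>k by (simp add: zero_le_mult_iff)
    have "\<bar>\<Delta>\<bar> \<le> 3 / 2 * (b * \<xi> ^ k)" proof -
      have "\<bar>\<Delta>\<bar> \<le> \<bar>\<Delta> - d\<bar> + \<bar>d\<bar>" by linarith
      then show ?thesis using D u(7)[folded d_def] by linarith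
    qed
    also have "b * \<xi> ^ k \<le> b * (2 * x) ^ k" using b \<xi> x\<xi> by (intro mult_left_mono power_mono) auto
    then have "3 / 2 * (b * \<xi> ^ k) \<le> b' * x ^ k" by (simp add: b'_def power_mult_distrib)
    finally have 1: "\<bar>\<Delta>\<bar> \<le> b' * x ^ k" .
    have 2: "a' * x ^ k \<le> sgn s * \<Delta>"
    proof (cases "s = 0")
      case False
      have "(2 / 3 * x) ^ k \<le> \<xi> ^ k" using elim x\<xi> by (intro power_mono) auto
      then have "a / 2 * (2 / 3 * x) ^ k \<le> a / 2 * \<xi> ^ k" using a[OF False] by (intro mult_left_mono) auto
      then have l: "a' * x ^ k \<le> a / 2 * \<xi> ^ k" using False by (simp only: a'_def power_mult_distrib) simp
      have "\<bar>sgn s * d\<bar> = \<bar>d\<bar>" "\<bar>sgn s * (\<Delta> - d)\<bar> = \<bar>\<Delta> - d\<bar>" using False by (simp_all add: abs_mult abs_sgn_eq)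
      moreover have "0 < a * \<xi> ^ k" using a[OF False] \<xi>k by simp
      moreover have "a * \<xi> ^ k \<le> sgn s * d" using u(8) by (simp add: d_def)
      moreover have "sgn s * \<Delta> = sgn s * d + sgn s * (\<Delta> - d)" by (simp add: algebra_simps)
      moreover have "a / 2 * \<xi> ^ k = a * \<xi> ^ k / 2" by simp
      ultimately show ?thesis using D l by linarith
    qed (simp add: a'_def)
    show ?case using 1 2 unfolding \<Delta>_def v_def by blast
  qed
  moreover have "s \<noteq> 0 \<longrightarrow> 0 < a'" using a by (simp add: a'_def)
  ultimately show ?thesis by blast
qed

lemma continuous_on_reflect_field:
  assumes "continuous_on (ball 0 r) Z"
  shows "continuous_on (ball 0 r) (reflect_field Z)"
proof -
  have "continuous_on (ball 0 r) (\<lambda>w. Z (- fst w, snd w))"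
    by (rule continuous_on_compose2[OF assms]) (auto intro!: continuous_intros simp: norm_prod_def)
  then show ?thesis unfolding reflect_field_def by (intro continuous_intros)
qed

theorem theorem3p1:
  fixes Zp Zm Wp Wm :: "real \<times> real \<Rightarrow> real \<times> real" and V :: "nat \<Rightarrow> real"
  assumes "analytic_field Zp" and "analytic_field Zm"
    and "monodromic Zp Zm"
    and "ccw_version Zp Zm Wp Wm"
    and "lyapunov_constants Wp Wm V"
  shows "(\<forall>\<gamma>p \<gamma>m. FF_type Zp Zm \<and> FF_normal_form_coeffs Wp Wm \<gamma>p \<gamma>m \<longrightarrow>
            algebraically_equivalent V (\<lambda>k. \<gamma>p k + (-1) ^ (k - 1) * \<gamma>m k)) \<and>
         (\<forall>lm \<gamma>p. FP_type Zp Zm lm \<and> FP_normal_form_coeffs Wp Wm lm \<gamma>p \<longrightarrow>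
            algebraically_equivalent V \<gamma>p) \<and>
         (\<forall>lp lm \<sigma>p. PP_type Zp Zm lp lm \<and> PP_normal_form_coeffs Wp Wm lp lm \<sigma>p \<longrightarrow>
            algebraically_equivalent V (\<lambda>k. (1 + (-1) ^ k) * \<sigma>p k))"
proof -
  obtain \<rho>p where \<rho>p: "0 < \<rho>p" "continuous_on (ball 0 \<rho>p) Wp"
    using analytic_field_continuous[OF assms(1)] continuous_on_reflect_field assms(4)
    unfolding ccw_version_def by metis
  obtain \<rho>m where \<rho>m: "0 < \<rho>m" "continuous_on (ball 0 \<rho>m) Wm"
    using analytic_field_continuous[OF assms(2)] continuous_on_reflect_field assms(4)
    unfolding ccw_version_def by metis
  obtain \<delta> \<Pi>p \<Pi>m where hr: "0 < \<delta>" "half_return_maps Wp Wm \<delta> \<Pi>p \<Pi>m" "inj_on \<Pi>m {-\<delta>..0}"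
    and ev: "\<forall>\<^sub>F x in at_right 0. x \<in> \<Pi>m ` {-\<delta>..0} \<and>
           (\<lambda>k. V (Suc k) * x ^ Suc k) sums (the_inv_into {-\<delta>..0} \<Pi>m x - \<Pi>p x)"
    using assms(5) unfolding lyapunov_constants_def by blast
  have dom: "\<forall>\<^sub>F x in at_right 0. x \<in> \<Pi>m ` {-\<delta>..0}" using ev by (rule eventually_mono) blast
  have ser: "\<forall>\<^sub>F x in at_right 0. (\<lambda>k. V (Suc k) * x ^ Suc k) sums (the_inv_into {-\<delta>..0} \<Pi>m x - \<Pi>p x)"
    using ev by (rule eventually_mono) blast
  \<comment> \<open>Charts and normal forms may vary with \<open>k\<close>; only the return maps of
    the original system are common to all indices, and the estimates speak of those alone.\<close>
  have main: "algebraically_equivalent V U"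
    if gap: "\<And>k. 1 \<le> k \<Longrightarrow> (\<And>j. 1 \<le> j \<Longrightarrow> j < k \<Longrightarrow> U j = 0) \<Longrightarrow>
      \<exists>\<epsilon> Tp \<phi>p Fp \<phi>m. chart_conjugates \<epsilon> \<rho>p Tp \<phi>p Wp Fp \<and> (\<forall>x. \<bar>x\<bar> < \<epsilon> \<longrightarrow> \<phi>m x = \<phi>p x) \<and>
        gap_estimate \<epsilon> \<rho>p \<rho>m \<phi>p \<phi>m Wp (flip_field Wm) k (U k)" for U
  proof (rule algebraically_equivalentI[OF ser])
    fix k :: nat assume k: "1 \<le> k" "\<And>j. 1 \<le> j \<Longrightarrow> j < k \<Longrightarrow> U j = 0"
    obtain \<epsilon> Tp \<phi>p Fp \<phi>m where "chart_conjugates \<epsilon> \<rho>p Tp \<phi>p Wp Fp" "\<forall>x. \<bar>x\<bar> < \<epsilon> \<longrightarrow> \<phi>m x = \<phi>p x"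
      "gap_estimate \<epsilon> \<rho>p \<rho>m \<phi>p \<phi>m Wp (flip_field Wm) k (U k)"
      using gap[OF k] by blast
    then show "\<exists>a b. (U k \<noteq> 0 \<longrightarrow> 0 < a) \<and> (\<forall>\<^sub>F x in at_right 0.
        \<bar>the_inv_into {-\<delta>..0} \<Pi>m x - \<Pi>p x\<bar> \<le> b * x ^ k \<and>
        a * x ^ k \<le> sgn (U k) * (the_inv_into {-\<delta>..0} \<Pi>m x - \<Pi>p x))"
      by (intro gap_estimate_return_maps[OF _ _ \<rho>p(2) \<rho>m(2) _ hr dom]) auto
  qed
  \<comment> \<open>A normal form of order \<open>k\<close> already controls the displacement up to
    order \<open>k + 1\<close>, since the parabolic comparison reaches index
    \<open>N + 1\<close>.\<close>
  have lower: "displacement_estimate \<epsilon> \<rho>m \<phi>m (flip_field Wm) (k + 1) 0"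
    if "chart_conjugates \<epsilon> \<rho>m Tm \<phi>m (flip_field Wm) (flip_field Fm)"
      "lower_parabolic_normal_form k l Fm" "l \<ge> 1" "k \<ge> 1" for \<epsilon> Tm \<phi>m Fm k l
    using parabolic_displacement[OF that(1) lower_parabolic_normal_form_flip[OF that(2)] that(3,4), of "k + 1"]
    by simp
  show ?thesis
  proof (intro conjI allI impI)
    fix \<gamma>p \<gamma>m assume "FF_type Zp Zm \<and> FF_normal_form_coeffs Wp Wm \<gamma>p \<gamma>m"
    then have nf: "\<And>N. N \<ge> 1 \<Longrightarrow> \<exists>Fp Fm. focus_normal_form N \<gamma>p Fp \<and> focus_normal_form N \<gamma>m Fm \<and>
        transforms_to Wp Wm Fp Fm" by (simp add: FF_normal_form_coeffs_def)
    define U where "U = (\<lambda>k. \<gamma>p k + (-1) ^ (k - 1) * \<gamma>m k)"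
    \<comment> \<open>The sign of the flipped lower coefficient turns the difference of coefficients
      into the stated sum. The index 0 is excluded because there \<open>j - 1\<close> is truncated
      and the signs would not match.\<close>
    have U: "\<gamma>p j - (-1) ^ j * \<gamma>m j = U j" if "1 \<le> j" for j
      using that by (cases j) (auto simp: U_def)
    have "algebraically_equivalent V U"
    proof (rule main)
      fix k :: nat assume k: "1 \<le> k" "\<And>j. 1 \<le> j \<Longrightarrow> j < k \<Longrightarrow> U j = 0"
      obtain Fp Fm where F: "focus_normal_form k \<gamma>p Fp" "focus_normal_form k \<gamma>m Fm" "transforms_to Wp Wm Fp Fm"
        using nf[OF k(1)] by blast
      obtain \<epsilon> Tp Tm \<phi>p \<phi>m where c: "chart_conjugates \<epsilon> \<rho>p Tp \<phi>p Wp Fp"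
        "chart_conjugates \<epsilon> \<rho>m Tm \<phi>m (flip_field Wm) (flip_field Fm)" "\<And>x. \<bar>x\<bar> < \<epsilon> \<Longrightarrow> \<phi>m x = \<phi>p x"
        using transforms_to_charts[OF F(3) \<rho>p(1) \<rho>m(1)] by metis
      have "gap_estimate \<epsilon> \<rho>p \<rho>m \<phi>p \<phi>m Wp (flip_field Wm) k (\<gamma>p k - (-1) ^ k * \<gamma>m k)"
        using U k by (intro gap_estimate_focus_focus[OF c(1,2) F(1) focus_normal_form_flip[OF F(2)] c(3)])
          (auto, metis eq_iff_diff_eq_0)
      then show "\<exists>\<epsilon> Tp \<phi>p Fp \<phi>m. chart_conjugates \<epsilon> \<rho>p Tp \<phi>p Wp Fp \<and> (\<forall>x. \<bar>x\<bar> < \<epsilon> \<longrightarrow> \<phi>m x = \<phi>p x) \<and>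
        gap_estimate \<epsilon> \<rho>p \<rho>m \<phi>p \<phi>m Wp (flip_field Wm) k (U k)"
        unfolding U[OF k(1)] using c(1,3) by blast
    qed
    then show "algebraically_equivalent V (\<lambda>k. \<gamma>p k + (-1) ^ (k - 1) * \<gamma>m k)" by (simp add: U_def)
  next
    fix lm \<gamma>p assume h: "FP_type Zp Zm lm \<and> FP_normal_form_coeffs Wp Wm lm \<gamma>p"
    then have nf: "\<And>N. N \<ge> 1 \<Longrightarrow> \<exists>Fp Fm. focus_normal_form N \<gamma>p Fp \<and> lower_parabolic_normal_form N lm Fm \<and>
        transforms_to Wp Wm Fp Fm" by (simp add: FP_normal_form_coeffs_def)
    have lm: "lm \<ge> 1" using h by (simp add: FP_type_def parabolic_type_def)
    show "algebraically_equivalent V \<gamma>p"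
    proof (rule main)
      fix k :: nat assume k: "1 \<le> k" "\<And>j. 1 \<le> j \<Longrightarrow> j < k \<Longrightarrow> \<gamma>p j = 0"
      obtain Fp Fm where F: "focus_normal_form k \<gamma>p Fp" "lower_parabolic_normal_form k lm Fm" "transforms_to Wp Wm Fp Fm"
        using nf[OF k(1)] by blast
      obtain \<epsilon> Tp Tm \<phi>p \<phi>m where c: "chart_conjugates \<epsilon> \<rho>p Tp \<phi>p Wp Fp"
        "chart_conjugates \<epsilon> \<rho>m Tm \<phi>m (flip_field Wm) (flip_field Fm)" "\<And>x. \<bar>x\<bar> < \<epsilon> \<Longrightarrow> \<phi>m x = \<phi>p x"
        using transforms_to_charts[OF F(3) \<rho>p(1) \<rho>m(1)] by metis
      have "displacement_estimate \<epsilon> \<rho>p \<phi>p Wp k (\<gamma>p k)" using focus_displacement[OF c(1) F(1) k(1)] k(2) by simp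
      from gap_estimate_displacement[OF this lower[OF c(2) F(2) lm k(1)]]
      show "\<exists>\<epsilon> Tp \<phi>p Fp \<phi>m. chart_conjugates \<epsilon> \<rho>p Tp \<phi>p Wp Fp \<and> (\<forall>x. \<bar>x\<bar> < \<epsilon> \<longrightarrow> \<phi>m x = \<phi>p x) \<and>
        gap_estimate \<epsilon> \<rho>p \<rho>m \<phi>p \<phi>m Wp (flip_field Wm) k (\<gamma>p k)"
        using c(1,3) by blast
    qed
  next
    fix lp lm \<sigma>p assume h: "PP_type Zp Zm lp lm \<and> PP_normal_form_coeffs Wp Wm lp lm \<sigma>p"
    then have nf: "\<And>N. N \<ge> 1 \<Longrightarrow> \<exists>Fp Fm. upper_parabolic_normal_form N lp \<sigma>p Fp \<and>
        lower_parabolic_normal_form N lm Fm \<and> transforms_to Wp Wm Fp Fm" by (simp add: PP_normal_form_coeffs_def)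
    have l: "lp \<ge> 1" "lm \<ge> 1" using h by (auto simp: PP_type_def parabolic_type_def)
    show "algebraically_equivalent V (\<lambda>k. (1 + (-1) ^ k) * \<sigma>p k)"
    proof (rule main)
      fix k :: nat assume k: "1 \<le> k" "\<And>j. 1 \<le> j \<Longrightarrow> j < k \<Longrightarrow> (1 + (-1) ^ j) * \<sigma>p j = 0"
      obtain Fp Fm where F: "upper_parabolic_normal_form k lp \<sigma>p Fp" "lower_parabolic_normal_form k lm Fm" "transforms_to Wp Wm Fp Fm"
        using nf[OF k(1)] by blast
      obtain \<epsilon> Tp Tm \<phi>p \<phi>m where c: "chart_conjugates \<epsilon> \<rho>p Tp \<phi>p Wp Fp"
        "chart_conjugates \<epsilon> \<rho>m Tm \<phi>m (flip_field Wm) (flip_field Fm)" "\<And>x. \<bar>x\<bar> < \<epsilon> \<Longrightarrow> \<phi>m x = \<phi>p x"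
        using transforms_to_charts[OF F(3) \<rho>p(1) \<rho>m(1)] by metis
      have "displacement_estimate \<epsilon> \<rho>p \<phi>p Wp k ((1 + (-1) ^ k) * \<sigma>p k)"
        using parabolic_displacement[OF c(1) F(1) l(1) k(1) k(1)] k(2) by simp
      from gap_estimate_displacement[OF this lower[OF c(2) F(2) l(2) k(1)]]
      show "\<exists>\<epsilon> Tp \<phi>p Fp \<phi>m. chart_conjugates \<epsilon> \<rho>p Tp \<phi>p Wp Fp \<and> (\<forall>x. \<bar>x\<bar> < \<epsilon> \<longrightarrow> \<phi>m x = \<phi>p x) \<and>
        gap_estimate \<epsilon> \<rho>p \<rho>m \<phi>p \<phi>m Wp (flip_field Wm) k ((1 + (-1) ^ k) * \<sigma>p k)"
        using c(1,3) by blast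
    qed
  qed
qed

end
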